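(* Let $f \colon \mathcal{M} \to \mathbb{R}$ be $C^2$ on a real-analytic manifold $\mathcal{M}$ with a Riemannian metric and a real-analytic retraction $\mathrm{R} \colon \mathrm{T}\mathcal{M} \to \mathcal{M}$. For all $\tau, r \in (0,1)$, all $\varepsilon > 0$ and (Lebesgue-)almost any initial step size $\bar\alpha > 0$, Riemannian gradient descent with stabilized Armijo backtracking line-search (the algorithm described in the context) avoids the strict saddles of $f$; that is, the set of initial points $x_0 \in \mathcal{M}$ for which the generated sequence $(x_t)_{t\ge0}$ converges to a strict saddle of $f$ has measure zero in $\mathcal{M}$.
   Context: Manifolds are finite-dimensional, Hausdorff and second countable. A subset $A$ of a smooth $n$-dimensional manifold $\mathcal{M}$ has measure zero if for every smooth chart $(U,\varphi)$ the set $\varphi(A\cap U) \subseteq \mathbb{R}^n$ has Lebesgue measure zero. $\mathrm{grad} f$ and $\mathrm{Hess} f$ denote the Riemannian gradient and Hessian; a strict saddle of $f$ is a point $x^*$ with $\mathrm{grad} f(x^* ) = 0$ at which $\mathrm{Hess} f(x^* )$ has at least one negative eigenvalue. A retraction is a smooth map $\mathrm{R} \colon \mathrm{T}\mathcal{M} \to \mathcal{M}$, $(x,v) \mapsto \mathrm{R}_x(v)$, defined on the whole tangent bundle, such that each curve $c(t) = \mathrm{R}_x(tv)$ satisfies $c(0)=x$ and $c'(0)=v$. A map between real-analytic manifolds is real analytic if it is given by locally convergent power series in real-analytic charts ($\mathrm{T}\mathcal{M}$ is a real-analytic manifold when $\mathcal{M}$ is). The Riemannian metric need not be real analytic. Stabilized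 backtracking Riemannian gradient descent. Inputs: $\tau, r \in (0,1)$, $\bar\alpha > 0$, $\varepsilon > 0$, $x_0 \in \mathcal{M}$. Set $\alpha_0 \leftarrow \bar\alpha$. For $t = 0, 1, 2, \dots$: (i) while $f(x_t) - f(\mathrm{R}_{x_t}(-\alpha_t\, \mathrm{grad} f(x_t))) < r\, \alpha_t \|\mathrm{grad} f(x_t)\|^2$, replace $\alpha_t \leftarrow \tau \alpha_t$; (ii) with the resulting value of $\alpha_t$, set $x_{t+1} \leftarrow \mathrm{R}_{x_t}(-\alpha_t\, \mathrm{grad} f(x_t))$; (iii) if $\|\mathrm{grad} f(x_{t+1})\| \ge \varepsilon$, set $\alpha_{t+1} \leftarrow \bar\alpha$; otherwise set $\alpha_{t+1} \leftarrow \alpha_t$ (the value used in (ii)). *)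

theory Defs
  imports "HOL-Analysis.Analysis" "HOL-Library.While_Combinator"
begin

section \<open>Regularity of maps between open subsets of Euclidean spaces\<close>

primrec Ck_on :: "nat \<Rightarrow> 'a::real_normed_vector set \<Rightarrow> ('a \<Rightarrow> 'b::real_normed_vector) \<Rightarrow> bool" where
  "Ck_on 0 S f \<longleftrightarrow> continuous_on S f"
| "Ck_on (Suc k) S f \<longleftrightarrow>
     (\<forall>x\<in>S. f differentiable (at x)) \<and> (\<forall>v. Ck_on k S (\<lambda>x. frechet_derivative f (at x) v))"

definition smooth_on :: "'a::real_normed_vector set \<Rightarrow> ('a \<Rightarrow> 'b::real_normed_vector) \<Rightarrow> bool" where
  "smooth_on S f \<longleftrightarrow> (\<forall>k. Ck_on k S f)"

text \<open>Multi-indices are the functions from the standard basis to the natural numbers.\<close>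

definition real_analytic_on ::
    "'a::euclidean_space set \<Rightarrow> ('a \<Rightarrow> 'b::real_normed_vector) \<Rightarrow> bool" where
  "real_analytic_on S f \<longleftrightarrow>
     (\<forall>a\<in>S. \<exists>\<rho>>0. \<exists>coef :: ('a \<Rightarrow> nat) \<Rightarrow> 'b. \<forall>x \<in> S \<inter> ball a \<rho>.
        ((\<lambda>k. (\<Prod>i\<in>Basis. ((x - a) \<bullet> i) ^ k i) *\<^sub>R coef k) has_sum f x)
          (Basis \<rightarrow>\<^sub>E (UNIV :: nat set)))"

section \<open>Manifolds\<close>

text \<open>
  A manifold is a type of class \<open>t2_space\<close> and \<open>second_countable_topology\<close> together with an
  atlas \<open>A\<close>, which need not be maximal. The chart domains cover the whole type.
  A chart is a pair of its domain and its coordinate map; the values of the coordinate map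
  outside the domain are irrelevant.
\<close>

type_synonym ('m, 'e) chart = "'m set \<times> ('m \<Rightarrow> 'e)"

abbreviation chart_dom :: "('m, 'e) chart \<Rightarrow> 'm set" where
  "chart_dom c \<equiv> fst c"

abbreviation chart_img :: "('m, 'e) chart \<Rightarrow> 'e set" where
  "chart_img c \<equiv> snd c ` fst c"

abbreviation chart_inv :: "('m, 'e) chart \<Rightarrow> 'e \<Rightarrow> 'm" where
  "chart_inv c \<equiv> inv_into (fst c) (snd c)"

abbreviation transition :: "('m, 'e) chart \<Rightarrow> ('m, 'e) chart \<Rightarrow> 'e \<Rightarrow> 'e" where
  "transition c d \<equiv> snd d \<circ> chart_inv c"

definition is_chart :: "('m::topological_space, 'e::euclidean_space) chart \<Rightarrow> bool" where
  "is_chart c \<longleftrightarrow> open (chart_dom c) \<and> open (chart_img c) \<and>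
     homeomorphism (chart_dom c) (chart_img c) (snd c) (chart_inv c)"

definition real_analytic_atlas ::
    "('m::{t2_space, second_countable_topology}, 'e::euclidean_space) chart set \<Rightarrow> bool" where
  "real_analytic_atlas A \<longleftrightarrow>
     (\<forall>c\<in>A. is_chart c) \<and> (\<Union>c\<in>A. chart_dom c) = UNIV \<and>
     (\<forall>c\<in>A. \<forall>d\<in>A. real_analytic_on (snd c ` (chart_dom c \<inter> chart_dom d)) (transition c d))"

text \<open>The charts of the smooth structure determined by \<open>A\<close>.\<close>

definition smooth_chart ::
    "('m::topological_space, 'e::euclidean_space) chart set \<Rightarrow> ('m, 'e) chart \<Rightarrow> bool" where
  "smooth_chart A c \<longleftrightarrow> is_chart c \<and>
     (\<forall>d\<in>A. smooth_on (snd c ` (chart_dom c \<inter> chart_dom d)) (transition c d) \<and>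
            smooth_on (snd d ` (chart_dom d \<inter> chart_dom c)) (transition d c))"

definition manifold_measure_zero ::
    "('m::topological_space, 'e::euclidean_space) chart set \<Rightarrow> 'm set \<Rightarrow> bool" where
  "manifold_measure_zero A S \<longleftrightarrow>
     (\<forall>c. smooth_chart A c \<longrightarrow> snd c ` (S \<inter> chart_dom c) \<in> null_sets lebesgue)"

definition C2_function ::
    "('m, 'e::euclidean_space) chart set \<Rightarrow> ('m \<Rightarrow> real) \<Rightarrow> bool" where
  "C2_function A f \<longleftrightarrow> (\<forall>c\<in>A. Ck_on 2 (chart_img c) (f \<circ> chart_inv c))"

section \<open>Tangent vectors\<close>

text \<open>
  A tangent vector at \<open>x\<close> is the family of its components in all charts of \<open>A\<close> around \<open>x\<close>,
  related by the derivatives of the transition maps. The components at all other charts are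
  set to \<open>0\<close>, so that equality of tangent vectors is equality of functions.
\<close>

type_synonym ('m, 'e) tangent_vector = "('m, 'e) chart \<Rightarrow> 'e"

definition tangent_space ::
    "('m, 'e::euclidean_space) chart set \<Rightarrow> 'm \<Rightarrow> ('m, 'e) tangent_vector set" where
  "tangent_space A x = {v.
     (\<forall>c\<in>A. \<forall>d\<in>A. x \<in> chart_dom c \<longrightarrow> x \<in> chart_dom d \<longrightarrow>
        v d = frechet_derivative (transition c d) (at (snd c x)) (v c)) \<and>
     (\<forall>c. \<not> (c \<in> A \<and> x \<in> chart_dom c) \<longrightarrow> v c = 0)}"

definition tv_zero :: "('m, 'e::real_vector) tangent_vector" where
  "tv_zero = (\<lambda>c. 0)"

definition tv_add :: "('m, 'e::real_vector) tangent_vector \<Rightarrow> ('m, 'e) tangent_vector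
    \<Rightarrow> ('m, 'e) tangent_vector" where
  "tv_add v w = (\<lambda>c. v c + w c)"

definition tv_scale :: "real \<Rightarrow> ('m, 'e::real_vector) tangent_vector
    \<Rightarrow> ('m, 'e) tangent_vector" where
  "tv_scale a v = (\<lambda>c. a *\<^sub>R v c)"

text \<open>The tangent vector at \<open>x\<close> whose component in the chart \<open>c\<close> is \<open>u\<close>.\<close>

definition tv_of_coord ::
    "('m, 'e::euclidean_space) chart set \<Rightarrow> ('m, 'e) chart \<Rightarrow> 'm \<Rightarrow> 'e \<Rightarrow> ('m, 'e) tangent_vector"
  where
  "tv_of_coord A c x u = (\<lambda>d. if d \<in> A \<and> x \<in> chart_dom d
     then frechet_derivative (transition c d) (at (snd c x)) u else 0)"

definition chart_at :: "('m, 'e) chart set \<Rightarrow> 'm \<Rightarrow> ('m, 'e) chart" where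
  "chart_at A x = (SOME c. c \<in> A \<and> x \<in> chart_dom c)"

definition differential ::
    "('m, 'e::euclidean_space) chart set \<Rightarrow> ('m \<Rightarrow> real) \<Rightarrow> 'm \<Rightarrow> ('m, 'e) tangent_vector \<Rightarrow> real"
  where
  "differential A f x v =
     (let c = chart_at A x in frechet_derivative (f \<circ> chart_inv c) (at (snd c x)) (v c))"

section \<open>Riemannian metrics, gradient and Hessian\<close>

type_synonym ('m, 'e) metric =
  "'m \<Rightarrow> ('m, 'e) tangent_vector \<Rightarrow> ('m, 'e) tangent_vector \<Rightarrow> real"

text \<open>The value of the metric on the vectors with components \<open>u\<close>, \<open>w\<close> in the chart \<open>c\<close>, at the
  point with coordinates \<open>p\<close>.\<close>

definition metric_coord ::
    "('m, 'e::euclidean_space) chart set \<Rightarrow> ('m, 'e) metric \<Rightarrow> ('m, 'e) chart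
      \<Rightarrow> 'e \<Rightarrow> 'e \<Rightarrow> 'e \<Rightarrow> real" where
  "metric_coord A g c p u w =
     g (chart_inv c p) (tv_of_coord A c (chart_inv c p) u) (tv_of_coord A c (chart_inv c p) w)"

definition riemannian_metric ::
    "('m, 'e::euclidean_space) chart set \<Rightarrow> ('m, 'e) metric \<Rightarrow> bool" where
  "riemannian_metric A g \<longleftrightarrow>
     (\<forall>x. \<forall>u\<in>tangent_space A x. \<forall>v\<in>tangent_space A x. \<forall>w\<in>tangent_space A x. \<forall>a.
        g x (tv_add u v) w = g x u w + g x v w \<and>
        g x (tv_scale a u) w = a * g x u w \<and>
        g x u w = g x w u) \<and>
     (\<forall>x. \<forall>v\<in>tangent_space A x. v \<noteq> tv_zero \<longrightarrow> g x v v > 0) \<and>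
     (\<forall>c\<in>A. \<forall>u w. smooth_on (chart_img c) (\<lambda>p. metric_coord A g c p u w))"

definition tv_norm :: "('m, 'e) metric \<Rightarrow> 'm \<Rightarrow> ('m, 'e) tangent_vector \<Rightarrow> real" where
  "tv_norm g x v = sqrt (g x v v)"

definition grad ::
    "('m, 'e::euclidean_space) chart set \<Rightarrow> ('m, 'e) metric \<Rightarrow> ('m \<Rightarrow> real)
      \<Rightarrow> 'm \<Rightarrow> ('m, 'e) tangent_vector" where
  "grad A g f x = (THE z. z \<in> tangent_space A x \<and>
     (\<forall>w\<in>tangent_space A x. g x z w = differential A f x w))"

text \<open>
  The Levi-Civita connection: the covariant derivative at \<open>x\<close> of the vector field \<open>V\<close> in the
  direction \<open>v\<close>. In a chart, \<open>\<nabla>\<^sub>v V = DV(v) + \<Gamma>(v, V)\<close>, where by the Koszul formula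
  \<open>2 g(\<Gamma>(v, V), w) = (\<partial>\<^sub>v g)(V, w) + (\<partial>\<^sub>V g)(v, w) - (\<partial>\<^sub>w g)(v, V)\<close>;
  the vector \<open>\<nabla>\<^sub>v V\<close> is characterised by its inner products with all \<open>w\<close>.
\<close>

definition covariant_derivative ::
    "('m, 'e::euclidean_space) chart set \<Rightarrow> ('m, 'e) metric \<Rightarrow> ('m \<Rightarrow> ('m, 'e) tangent_vector)
      \<Rightarrow> 'm \<Rightarrow> ('m, 'e) tangent_vector \<Rightarrow> ('m, 'e) tangent_vector" where
  "covariant_derivative A g V x v = (let c = chart_at A x; p = snd c x; G = metric_coord A g c in
     THE z. z \<in> tangent_space A x \<and> (\<forall>w\<in>tangent_space A x.
       g x z w =
         G p (frechet_derivative (\<lambda>q. V (chart_inv c q) c) (at p) (v c)) (w c) +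
         (frechet_derivative (\<lambda>q. G q (V x c) (w c)) (at p) (v c) +
          frechet_derivative (\<lambda>q. G q (v c) (w c)) (at p) (V x c) -
          frechet_derivative (\<lambda>q. G q (v c) (V x c)) (at p) (w c)) / 2))"

definition hessian ::
    "('m, 'e::euclidean_space) chart set \<Rightarrow> ('m, 'e) metric \<Rightarrow> ('m \<Rightarrow> real)
      \<Rightarrow> 'm \<Rightarrow> ('m, 'e) tangent_vector \<Rightarrow> ('m, 'e) tangent_vector" where
  "hessian A g f x v = covariant_derivative A g (grad A g f) x v"

definition strict_saddle ::
    "('m, 'e::euclidean_space) chart set \<Rightarrow> ('m, 'e) metric \<Rightarrow> ('m \<Rightarrow> real) \<Rightarrow> 'm \<Rightarrow> bool" where
  "strict_saddle A g f x \<longleftrightarrow> grad A g f x = tv_zero \<and>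
     (\<exists>ev<0. \<exists>v\<in>tangent_space A x. v \<noteq> tv_zero \<and> hessian A g f x v = tv_scale ev v)"

section \<open>Retractions\<close>

text \<open>
  The tangent bundle has the charts \<open>(x, v) \<mapsto> (\<phi> x, v\<^sub>\<phi>)\<close>, for \<open>\<phi>\<close> in \<open>A\<close>, with image
  \<open>chart_img c \<times> UNIV\<close>. A map \<open>F\<close> from the tangent bundle to the manifold, given as a function of
  the base point and the vector, has regularity \<open>reg\<close> if it is continuous and has regularity
  \<open>reg\<close> in charts. Values of \<open>F\<close> at vectors not tangent at the base point are irrelevant.
\<close>

definition bundle_map_coord ::
    "('m, 'e::euclidean_space) chart set \<Rightarrow> ('m \<Rightarrow> ('m, 'e) tangent_vector \<Rightarrow> 'm)
      \<Rightarrow> ('m, 'e) chart \<Rightarrow> 'e \<times> 'e \<Rightarrow> 'm" where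
  "bundle_map_coord A F c = (\<lambda>(p, u). F (chart_inv c p) (tv_of_coord A c (chart_inv c p) u))"

definition regular_bundle_map ::
    "(('e \<times> 'e) set \<Rightarrow> ('e \<times> 'e \<Rightarrow> 'e) \<Rightarrow> bool)
      \<Rightarrow> ('m::topological_space, 'e::euclidean_space) chart set
      \<Rightarrow> ('m \<Rightarrow> ('m, 'e) tangent_vector \<Rightarrow> 'm) \<Rightarrow> bool" where
  "regular_bundle_map reg A F \<longleftrightarrow> (\<forall>c\<in>A.
     continuous_on (chart_img c \<times> UNIV) (bundle_map_coord A F c) \<and>
     (\<forall>d\<in>A. reg {z \<in> chart_img c \<times> UNIV. bundle_map_coord A F c z \<in> chart_dom d}
                (snd d \<circ> bundle_map_coord A F c)))"

definition is_retraction ::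
    "('m::topological_space, 'e::euclidean_space) chart set
      \<Rightarrow> ('m \<Rightarrow> ('m, 'e) tangent_vector \<Rightarrow> 'm) \<Rightarrow> bool" where
  "is_retraction A R \<longleftrightarrow> regular_bundle_map smooth_on A R \<and>
     (\<forall>x. \<forall>v\<in>tangent_space A x.
        R x (tv_scale 0 v) = x \<and>
        (\<forall>d\<in>A. x \<in> chart_dom d \<longrightarrow>
           ((\<lambda>t. snd d (R x (tv_scale t v))) has_vector_derivative v d) (at 0)))"

definition real_analytic_bundle_map ::
    "('m::topological_space, 'e::euclidean_space) chart set
      \<Rightarrow> ('m \<Rightarrow> ('m, 'e) tangent_vector \<Rightarrow> 'm) \<Rightarrow> bool" where
  "real_analytic_bundle_map A F \<longleftrightarrow> regular_bundle_map real_analytic_on A F"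

section \<open>Riemannian gradient descent with stabilized backtracking\<close>

definition gd_step ::
    "('m, 'e::euclidean_space) chart set \<Rightarrow> ('m, 'e) metric
      \<Rightarrow> ('m \<Rightarrow> ('m, 'e) tangent_vector \<Rightarrow> 'm) \<Rightarrow> ('m \<Rightarrow> real) \<Rightarrow> 'm \<Rightarrow> real \<Rightarrow> 'm" where
  "gd_step A g R f x \<alpha> = R x (tv_scale (- \<alpha>) (grad A g f x))"

definition backtrack ::
    "('m, 'e::euclidean_space) chart set \<Rightarrow> ('m, 'e) metric
      \<Rightarrow> ('m \<Rightarrow> ('m, 'e) tangent_vector \<Rightarrow> 'm) \<Rightarrow> ('m \<Rightarrow> real) \<Rightarrow> real \<Rightarrow> real \<Rightarrow> 'm \<Rightarrow> real \<Rightarrow> real"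
  where
  "backtrack A g R f \<tau> r x \<alpha>0 =
     while (\<lambda>\<alpha>. f x - f (gd_step A g R f x \<alpha>) < r * \<alpha> * (tv_norm g x (grad A g f x))\<^sup>2)
       (\<lambda>\<alpha>. \<tau> * \<alpha>) \<alpha>0"

text \<open>The state at time \<open>t\<close> is the iterate \<open>x\<^sub>t\<close> with the step size \<open>\<alpha>\<^sub>t\<close> before backtracking.\<close>

primrec stabilized_rgd_state ::
    "('m, 'e::euclidean_space) chart set \<Rightarrow> ('m, 'e) metric
      \<Rightarrow> ('m \<Rightarrow> ('m, 'e) tangent_vector \<Rightarrow> 'm) \<Rightarrow> ('m \<Rightarrow> real)
      \<Rightarrow> real \<Rightarrow> real \<Rightarrow> real \<Rightarrow> real \<Rightarrow> 'm \<Rightarrow> nat \<Rightarrow> 'm \<times> real" where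
  "stabilized_rgd_state A g R f \<tau> r \<epsilon> \<alpha>bar x0 0 = (x0, \<alpha>bar)"
| "stabilized_rgd_state A g R f \<tau> r \<epsilon> \<alpha>bar x0 (Suc t) =
     (let (x, \<alpha>0) = stabilized_rgd_state A g R f \<tau> r \<epsilon> \<alpha>bar x0 t;
          \<alpha> = backtrack A g R f \<tau> r x \<alpha>0;
          y = gd_step A g R f x \<alpha>
      in (y, if tv_norm g y (grad A g f y) \<ge> \<epsilon> then \<alpha>bar else \<alpha>))"

definition stabilized_rgd ::
    "('m, 'e::euclidean_space) chart set \<Rightarrow> ('m, 'e) metric
      \<Rightarrow> ('m \<Rightarrow> ('m, 'e) tangent_vector \<Rightarrow> 'm) \<Rightarrow> ('m \<Rightarrow> real)
      \<Rightarrow> real \<Rightarrow> real \<Rightarrow> real \<Rightarrow> real \<Rightarrow> 'm \<Rightarrow> nat \<Rightarrow> 'm" where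
  "stabilized_rgd A g R f \<tau> r \<epsilon> \<alpha>bar x0 t = fst (stabilized_rgd_state A g R f \<tau> r \<epsilon> \<alpha>bar x0 t)"

end

theory Submission
  imports Defs "HOL-Complex_Analysis.Complex_Analysis" "Jordan_Normal_Form.Determinant"
begin

text \<open>
  For a fixed step size \<open>\<alpha>\<close> let \<open>\<Psi>\<^sub>\<alpha>(x) = R\<^sub>x(-\<alpha> grad f(x))\<close>. In charts the determinant of \<open>D\<Psi>\<^sub>\<alpha>(x)\<close> is, for
  fixed \<open>x\<close>, a real-analytic function of \<open>\<alpha>\<close> that does not vanish at \<open>\<alpha> = 0\<close>; hence it has only countably
  many zeros, and by Fubini, for almost every \<open>\<alpha>\<close>, \<open>D\<Psi>\<^sub>\<alpha>(x)\<close> is invertible for almost every \<open>x\<close>. For such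
  \<open>\<alpha>\<close> the preimages of null sets under \<open>\<Psi>\<^sub>\<alpha>\<close> are null.

  The Armijo condition holds for all small step sizes uniformly near every point, so a run that converges
  to a critical point eventually uses one fixed step size \<open>\<tau>\<^sup>k \<alpha>bar\<close>. At a strict saddle,
  \<open>D\<Psi>\<^sub>\<alpha> = I - \<alpha> Hess f\<close> is self-adjoint for the metric and has an eigenvalue larger than \<open>1\<close>. There is then a
  quadratic form that is positive on the corresponding eigenvector \<open>v\<close> and grows by a factor larger than \<open>1\<close>
  along the difference of two orbits. Thus the set of points whose orbits stay near the saddle meets every
  line of direction \<open>v\<close> at most once; being compact, it is null because its translates along \<open>v\<close> are disjoint.
  No stable manifold theorem is needed. The theorem follows by taking countably many preimages.
\<close>

text \<open>The regularity is uneven, and this shapes the argument. With \<open>f\<close> only C^2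
  and the metric only smooth, the gradient is only C^1, so the determinant need not be analytic in
  the point. For a fixed point the gradient is a constant vector, and analyticity of the retraction
  alone makes the determinant analytic in \<alpha>. As \<alpha> varies, the new point moves from
  chart to chart, so no single determinant is defined on the whole line. The vanishing of the
  determinant is shown to be independent of the target chart, and an open-closed argument starting
  from \<alpha> = 0 connects the local pieces.

  The step sizes of a run depend on its initial point, but all of them have the form \<tau>^k times
  the initial step size. One null set of initial step sizes therefore excludes every bad step, and
  only countably many finite prefixes of steps occur. The stabilizing rule enters where the gradient
  norm is below \<epsilon>: there the step size is carried over, so it can only decrease. Strict
  saddles may form a continuum; second countability reduces their neighbourhoods to countably
  many.\<close>

no_notation scalar_prod (infix "\<bullet>" 70)
no_notation vec_index (infixl "$" 100)
notation vec_index (infixl "$v" 100)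

section \<open>Strict differentiability\<close>

text \<open>
  Strict differentiability stands in for \<open>C\<^sup>1\<close>: it is a condition at a single point that still provides
  local Lipschitz inverses, is inherited by solutions of linear systems, and makes the derivative continuous.
\<close>

definition strict_deriv ::
  "('a::real_normed_vector \<Rightarrow> 'b::real_normed_vector) \<Rightarrow> ('a \<Rightarrow> 'b) \<Rightarrow> 'a \<Rightarrow> bool" where
  "strict_deriv F L p \<longleftrightarrow> bounded_linear L \<and>
     (\<forall>e>0. \<exists>d>0. \<forall>x\<in>ball p d. \<forall>y\<in>ball p d. norm (F x - F y - L (x - y)) \<le> e * norm (x - y))"

lemma strict_derivE:
  assumes "strict_deriv F L p" "e > 0"
  obtains d where "d > 0"
    "\<And>x y. x \<in> ball p d \<Longrightarrow> y \<in> ball p d \<Longrightarrow> norm (F x - F y - L (x - y)) \<le> e * norm (x - y)"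
  using assms unfolding strict_deriv_def by blast

lemma strict_deriv_bounded_linear: "strict_deriv F L p \<Longrightarrow> bounded_linear L"
  by (simp add: strict_deriv_def)

lemma strict_deriv_has_derivative:
  assumes "strict_deriv F L p"
  shows "(F has_derivative L) (at p)"
proof (rule has_derivativeI_sandwich[where e=1 and H="\<lambda>y. norm (F y - F p - L (y - p)) / norm (y - p)"])
  show "bounded_linear L" using assms by (rule strict_deriv_bounded_linear)
  show "((\<lambda>y. norm (F y - F p - L (y - p)) / norm (y - p)) \<longlongrightarrow> 0) (at p)"
  proof (rule LIM_I)
    fix r :: real assume "r > 0"
    then obtain d where d: "d > 0"
      "\<And>x y. x \<in> ball p d \<Longrightarrow> y \<in> ball p d \<Longrightarrow> norm (F x - F y - L (x - y)) \<le> r/2 * norm (x - y)"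
      using strict_derivE[OF assms, of "r/2"] by auto
    show "\<exists>s>0. \<forall>x. x \<noteq> p \<and> norm (x - p) < s \<longrightarrow>
        norm (norm (F x - F p - L (x - p)) / norm (x - p) - 0) < r"
    proof (intro exI[of _ d] conjI d allI impI)
      fix x assume x: "x \<noteq> p \<and> norm (x - p) < d"
      then have "norm (F x - F p - L (x - p)) \<le> r/2 * norm (x - p)"
        using d(1) by (intro d(2)) (auto simp: dist_norm norm_minus_commute)
      also have "\<dots> < r * norm (x - p)" using x \<open>r > 0\<close> by simp
      finally show "norm (norm (F x - F p - L (x - p)) / norm (x - p) - 0) < r"
        using x by (simp add: divide_less_eq)
    qed
  qed
qed auto

lemma strict_deriv_unique:
  assumes "strict_deriv F L p" shows "frechet_derivative F (at p) = L"
  using strict_deriv_has_derivative[OF assms] by (metis frechet_derivative_at)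

lemma strict_deriv_lipschitz:
  assumes "strict_deriv F L p"
  obtains d C where "d > 0" "C > 0"
    "\<And>x y. x \<in> ball p d \<Longrightarrow> y \<in> ball p d \<Longrightarrow> norm (F x - F y) \<le> C * norm (x - y)"
proof -
  obtain K where K: "K > 0" "\<And>x. norm (L x) \<le> norm x * K"
    using bounded_linear.pos_bounded[OF strict_deriv_bounded_linear[OF assms]] by blast
  obtain d where d: "d > 0"
    "\<And>x y. x \<in> ball p d \<Longrightarrow> y \<in> ball p d \<Longrightarrow> norm (F x - F y - L (x - y)) \<le> 1 * norm (x - y)"
    using strict_derivE[OF assms, of 1] by auto
  show ?thesis
  proof (rule that[of d "K+1"])
    fix x y assume "x \<in> ball p d" "y \<in> ball p d"
    from d(2)[OF this] K(2)[of "x - y"] norm_triangle_sub[of "F x - F y" "L (x - y)"]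
    show "norm (F x - F y) \<le> (K+1) * norm (x - y)" by (simp add: algebra_simps)
  qed (use d K in auto)
qed

lemma strict_deriv_cong:
  assumes "strict_deriv F L p" "open S" "p \<in> S" "\<And>x. x \<in> S \<Longrightarrow> F x = G x"
  shows "strict_deriv G L p"
  unfolding strict_deriv_def
proof (intro conjI allI impI)
  show "bounded_linear L" using assms by (simp add: strict_deriv_bounded_linear)
  fix e :: real assume "e > 0"
  obtain d where d: "d > 0"
    "\<And>x y. x \<in> ball p d \<Longrightarrow> y \<in> ball p d \<Longrightarrow> norm (F x - F y - L (x - y)) \<le> e * norm (x - y)"
    using strict_derivE[OF assms(1) \<open>e > 0\<close>] by auto
  obtain d' where d': "d' > 0" "ball p d' \<subseteq> S" using assms openE by metis
  show "\<exists>d>0. \<forall>x\<in>ball p d. \<forall>y\<in>ball p d. norm (G x - G y - L (x - y)) \<le> e * norm (x - y)"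
  proof (intro exI[of _ "min d d'"] conjI ballI)
    fix x y assume xy: "x \<in> ball p (min d d')" "y \<in> ball p (min d d')"
    then have "x \<in> S" "y \<in> S" using d'(2) by auto
    then show "norm (G x - G y - L (x - y)) \<le> e * norm (x - y)"
      using d(2)[of x y] xy assms(4) by simp
  qed (use d d' in auto)
qed

lemma strict_deriv_linear:
  assumes "bounded_linear L" shows "strict_deriv L L p"
  using assms by (auto simp: strict_deriv_def linear_diff[OF bounded_linear.linear] intro: exI[of _ 1])

lemma strict_deriv_const: "strict_deriv (\<lambda>x. c) (\<lambda>x. 0) p"
  by (auto simp: strict_deriv_def intro: exI[of _ 1])

lemma strict_deriv_compose:
  assumes F: "strict_deriv F L p" and G: "strict_deriv G M (F p)"
  shows "strict_deriv (\<lambda>x. G (F x)) (\<lambda>x. M (L x)) p"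
  unfolding strict_deriv_def
proof (intro conjI allI impI)
  show "bounded_linear (\<lambda>x. M (L x))"
    by (rule bounded_linear_compose[OF strict_deriv_bounded_linear[OF G] strict_deriv_bounded_linear[OF F]])
  fix e :: real assume e: "e > 0"
  obtain d C where d: "d > 0" "C > 0"
    "\<And>x y. x \<in> ball p d \<Longrightarrow> y \<in> ball p d \<Longrightarrow> norm (F x - F y) \<le> C * norm (x - y)"
    using strict_deriv_lipschitz[OF F] by blast
  obtain K where K: "K > 0" "\<And>x. norm (M x) \<le> norm x * K"
    using bounded_linear.pos_bounded[OF strict_deriv_bounded_linear[OF G]] by blast
  obtain d1 where d1: "d1 > 0" "\<And>x y. x \<in> ball p d1 \<Longrightarrow> y \<in> ball p d1 \<Longrightarrow>
      norm (F x - F y - L (x - y)) \<le> e / (2 * K) * norm (x - y)"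
    using strict_derivE[OF F, of "e / (2 * K)"] e K by auto
  obtain d2 where d2: "d2 > 0" "\<And>x y. x \<in> ball (F p) d2 \<Longrightarrow> y \<in> ball (F p) d2 \<Longrightarrow>
      norm (G x - G y - M (x - y)) \<le> e / (2 * C) * norm (x - y)"
    using strict_derivE[OF G, of "e / (2 * C)"] e d by auto
  \<comment> \<open>The radius \<open>d2 / C\<close> makes \<open>F\<close>, which is Lipschitz with
    constant \<open>C\<close>, send \<open>ball p r\<close> into \<open>ball (F p) d2\<close>, where
    the estimate for \<open>G\<close> holds.\<close>
  define r where "r = min (min d d1) (d2 / C)"
  show "\<exists>r>0. \<forall>x\<in>ball p r. \<forall>y\<in>ball p r.
      norm (G (F x) - G (F y) - M (L (x - y))) \<le> e * norm (x - y)"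
  proof (intro exI[of _ r] conjI ballI)
    show "r > 0" using d d1 d2 by (simp add: r_def)
    have inF: "F x \<in> ball (F p) d2" if "x \<in> ball p r" for x
    proof -
      have "norm (F x - F p) \<le> C * norm (x - p)"
        using that d by (intro d(3)) (auto simp: r_def)
      also have "\<dots> < C * (d2 / C)"
        using that d(2) by (intro mult_strict_left_mono) (auto simp: r_def dist_norm norm_minus_commute)
      finally show ?thesis using d(2) by (simp add: dist_norm norm_minus_commute)
    qed
    fix x y assume xy: "x \<in> ball p r" "y \<in> ball p r"
    have 1: "norm (G (F x) - G (F y) - M (F x - F y)) \<le> e / (2*C) * norm (F x - F y)"
      using inF xy by (intro d2) auto
    have 2: "norm (F x - F y) \<le> C * norm (x - y)" using xy by (intro d(3)) (auto simp: r_def)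
    have "e / (2*C) * norm (F x - F y) \<le> e / (2*C) * (C * norm (x - y))"
      using 2 e d by (intro mult_left_mono) auto
    also have "\<dots> = e/2 * norm (x - y)" using d by simp
    finally have 3: "norm (G (F x) - G (F y) - M (F x - F y)) \<le> e/2 * norm (x - y)"
      by (rule order_trans[OF 1])
    have "norm (F x - F y - L (x - y)) \<le> e / (2 * K) * norm (x - y)"
      using xy by (intro d1) (auto simp: r_def)
    then have "norm (F x - F y - L (x - y)) * K \<le> e / (2 * K) * norm (x - y) * K"
      using K by (intro mult_right_mono) auto
    also have "\<dots> = e/2 * norm (x - y)" using K by simp
    finally have 4: "norm (M (F x - F y - L (x - y))) \<le> e/2 * norm (x - y)"
      using K(2)[of "F x - F y - L (x - y)"] by simp
    have "G (F x) - G (F y) - M (L (x - y)) =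
        (G (F x) - G (F y) - M (F x - F y)) + M (F x - F y - L (x - y))"
      using linear_diff[OF bounded_linear.linear[OF strict_deriv_bounded_linear[OF G]]] by simp
    then show "norm (G (F x) - G (F y) - M (L (x - y))) \<le> e * norm (x - y)"
      using norm_triangle_mono[OF 3 4] by (simp add: field_simps)
  qed
qed

lemma strict_deriv_Pair:
  assumes F: "strict_deriv F L p" and G: "strict_deriv G M p"
  shows "strict_deriv (\<lambda>x. (F x, G x)) (\<lambda>x. (L x, M x)) p"
  unfolding strict_deriv_def
proof (intro conjI allI impI)
  show "bounded_linear (\<lambda>x. (L x, M x))"
    by (rule bounded_linear_Pair[OF strict_deriv_bounded_linear[OF F] strict_deriv_bounded_linear[OF G]])
  fix e :: real assume e: "e > 0"
  obtain d1 where d1: "d1 > 0" "\<And>x y. x \<in> ball p d1 \<Longrightarrow> y \<in> ball p d1 \<Longrightarrow>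
      norm (F x - F y - L (x - y)) \<le> e / 2 * norm (x - y)"
    using strict_derivE[OF F, of "e / 2"] e by auto
  obtain d2 where d2: "d2 > 0" "\<And>x y. x \<in> ball p d2 \<Longrightarrow> y \<in> ball p d2 \<Longrightarrow>
      norm (G x - G y - M (x - y)) \<le> e / 2 * norm (x - y)"
    using strict_derivE[OF G, of "e / 2"] e by auto
  show "\<exists>d>0. \<forall>x\<in>ball p d. \<forall>y\<in>ball p d.
      norm ((F x, G x) - (F y, G y) - (L (x - y), M (x - y))) \<le> e * norm (x - y)"
  proof (intro exI[of _ "min d1 d2"] conjI ballI)
    fix x y assume "x \<in> ball p (min d1 d2)" "y \<in> ball p (min d1 d2)"
    then have "norm (F x - F y - L (x - y)) + norm (G x - G y - M (x - y))
        \<le> e/2 * norm (x - y) + e/2 * norm (x - y)"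
      by (intro add_mono d1 d2) auto
    then show "norm ((F x, G x) - (F y, G y) - (L (x - y), M (x - y))) \<le> e * norm (x - y)"
      using norm_Pair_le[of "F x - F y - L (x - y)" "G x - G y - M (x - y)"] by simp
  qed (use d1 d2 in auto)
qed

lemma strict_deriv_add:
  assumes "strict_deriv F L p" "strict_deriv G M p"
  shows "strict_deriv (\<lambda>x. F x + G x) (\<lambda>x. L x + M x) p"
proof -
  have "bounded_linear (\<lambda>z::'b \<times> 'b. fst z + snd z)"
    by (intro bounded_linear_add bounded_linear_fst bounded_linear_snd)
  from strict_deriv_compose[OF strict_deriv_Pair[OF assms] strict_deriv_linear[OF this]]
  show ?thesis by simp
qed

lemma strict_deriv_sum:
  assumes "finite I" "\<And>i. i \<in> I \<Longrightarrow> strict_deriv (F i) (L i) p"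
  shows "strict_deriv (\<lambda>x. \<Sum>i\<in>I. F i x) (\<lambda>x. \<Sum>i\<in>I. L i x) p"
  using assms by (induction I) (auto intro: strict_deriv_const strict_deriv_add)

lemma (in bounded_bilinear) strict_deriv_bilinear:
  "strict_deriv (\<lambda>z. prod (fst z) (snd z)) (\<lambda>z. prod (fst q) (snd z) + prod (fst z) (snd q)) q"
  unfolding strict_deriv_def
proof (intro conjI allI impI)
  show "bounded_linear (\<lambda>z. prod (fst q) (snd z) + prod (fst z) (snd q))"
    by (intro bounded_linear_add bounded_linear_compose[OF bounded_linear_left bounded_linear_fst]
        bounded_linear_compose[OF bounded_linear_right bounded_linear_snd])
  fix e :: real assume e: "e > 0"
  obtain K where K: "K > 0" "\<And>a b. norm (prod a b) \<le> norm a * norm b * K"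
    using pos_bounded by blast
  show "\<exists>d>0. \<forall>x\<in>ball q d. \<forall>y\<in>ball q d.
      norm (prod (fst x) (snd x) - prod (fst y) (snd y)
         - (prod (fst q) (snd (x - y)) + prod (fst (x - y)) (snd q))) \<le> e * norm (x - y)"
  proof (intro exI[of _ "e / (2 * K)"] conjI ballI)
    show "e / (2 * K) > 0" using e K by simp
    fix x y assume xy: "x \<in> ball q (e / (2 * K))" "y \<in> ball q (e / (2 * K))"
    \<comment> \<open>Each term pairs a component of \<open>x - y\<close> with a component of
      \<open>x - q\<close> or \<open>y - q\<close>, so the remainder is small relative to
      \<open>x - y\<close>, not just relative to the distance from \<open>q\<close>.\<close>
    have eq: "prod (fst x) (snd x) - prod (fst y) (snd y)
         - (prod (fst q) (snd (x - y)) + prod (fst (x - y)) (snd q))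
       = prod (fst (x - q)) (snd (x - y)) + prod (fst (x - y)) (snd (y - q))"
      by (simp add: diff_left diff_right)
    have n1: "norm (fst (x - q)) \<le> e / (2*K)" "norm (snd (y - q)) \<le> e / (2*K)"
      using xy norm_fst_le[of "fst (x-q)" "snd (x-q)"] norm_snd_le[of "snd (y-q)" "fst (y-q)"]
      unfolding prod.collapse mem_ball dist_norm norm_minus_commute[of q] by linarith+
    have n2: "norm (fst (x - y)) \<le> norm (x - y)" "norm (snd (x - y)) \<le> norm (x - y)"
      using norm_fst_le[of "fst (x-y)" "snd (x-y)"] norm_snd_le[of "snd (x-y)" "fst (x-y)"]
      unfolding prod.collapse by blast+
    have "norm (prod (fst (x - q)) (snd (x - y))) \<le> norm (fst (x - q)) * norm (snd (x - y)) * K"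
      by (rule K)
    also have "\<dots> \<le> e / (2*K) * norm (x - y) * K"
      using n1 n2 K e by (intro mult_right_mono mult_mono) auto
    finally have 1: "norm (prod (fst (x - q)) (snd (x - y))) \<le> e/2 * norm (x - y)"
      using K by simp
    have "norm (prod (fst (x - y)) (snd (y - q))) \<le> norm (fst (x - y)) * norm (snd (y - q)) * K"
      by (rule K)
    also have "\<dots> \<le> norm (x - y) * (e / (2*K)) * K"
      using n1 n2 K e by (intro mult_right_mono mult_mono) auto
    finally have 2: "norm (prod (fst (x - y)) (snd (y - q))) \<le> e/2 * norm (x - y)"
      using K by (simp add: mult.commute)
    show "norm (prod (fst x) (snd x) - prod (fst y) (snd y)
         - (prod (fst q) (snd (x - y)) + prod (fst (x - y)) (snd q))) \<le> e * norm (x - y)"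
      unfolding eq using norm_triangle_mono[OF 1 2] by (simp add: field_simps)
  qed
qed

lemma (in bounded_bilinear) strict_deriv_prod:
  assumes "strict_deriv F L p" "strict_deriv G M p"
  shows "strict_deriv (\<lambda>x. prod (F x) (G x)) (\<lambda>x. prod (F p) (M x) + prod (L x) (G p)) p"
  using strict_deriv_compose[OF strict_deriv_Pair[OF assms] strict_deriv_bilinear] by simp

lemma linear_inj_lower_bound:
  fixes L :: "'a::real_normed_vector \<Rightarrow> 'b::euclidean_space"
  assumes "bounded_linear L" "\<And>x. L x = 0 \<Longrightarrow> x = 0"
  obtains m where "m > 0" "\<And>x. m * norm x \<le> norm (L x)"
proof -
  have lin: "linear L" by (rule bounded_linear.linear[OF assms(1)])
  then have "inj L" using assms(2) by (simp add: linear_injective_0)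
  then show ?thesis using linear_inj_bounded_below_pos[OF lin] that by blast
qed

text \<open>The two-point estimate shows that \<open>F\<close> shrinks distances near
  \<open>p\<close> by no more than the factor \<open>m/2\<close>, where \<open>m\<close> is a lower
  bound of \<open>L\<close>. Hence \<open>F\<close> is injective there with a Lipschitz inverse,
  which carries the null image back to a null set. A set that is null near each of its points is
  null.\<close>

lemma strict_deriv_negligible_preimage:
  fixes F :: "'a::euclidean_space \<Rightarrow> 'a"
  assumes sd: "\<And>p. p \<in> Y \<Longrightarrow> \<exists>L. strict_deriv F L p \<and> (\<forall>x. L x = 0 \<longrightarrow> x = 0)"
    and N: "F ` Y \<subseteq> N" "negligible N"
  shows "negligible Y"
  unfolding locally_negligible_alt[of Y]
proof
  fix p assume p: "p \<in> Y"
  obtain L where L: "strict_deriv F L p" "\<And>x. L x = 0 \<Longrightarrow> x = 0" using sd[OF p] by blast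
  obtain m where m: "m > 0" "\<And>x. m * norm x \<le> norm (L x)"
    using linear_inj_lower_bound[OF strict_deriv_bounded_linear[OF L(1)] L(2)] by blast
  obtain d where d: "d > 0" "\<And>x y. x \<in> ball p d \<Longrightarrow> y \<in> ball p d \<Longrightarrow>
      norm (F x - F y - L (x - y)) \<le> m/2 * norm (x - y)"
    using strict_derivE[OF L(1), of "m/2"] m by auto
  define U where "U = Y \<inter> ball p d"
  have low: "m/2 * norm (x - y) \<le> norm (F x - F y)" if "x \<in> U" "y \<in> U" for x y
    using d(2)[of x y] m(2)[of "x - y"] norm_triangle_sub[of "L (x - y)" "F x - F y"] that
    by (simp add: U_def norm_minus_commute)
  have inj: "inj_on F U"
  proof (rule inj_onI)
    fix x y assume "x \<in> U" "y \<in> U" "F x = F y"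
    with low[of x y] have "m/2 * norm (x - y) \<le> 0" by simp
    then show "x = y" using m(1) by (simp add: mult_le_0_iff)
  qed
  have "negligible (F ` U)" using N negligible_subset by (metis U_def Int_lower1 image_mono)
  then have "negligible (inv_into U F ` F ` U)"
  proof (rule negligible_locally_Lipschitz_image[OF order_refl])
    fix x assume "x \<in> F ` U"
    show "\<exists>T B. open T \<and> x \<in> T \<and>
        (\<forall>y\<in>F ` U \<inter> T. norm (inv_into U F y - inv_into U F x) \<le> B * norm (y - x))"
    proof (intro exI[of _ UNIV] exI[of _ "2/m"] conjI ballI)
      fix y assume "y \<in> F ` U \<inter> UNIV"
      with \<open>x \<in> F ` U\<close> obtain a b where ab: "a \<in> U" "b \<in> U" "x = F a" "y = F b" by blast
      then show "norm (inv_into U F y - inv_into U F x) \<le> 2/m * norm (y - x)"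
        using low[of b a] inj m(1) by (simp add: field_simps)
    qed auto
  qed
  then have "negligible U" using inj by (simp add: inv_into_image_cancel)
  then show "\<exists>U. openin (top_of_set Y) U \<and> p \<in> U \<and> negligible U"
    using p d(1) openin_open_Int[OF open_ball, of Y p d] unfolding U_def
    by (metis IntI centre_in_ball)
qed

text \<open>For \<open>q\<close> near \<open>p\<close>, both \<open>D q\<close> and
  \<open>D p\<close> approximate the same increment of \<open>F\<close> between \<open>q\<close> and
  a nearby point in direction \<open>h\<close>, because the estimate at \<open>p\<close> holds for
  any two points close to \<open>p\<close>. Dividing by the length of the increment compares the two
  derivatives.\<close>

lemma strict_deriv_continuous:
  fixes F :: "'a::real_normed_vector \<Rightarrow> 'b::real_normed_vector"
  assumes "\<And>q. q \<in> S \<Longrightarrow> strict_deriv F (D q) q"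
  shows "continuous_on S (\<lambda>q. D q h)"
  unfolding continuous_on_iff
proof (intro ballI allI impI)
  fix p and e :: real assume p: "p \<in> S" and e: "e > 0"
  define N where "N = norm h + 1"
  define k where "k = e / (2 * N)"
  have n: "N > 0" "norm h < N" by (auto simp: N_def add_nonneg_pos)
  have k: "k > 0" using e n by (simp add: k_def)
  obtain d where d: "d > 0" "\<And>x y. x \<in> ball p d \<Longrightarrow> y \<in> ball p d \<Longrightarrow>
      norm (F x - F y - D p (x - y)) \<le> k * norm (x - y)"
    using strict_derivE[OF assms[OF p] k] by blast
  show "\<exists>d>0. \<forall>q\<in>S. dist q p < d \<longrightarrow> dist (D q h) (D p h) < e"
  proof (intro exI[of _ d] conjI ballI impI d)
    fix q assume q: "q \<in> S" "dist q p < d"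
    obtain d' where d': "d' > 0" "\<And>x y. x \<in> ball q d' \<Longrightarrow> y \<in> ball q d' \<Longrightarrow>
        norm (F x - F y - D q (x - y)) \<le> k * norm (x - y)"
      using strict_derivE[OF assms[OF q(1)] k] by blast
    define m where "m = min d' (d - dist q p)"
    have m: "m > 0" using d' q by (simp add: m_def)
    \<comment> \<open>The scale \<open>t\<close> may depend on \<open>q\<close>: it keeps the second
      point in both balls and cancels at the end.\<close>
    define t where "t = m / (2 * N)"
    have t: "t > 0" using m n by (simp add: t_def)
    have "norm (t *\<^sub>R h) \<le> t * N" using t n by simp
    also have "\<dots> = m / 2" using n by (simp add: t_def)
    also have "\<dots> < m" using m by simp
    finally have th: "norm (t *\<^sub>R h) < m" .
    have in1: "q + t *\<^sub>R h \<in> ball q d'" "q \<in> ball q d'"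
      using th d' by (auto simp: m_def dist_norm)
    have in2: "q + t *\<^sub>R h \<in> ball p d" "q \<in> ball p d"
      using th q dist_triangle[of p "q + t *\<^sub>R h" q] by (auto simp: m_def dist_norm norm_minus_commute)
    have lin: "linear (D q)" "linear (D p)"
      using assms[OF p] assms[OF q(1)] strict_deriv_bounded_linear bounded_linear.linear by blast+
    let ?\<Delta> = "F (q + t *\<^sub>R h) - F q"
    have 1: "norm (?\<Delta> - t *\<^sub>R D q h) \<le> k * (t * norm h)"
      using d'(2)[OF in1] t by (simp add: linear_scale[OF lin(1)])
    have 2: "norm (?\<Delta> - t *\<^sub>R D p h) \<le> k * (t * norm h)"
      using d(2)[OF in2] t by (simp add: linear_scale[OF lin(2)])
    have "t * norm (D q h - D p h) = norm ((?\<Delta> - t *\<^sub>R D p h) - (?\<Delta> - t *\<^sub>R D q h))"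
      using t by (simp add: scaleR_diff_right[symmetric])
    also have "\<dots> \<le> k * (t * norm h) + k * (t * norm h)"
      by (rule order_trans[OF norm_triangle_ineq4 add_mono[OF 2 1]])
    also have "\<dots> = t * (2 * k * norm h)" by (simp add: algebra_simps)
    finally have "norm (D q h - D p h) \<le> 2 * k * norm h" using t by simp
    also have "\<dots> < 2 * k * N" using k n by simp
    also have "\<dots> = e" using n by (simp add: k_def)
    finally show "dist (D q h) (D p h) < e" by (simp add: dist_norm)
  qed
qed

section \<open>Maps of class \<open>C\<^sup>1\<close> and \<open>C\<^sup>2\<close>\<close>

lemma linear_bound_Basis:
  fixes D :: "'a::euclidean_space \<Rightarrow> 'b::real_normed_vector"
  assumes "linear D" "\<And>i. i \<in> Basis \<Longrightarrow> norm (D i) \<le> e"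
  shows "norm (D h) \<le> real DIM('a) * e * norm h"
proof -
  have "D h = D (\<Sum>i\<in>Basis. (h \<bullet> i) *\<^sub>R i)" by (simp add: euclidean_representation)
  also have "\<dots> = (\<Sum>i\<in>Basis. (h \<bullet> i) *\<^sub>R D i)"
    using assms(1) by (simp add: linear_sum linear_scale o_def)
  also have "norm \<dots> \<le> (\<Sum>i\<in>(Basis::'a set). e * norm h)"
  proof (rule sum_norm_le)
    fix i :: 'a assume i: "i \<in> Basis"
    have "\<bar>h \<bullet> i\<bar> * norm (D i) \<le> norm h * e"
      using assms(2)[OF i] Basis_le_norm[OF i] by (intro mult_mono) auto
    then show "norm ((h \<bullet> i) *\<^sub>R D i) \<le> e * norm h" by (simp add: mult.commute)
  qed
  finally show ?thesis by simp
qed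

text \<open>\<open>Ck_on\<close> controls derivatives one direction at a time; in finite dimension,
  closeness on the basis vectors is closeness in operator norm.\<close>

lemma linear_family_close:
  fixes D :: "'a::euclidean_space \<Rightarrow> 'a \<Rightarrow> 'b::real_normed_vector"
  assumes S: "open S" "p \<in> S" and lin: "\<And>q. q \<in> S \<Longrightarrow> linear (D q)"
    and cont: "\<And>i. continuous_on S (\<lambda>q. D q i)" and e: "e > 0"
  obtains d where "d > 0" "ball p d \<subseteq> S" "\<And>q h. q \<in> ball p d \<Longrightarrow> norm (D q h - D p h) \<le> e * norm h"
proof -
  have "\<forall>\<^sub>F x in nhds p. \<forall>i\<in>Basis. dist (D x i) (D p i) < e / DIM('a)"
  proof (rule eventually_ball_finite, simp, rule ballI)
    fix i :: 'a
    have "isCont (\<lambda>x. D x i) p" using cont S continuous_on_eq_continuous_at by blast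
    then have "((\<lambda>x. D x i) \<longlongrightarrow> D p i) (nhds p)"
      by (simp add: continuous_at tendsto_nhds_iff)
    then show "\<forall>\<^sub>F x in nhds p. dist (D x i) (D p i) < e / DIM('a)"
      using e by (simp add: tendsto_iff)
  qed
  moreover have "\<forall>\<^sub>F x in nhds p. x \<in> S" using S eventually_nhds by blast
  ultimately have "\<forall>\<^sub>F x in nhds p. (\<forall>i\<in>Basis. dist (D x i) (D p i) < e / DIM('a)) \<and> x \<in> S"
    by eventually_elim simp
  then obtain d where d: "d > 0"
    "\<And>x. dist x p < d \<Longrightarrow> (\<forall>i\<in>Basis. dist (D x i) (D p i) < e / DIM('a)) \<and> x \<in> S"
    unfolding eventually_nhds_metric by blast
  show ?thesis
  proof (rule that[OF d(1)])
    show "ball p d \<subseteq> S" using d(2) by (auto simp: dist_commute)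
    fix q h assume "q \<in> ball p d"
    then have q: "dist q p < d" by (simp add: dist_commute)
    have "linear (\<lambda>h. D q h - D p h)" using d(2)[OF q] S(2) by (intro linear_compose_sub lin) auto
    moreover have "norm (D q i - D p i) \<le> e / DIM('a)" if "i \<in> Basis" for i
      using d(2)[OF q] that by (auto simp: dist_norm less_imp_le)
    ultimately show "norm (D q h - D p h) \<le> e * norm h"
      using linear_bound_Basis[of "\<lambda>h. D q h - D p h" "e / DIM('a)" h] by simp
  qed
qed

lemma linear_family_locally_bounded:
  fixes D :: "'a::euclidean_space \<Rightarrow> 'a \<Rightarrow> real"
  assumes S: "open S" "p \<in> S" and lin: "\<And>q. q \<in> S \<Longrightarrow> linear (D q)"
    and cont: "\<And>i. continuous_on S (\<lambda>q. D q i)"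
  obtains d B where "d > 0" "B > 0" "ball p d \<subseteq> S" "\<And>q h. q \<in> ball p d \<Longrightarrow> \<bar>D q h\<bar> \<le> B * norm h"
proof -
  obtain d where d: "d > 0" "ball p d \<subseteq> S" "\<And>q h. q \<in> ball p d \<Longrightarrow> norm (D q h - D p h) \<le> 1 * norm h"
    by (rule linear_family_close[where D=D and e=1, OF S]) (simp_all add: lin cont)
  have "bounded_linear (D p)" using lin[OF S(2)] by (simp add: linear_conv_bounded_linear)
  then obtain K where K: "K > 0" "\<And>h. norm (D p h) \<le> norm h * K" using bounded_linear.pos_bounded by blast
  show ?thesis
  proof (rule that[OF d(1) _ d(2), of "K + 1"])
    fix q h assume "q \<in> ball p d"
    from d(3)[OF this, of h] K(2)[of h] show "\<bar>D q h\<bar> \<le> (K + 1) * norm h" by (simp add: algebra_simps)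
  qed (use K in simp)
qed

text \<open>This is the mean value inequality for \<open>F - L\<close>. With \<open>L\<close> the
  derivative at the centre of a ball it yields strict differentiability; with \<open>L\<close> the
  derivative at an endpoint of a segment it yields the quadratic linearization error.\<close>

lemma mean_value_deviation:
  fixes F :: "'a::real_normed_vector \<Rightarrow> 'b::real_normed_vector"
  assumes S: "convex S" "x \<in> S" "y \<in> S" and L: "bounded_linear L" and e: "0 \<le> e"
    and der: "\<And>z. z \<in> S \<Longrightarrow> (F has_derivative D z) (at z)"
    and close: "\<And>z h. z \<in> S \<Longrightarrow> norm (D z h - L h) \<le> e * norm h"
  shows "norm (F x - F y - L (x - y)) \<le> e * norm (x - y)"
proof -
  have "norm ((F x - L x) - (F y - L y)) \<le> e * norm (x - y)"
  proof (rule differentiable_bound[OF S(1) _ _ S(2,3), where f'="\<lambda>z h. D z h - L h"])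
    fix z assume z: "z \<in> S"
    show "((\<lambda>x. F x - L x) has_derivative (\<lambda>h. D z h - L h)) (at z within S)"
      by (intro has_derivative_diff has_derivative_at_withinI[OF der[OF z]] bounded_linear_imp_has_derivative L)
    show "onorm (\<lambda>h. D z h - L h) \<le> e" using close[OF z] e by (intro onorm_bound) auto
  qed
  moreover have "(F x - L x) - (F y - L y) = F x - F y - L (x - y)"
    using linear_diff[OF bounded_linear.linear[OF L], of x y] by simp
  ultimately show ?thesis by (simp only:)
qed

lemma Ck_on_1_has_derivative:
  assumes "Ck_on (Suc 0) S F" "x \<in> S"
  shows "(F has_derivative frechet_derivative F (at x)) (at x)"
  using assms by (simp add: frechet_derivative_works)

lemma Ck_on_1_strict_deriv:
  fixes F :: "'a::euclidean_space \<Rightarrow> 'b::real_normed_vector"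
  assumes C: "Ck_on (Suc 0) S F" and S: "open S" "p \<in> S"
  shows "strict_deriv F (frechet_derivative F (at p)) p"
  unfolding strict_deriv_def
proof (intro conjI allI impI)
  note der = Ck_on_1_has_derivative[OF C]
  show bl: "bounded_linear (frechet_derivative F (at p))" using der[OF S(2)] by (rule has_derivative_bounded_linear)
  fix e :: real assume e: "e > 0"
  obtain d where d: "d > 0" "ball p d \<subseteq> S" "\<And>q h. q \<in> ball p d \<Longrightarrow>
      norm (frechet_derivative F (at q) h - frechet_derivative F (at p) h) \<le> e * norm h"
    using linear_family_close[OF S, of "\<lambda>x. frechet_derivative F (at x)" e] has_derivative_linear[OF der] C e
    by (metis Ck_on.simps)
  show "\<exists>d>0. \<forall>x\<in>ball p d. \<forall>y\<in>ball p d.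
      norm (F x - F y - frechet_derivative F (at p) (x - y)) \<le> e * norm (x - y)"
    using d e by (intro exI[of _ d] conjI ballI mean_value_deviation[OF convex_ball _ _ bl _ der]) auto
qed

lemma Ck_on_2D:
  fixes F :: "'a::euclidean_space \<Rightarrow> 'b::real_normed_vector"
  assumes "Ck_on 2 S F"
  shows "Ck_on (Suc 0) S (\<lambda>x. frechet_derivative F (at x) v)"
    and "open S \<Longrightarrow> Ck_on (Suc 0) S F"
proof -
  have *: "\<forall>x\<in>S. F differentiable (at x)" "\<And>v. Ck_on (Suc 0) S (\<lambda>x. frechet_derivative F (at x) v)"
    using assms by (simp_all add: numeral_2_eq_2)
  then show "Ck_on (Suc 0) S (\<lambda>x. frechet_derivative F (at x) v)" by simp
  assume S: "open S"
  have "continuous_on S (\<lambda>x. frechet_derivative F (at x) v)" for v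
    using *(2)[of v] differentiable_imp_continuous_within
    by (auto simp: continuous_on_eq_continuous_at[OF S])
  with * show "Ck_on (Suc 0) S F" by simp
qed

text \<open>The directional derivatives are strictly differentiable, hence Lipschitz near
  \<open>p\<close>, and the mean value inequality on the segment from \<open>x\<close> to
  \<open>y\<close> turns this into a quadratic error. One constant serves all pairs of points near
  \<open>p\<close>, which later makes the Armijo condition locally uniform.\<close>

lemma Ck_on_2_linearization_error:
  fixes F :: "'a::euclidean_space \<Rightarrow> 'b::real_normed_vector"
  assumes C: "Ck_on 2 S F" and S: "open S" "p \<in> S"
  obtains d C where "d > 0" "C > 0" "ball p d \<subseteq> S"
    "\<And>x y. x \<in> ball p d \<Longrightarrow> y \<in> ball p d \<Longrightarrow>
       norm (F y - F x - frechet_derivative F (at x) (y - x)) \<le> C * (norm (y - x))\<^sup>2"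
proof -
  define D where "D x = frechet_derivative F (at x)" for x
  have C1: "Ck_on (Suc 0) S F" using Ck_on_2D(2)[OF C S(1)] .
  have der: "(F has_derivative D x) (at x)" if "x \<in> S" for x
    unfolding D_def by (rule Ck_on_1_has_derivative[OF C1 that])
  have bl: "bounded_linear (D x)" if "x \<in> S" for x
    using der[OF that] by (rule has_derivative_bounded_linear)
  have "\<exists>d K. d > 0 \<and> K > 0 \<and> (\<forall>x\<in>ball p d. \<forall>y\<in>ball p d. norm (D x i - D y i) \<le> K * norm (x - y))" for i
    using strict_deriv_lipschitz[OF Ck_on_1_strict_deriv[OF Ck_on_2D(1)[OF C] S], of i]
    unfolding D_def by metis
  then obtain d K where dK: "\<And>i. d i > 0" "\<And>i. K i > 0"
    "\<And>i x y. x \<in> ball p (d i) \<Longrightarrow> y \<in> ball p (d i) \<Longrightarrow> norm (D x i - D y i) \<le> K i * norm (x - y)"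
    by metis
  obtain d0 where d0: "d0 > 0" "ball p d0 \<subseteq> S" using S openE by metis
  define e where "e = min d0 (Min (d ` Basis))"
  have e: "e > 0" "e \<le> d0" "\<And>i. i \<in> Basis \<Longrightarrow> e \<le> d i"
    using d0 dK(1) by (auto simp: e_def min.coboundedI2)
  define M where "M = Max (K ` Basis)"
  have M: "K i \<le> M" if "i \<in> Basis" for i using that by (simp add: M_def)
  have M0: "M > 0" using M dK(2) nonempty_Basis by (metis all_not_in_conv less_le_trans)
  have Dlip: "norm (D x h - D y h) \<le> real DIM('a) * (M * norm (x - y)) * norm h"
    if "x \<in> ball p e" "y \<in> ball p e" for x y h
  proof (rule linear_bound_Basis)
    have "x \<in> S" "y \<in> S" using that d0 e by auto
    then show "linear (\<lambda>h. D x h - D y h)"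
      by (intro linear_compose_sub bounded_linear.linear bl)
    fix i :: 'a assume i: "i \<in> Basis"
    have "norm (D x i - D y i) \<le> K i * norm (x - y)" using that e(3)[OF i] by (intro dK) auto
    also have "\<dots> \<le> M * norm (x - y)" using M[OF i] by (intro mult_right_mono) auto
    finally show "norm (D x i - D y i) \<le> M * norm (x - y)" .
  qed
  show ?thesis
  proof (rule that[of e "real DIM('a) * M"])
    fix x y assume xy: "x \<in> ball p e" "y \<in> ball p e"
    have zb: "z \<in> ball p e" if "z \<in> closed_segment x y" for z
      using that xy closed_segment_subset[OF xy convex_ball] by blast
    have inS: "z \<in> S" if "z \<in> ball p e" for z using that e(2) d0 by auto
    have "norm (F y - F x - D x (y - x)) \<le> (real DIM('a) * (M * norm (y - x))) * norm (y - x)"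
    proof (rule mean_value_deviation[OF convex_closed_segment])
      fix z h assume z: "z \<in> closed_segment x y"
      show "(F has_derivative D z) (at z)" by (rule der[OF inS[OF zb[OF z]]])
      have "norm (D z h - D x h) \<le> real DIM('a) * (M * norm (z - x)) * norm h"
        by (rule Dlip[OF zb[OF z] xy(1)])
      also have "\<dots> \<le> real DIM('a) * (M * norm (y - x)) * norm h"
        using segment_bound(1)[OF z] M0 by (intro mult_right_mono mult_left_mono) auto
      finally show "norm (D z h - D x h) \<le> real DIM('a) * (M * norm (y - x)) * norm h" .
    qed (use bl inS xy M0 in auto)
    then show "norm (F y - F x - frechet_derivative F (at x) (y - x)) \<le> real DIM('a) * M * (norm (y - x))\<^sup>2"
      by (simp only: D_def power2_eq_square mult.assoc)
  qed (use e M0 d0 in auto)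
qed

text \<open>The four-point difference is symmetric in \<open>u\<close> and \<open>v\<close>. The
  mean value theorem in direction \<open>u\<close> turns it into the change of the
  \<open>u\<close>-derivative along \<open>s *\<^sub>R v\<close>; strict differentiability at
  \<open>p\<close> evaluates this change although neither end need be \<open>p\<close>.\<close>

lemma Ck_on_2_second_difference:
  fixes f :: "'a::euclidean_space \<Rightarrow> real"
  assumes C: "Ck_on 2 S f" and S: "open S" "p \<in> S" and e: "e > 0"
  obtains d where "d > 0" "\<And>s. 0 < s \<Longrightarrow> s < d \<Longrightarrow>
    \<bar>f (p + s *\<^sub>R u + s *\<^sub>R v) - f (p + s *\<^sub>R u) - f (p + s *\<^sub>R v) + f p
      - s\<^sup>2 * frechet_derivative (\<lambda>x. frechet_derivative f (at x) u) (at p) v\<bar> \<le> e * s\<^sup>2"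
proof -
  define D where "D x = frechet_derivative f (at x)" for x
  have C1: "Ck_on (Suc 0) S f" using Ck_on_2D(2)[OF C S(1)] .
  have der: "(f has_derivative D x) (at x)" if "x \<in> S" for x
    unfolding D_def by (rule Ck_on_1_has_derivative[OF C1 that])
  define A where "A = frechet_derivative (\<lambda>x. D x u) (at p)"
  have sdA: "strict_deriv (\<lambda>x. D x u) A p"
    unfolding A_def D_def by (rule Ck_on_1_strict_deriv[OF Ck_on_2D(1)[OF C] S])
  have "e / (norm v + 1) > 0" using e by (simp add: add_nonneg_pos)
  then obtain d1 where d1: "d1 > 0" "\<And>x y. x \<in> ball p d1 \<Longrightarrow> y \<in> ball p d1 \<Longrightarrow>
      norm (D x u - D y u - A (x - y)) \<le> e / (norm v + 1) * norm (x - y)"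
    using strict_derivE[OF sdA] by metis
  obtain d0 where d0: "d0 > 0" "ball p d0 \<subseteq> S" using S openE by metis
  \<comment> \<open>The denominator keeps the whole parallelogram spanned by
    \<open>s *\<^sub>R u\<close> and \<open>s *\<^sub>R v\<close> inside both balls, also when
    \<open>u\<close> and \<open>v\<close> are zero.\<close>
  define d where "d = min d0 d1 / (norm u + norm v + 1)"
  have n: "norm u + norm v + 1 > 0" by (simp add: add_nonneg_pos)
  show ?thesis
  proof (rule that[of d])
    show "d > 0" using d0 d1 n by (simp add: d_def)
    fix s assume s: "0 < s" "s < d"
    have sn: "s * (norm u + norm v + 1) < min d0 d1"
      using s n by (simp add: d_def pos_less_divide_eq)
    have inb: "p + (t * s) *\<^sub>R u + (b * s) *\<^sub>R v \<in> ball p (min d0 d1)"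
      if "0 \<le> t" "t \<le> 1" "0 \<le> b" "b \<le> 1" for t b
    proof -
      have "norm ((t * s) *\<^sub>R u + (b * s) *\<^sub>R v) \<le> (t * s) * norm u + (b * s) * norm v"
        using norm_triangle_ineq[of "(t * s) *\<^sub>R u" "(b * s) *\<^sub>R v"] that s by simp
      also have "\<dots> \<le> s * norm u + s * norm v"
        using that s by (intro add_mono mult_right_mono) auto
      also have "\<dots> < min d0 d1" using sn s by (simp add: algebra_simps)
      finally show ?thesis by (simp add: dist_norm norm_minus_commute add.assoc add.commute)
    qed
    define \<phi> where "\<phi> t = f (p + (t * s) *\<^sub>R u + s *\<^sub>R v) - f (p + (t * s) *\<^sub>R u)" for t
    define \<phi>' where "\<phi>' t h = D (p + (t * s) *\<^sub>R u + s *\<^sub>R v) ((h * s) *\<^sub>R u)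
        - D (p + (t * s) *\<^sub>R u) ((h * s) *\<^sub>R u)" for t h
    have "\<exists>x\<in>{0<..<1}. \<phi> 1 - \<phi> 0 = \<phi>' x (1 - 0)"
    proof (rule mvt_simple)
      fix t :: real assume t: "0 \<le> t" "t \<le> 1"
      have 1: "p + (t * s) *\<^sub>R u + s *\<^sub>R v \<in> S" "p + (t * s) *\<^sub>R u \<in> S"
        using inb[of t 1] inb[of t 0] t d0 by auto
      have "(\<phi> has_derivative \<phi>' t) (at t)"
        unfolding \<phi>_def[abs_def] \<phi>'_def
        by (intro has_derivative_diff has_derivative_compose[where g=f, OF _ der] 1)
          (auto intro!: derivative_eq_intros)
      then show "(\<phi> has_derivative \<phi>' t) (at t within {0..1})" by (rule has_derivative_at_withinI)
    qed simp
    then obtain \<xi> where \<xi>: "0 < \<xi>" "\<xi> < 1" "\<phi> 1 - \<phi> 0 = \<phi>' \<xi> 1" by auto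
    define x y where "x = p + (\<xi> * s) *\<^sub>R u + s *\<^sub>R v" and "y = p + (\<xi> * s) *\<^sub>R u"
    have xy: "x \<in> ball p (min d0 d1)" "y \<in> ball p (min d0 d1)" "x - y = s *\<^sub>R v"
      using inb[of \<xi> 1] inb[of \<xi> 0] \<xi> by (auto simp: x_def y_def)
    have lin: "linear (D z)" if "z \<in> ball p (min d0 d1)" for z
      using that d0 by (intro has_derivative_linear[OF der]) auto
    have "\<phi>' \<xi> 1 = s * (D x u - D y u)"
    proof -
      have "\<phi>' \<xi> 1 = D x (s *\<^sub>R u) - D y (s *\<^sub>R u)" by (simp only: \<phi>'_def x_def y_def mult_1_left)
      then show ?thesis
        by (simp add: linear_scale[OF lin[OF xy(1)]] linear_scale[OF lin[OF xy(2)]] right_diff_distrib)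
    qed
    moreover have "A (x - y) = s * A v"
      using strict_deriv_bounded_linear[OF sdA] by (simp add: xy linear_scale bounded_linear.linear)
    ultimately have "\<phi>' \<xi> 1 - s\<^sup>2 * A v = s * (D x u - D y u - A (x - y))"
      by (simp add: algebra_simps power2_eq_square)
    also have "\<bar>\<dots>\<bar> = s * norm (D x u - D y u - A (x - y))" using s by (simp add: abs_mult)
    also have "\<dots> \<le> s * (e / (norm v + 1) * norm (x - y))"
      using s xy by (intro mult_left_mono d1) auto
    also have "\<dots> = s\<^sup>2 * e * (norm v / (norm v + 1))" using s by (simp add: xy power2_eq_square)
    also have "\<dots> \<le> s\<^sup>2 * e * 1"
      using e by (intro mult_left_mono) (auto simp: divide_le_eq add_nonneg_pos)
    finally have "\<bar>\<phi> 1 - \<phi> 0 - s\<^sup>2 * A v\<bar> \<le> e * s\<^sup>2" by (simp add: \<xi>(3) mult.commute)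
    then show "\<bar>f (p + s *\<^sub>R u + s *\<^sub>R v) - f (p + s *\<^sub>R u) - f (p + s *\<^sub>R v) + f p
      - s\<^sup>2 * frechet_derivative (\<lambda>x. frechet_derivative f (at x) u) (at p) v\<bar> \<le> e * s\<^sup>2"
      by (simp add: \<phi>_def A_def D_def algebra_simps)
  qed
qed

text \<open>Both mixed derivatives approximate the same symmetric four-point difference. This is
  what makes the Hessian self-adjoint at critical points.\<close>

lemma Ck_on_2_symmetric:
  fixes f :: "'a::euclidean_space \<Rightarrow> real"
  assumes C: "Ck_on 2 S f" and S: "open S" "p \<in> S"
  shows "frechet_derivative (\<lambda>x. frechet_derivative f (at x) u) (at p) v =
         frechet_derivative (\<lambda>x. frechet_derivative f (at x) v) (at p) u" (is "?a = ?b")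
proof -
  have "\<bar>?a - ?b\<bar> \<le> e" if e: "e > 0" for e
  proof -
    have e2: "e / 2 > 0" using e by simp
    obtain d1 where d1: "d1 > 0" "\<And>s. 0 < s \<Longrightarrow> s < d1 \<Longrightarrow>
      \<bar>f (p + s *\<^sub>R u + s *\<^sub>R v) - f (p + s *\<^sub>R u) - f (p + s *\<^sub>R v) + f p - s\<^sup>2 * ?a\<bar> \<le> e/2 * s\<^sup>2"
      using Ck_on_2_second_difference[OF C S e2, where u=u and v=v] by blast
    obtain d2 where d2: "d2 > 0" "\<And>s. 0 < s \<Longrightarrow> s < d2 \<Longrightarrow>
      \<bar>f (p + s *\<^sub>R v + s *\<^sub>R u) - f (p + s *\<^sub>R v) - f (p + s *\<^sub>R u) + f p - s\<^sup>2 * ?b\<bar> \<le> e/2 * s\<^sup>2"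
      using Ck_on_2_second_difference[OF C S e2, where u=v and v=u] by blast
    define s where "s = min d1 d2 / 2"
    have s: "0 < s" "s < d1" "s < d2" using d1(1) d2(1) by (auto simp: s_def)
    have sw: "p + s *\<^sub>R v + s *\<^sub>R u = p + s *\<^sub>R u + s *\<^sub>R v" by (simp add: algebra_simps)
    have "\<bar>s\<^sup>2 * ?a - s\<^sup>2 * ?b\<bar> \<le> e/2 * s\<^sup>2 + e/2 * s\<^sup>2"
      using d1(2)[OF s(1,2)] d2(2)[OF s(1,3), unfolded sw] by linarith
    then have "\<bar>s\<^sup>2 * ?a - s\<^sup>2 * ?b\<bar> \<le> e * s\<^sup>2" by simp
    moreover have "\<bar>s\<^sup>2 * ?a - s\<^sup>2 * ?b\<bar> = \<bar>?a - ?b\<bar> * s\<^sup>2"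
      by (simp add: right_diff_distrib[symmetric] abs_mult mult.commute)
    ultimately show ?thesis using s(1) by simp
  qed
  then have "\<bar>?a - ?b\<bar> \<le> 0" by (rule field_le_epsilon[of _ 0, simplified])
  then show ?thesis by simp
qed

text \<open>Implicit differentiation of \<open>T V = b\<close>: the derivative of \<open>V\<close>
  at \<open>p\<close> is the inverse of \<open>T p\<close> applied to \<open>b' - T' (V p)\<close>.
  In the application \<open>T\<close> is the Gram matrix of the metric and \<open>b\<close> the
  differential of \<open>f\<close>, so that \<open>V\<close> is the gradient.\<close>

lemma strict_deriv_solve:
  fixes T :: "'a::euclidean_space \<Rightarrow> 'b::euclidean_space \<Rightarrow>\<^sub>L 'b" and V b :: "'a \<Rightarrow> 'b"
  assumes T: "strict_deriv T T' p" and b: "strict_deriv b b' p"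
    and S: "open S" "p \<in> S" and eq: "\<And>q. q \<in> S \<Longrightarrow> blinfun_apply (T q) (V q) = b q"
    and inj: "\<And>u. blinfun_apply (T p) u = 0 \<Longrightarrow> u = 0"
  shows "\<exists>L. strict_deriv V L p"
proof -
  obtain m where m: "m > 0" "\<And>x. m * norm x \<le> norm (T p x)"
    using linear_inj_lower_bound[OF blinfun.bounded_linear_right inj] by blast
  have linT: "linear (blinfun_apply (T p))" by (simp add: blinfun.bounded_linear_right bounded_linear.linear)
  have injT: "inj (blinfun_apply (T p))" using inj linT by (simp add: linear_injective_0)
  obtain Ti where Ti: "linear Ti" "\<And>x. T p (Ti x) = x"
    using linear_injective_isomorphism[OF linT injT] by blast
  define rhs where "rhs h = b' h - blinfun_apply (T' h) (V p)" for h
  have rhs: "bounded_linear rhs"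
    unfolding rhs_def[abs_def]
    by (intro bounded_linear_sub strict_deriv_bounded_linear[OF b]
        bounded_linear_compose[OF blinfun.bounded_linear_left strict_deriv_bounded_linear[OF T]])
  define L where "L h = Ti (rhs h)" for h
  have L: "bounded_linear L" unfolding L_def[abs_def]
    by (rule bounded_linear_compose[OF linear_conv_bounded_linear[THEN iffD1, OF Ti(1)] rhs])
  obtain dT CT where T1: "dT > 0" "CT > 0"
    "\<And>x y. x \<in> ball p dT \<Longrightarrow> y \<in> ball p dT \<Longrightarrow> norm (T x - T y) \<le> CT * norm (x - y)"
    using strict_deriv_lipschitz[OF T] by blast
  obtain db Cb where b1: "db > 0" "Cb > 0"
    "\<And>x y. x \<in> ball p db \<Longrightarrow> y \<in> ball p db \<Longrightarrow> norm (b x - b y) \<le> Cb * norm (x - y)"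
    using strict_deriv_lipschitz[OF b] by blast
  obtain dS where dS: "dS > 0" "ball p dS \<subseteq> S" using S openE by metis
  \<comment> \<open>The bound \<open>m / (2 * CT)\<close> keeps \<open>T q\<close> within
    \<open>m/2\<close> of \<open>T p\<close>, so that half of the lower bound \<open>m\<close>
    survives; the bound \<open>1\<close> serves to bound \<open>b\<close>, and through it
    \<open>V\<close>.\<close>
  define d0 where "d0 = Min {dT, db, dS, m / (2 * CT), 1}"
  have d0: "d0 > 0" "d0 \<le> dT" "d0 \<le> db" "d0 \<le> dS" "d0 \<le> m / (2 * CT)" "d0 \<le> 1"
    using T1 b1 dS m by (auto simp: d0_def)
  have inS: "q \<in> S" if "q \<in> ball p d0" for q using that d0 dS by auto
  have low: "m/2 * norm w \<le> norm (T q w)" if "q \<in> ball p d0" for q w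
  proof -
    have "norm (T p - T q) \<le> CT * norm (p - q)" using that d0 by (intro T1) auto
    also have "\<dots> \<le> CT * (m / (2 * CT))"
      using that d0 T1 by (intro mult_left_mono) (auto simp: dist_norm)
    also have "\<dots> = m/2" using T1 by simp
    finally have "norm ((T p - T q) w) \<le> m/2 * norm w"
      by (meson mult_right_mono norm_blinfun norm_ge_zero order_trans)
    then show ?thesis
      using m(2)[of w] norm_triangle_sub[of "T p w" "T q w"] by (simp add: blinfun.diff_left)
  qed
  define BV where "BV = 2 / m * (norm (b p) + Cb)"
  have BV: "norm (V q) \<le> BV" if q: "q \<in> ball p d0" for q
  proof -
    have "norm (b q - b p) \<le> Cb * norm (q - p)" using q d0 by (intro b1) auto
    also have "\<dots> \<le> Cb * 1" using q d0 b1 by (intro mult_left_mono) (auto simp: dist_norm norm_minus_commute)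
    finally have "norm (b q) \<le> norm (b p) + Cb" using norm_triangle_sub[of "b q" "b p"] by simp
    moreover have "m/2 * norm (V q) \<le> norm (b q)" using low[OF q, of "V q"] eq[OF inS[OF q]] by simp
    ultimately have "m/2 * norm (V q) \<le> norm (b p) + Cb" by simp
    then show ?thesis using m(1) by (simp add: BV_def field_simps)
  qed
  have BV0: "BV \<ge> 0" using m b1 by (simp add: BV_def)
  have diff: "T x (V x - V y) = b x - b y - (T x - T y) (V y)"
    if "x \<in> ball p d0" "y \<in> ball p d0" for x y
    using eq[OF inS] that by (simp add: blinfun.diff_left blinfun.diff_right)
  define CV where "CV = 2 / m * (Cb + CT * BV)"
  have CV0: "CV \<ge> 0" using m b1 T1 BV0 by (simp add: CV_def)
  have Vlip: "norm (V x - V y) \<le> CV * norm (x - y)" if xy: "x \<in> ball p d0" "y \<in> ball p d0" for x y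
  proof -
    have "norm ((T x - T y) (V y)) \<le> (CT * norm (x - y)) * BV"
      using norm_blinfun[of "T x - T y" "V y"] T1(3)[of x y] BV[OF xy(2)] xy d0 T1(2)
      by (intro order_trans[OF norm_blinfun] mult_mono) auto
    moreover have "norm (b x - b y) \<le> Cb * norm (x - y)" using xy d0 by (intro b1) auto
    ultimately have "norm (T x (V x - V y)) \<le> (Cb + CT * BV) * norm (x - y)"
      unfolding diff[OF xy] using norm_triangle_ineq4[of "b x - b y" "(T x - T y) (V y)"]
      by (simp add: algebra_simps)
    with low[OF xy(1), of "V x - V y"] have "m/2 * norm (V x - V y) \<le> (Cb + CT * BV) * norm (x - y)"
      by simp
    then show ?thesis using m(1) by (simp add: CV_def field_simps)
  qed
  obtain K' where K': "K' > 0" "\<And>h. norm (T' h) \<le> norm h * K'"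
    using bounded_linear.pos_bounded[OF strict_deriv_bounded_linear[OF T]] by blast
  have "strict_deriv V L p"
    unfolding strict_deriv_def
  proof (intro conjI allI impI L)
    fix e :: real assume e: "e > 0"
    \<comment> \<open>\<open>M\<close> adds up the coefficients of the four error terms below, and
      the factor \<open>m\<close> in \<open>e'\<close> pays for inverting
      \<open>T p\<close>.\<close>
    define M where "M = CT * CV + 1 + BV + K' * CV"
    have M: "M > 0" using T1 CV0 BV0 K' by (simp add: M_def add_nonneg_pos add_pos_nonneg)
    define e' where "e' = m * e / M"
    have e': "e' > 0" using m e M by (simp add: e'_def)
    obtain d1 where d1: "d1 > 0" "\<And>x y. x \<in> ball p d1 \<Longrightarrow> y \<in> ball p d1 \<Longrightarrow>
        norm (T x - T y - T' (x - y)) \<le> e' * norm (x - y)"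
      using strict_derivE[OF T e'] by blast
    obtain d2 where d2: "d2 > 0" "\<And>x y. x \<in> ball p d2 \<Longrightarrow> y \<in> ball p d2 \<Longrightarrow>
        norm (b x - b y - b' (x - y)) \<le> e' * norm (x - y)"
      using strict_derivE[OF b e'] by blast
    define d where "d = Min {d0, d1, d2, e'}"
    have d: "d > 0" "d \<le> d0" "d \<le> d1" "d \<le> d2" "d \<le> e'" using d0 d1 d2 e' by (auto simp: d_def)
    show "\<exists>d>0. \<forall>x\<in>ball p d. \<forall>y\<in>ball p d. norm (V x - V y - L (x - y)) \<le> e * norm (x - y)"
    proof (intro exI[of _ d] conjI ballI d)
      fix x y assume xy: "x \<in> ball p d" "y \<in> ball p d"
      have xy0: "x \<in> ball p d0" "y \<in> ball p d0" using xy d by auto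
      have ne: "norm (p - x) \<le> e'" "norm (y - p) \<le> e'"
        using xy d by (auto simp: dist_norm norm_minus_commute)
      have "T p (V x - V y - L (x - y)) = T p (V x - V y) - (b' (x - y) - T' (x - y) (V p))"
        by (simp add: blinfun.diff_right L_def Ti rhs_def)
      \<comment> \<open>Every summand has a small factor: the first and the last through the
        distance of \<open>x\<close> or \<open>y\<close> from \<open>p\<close>, the middle two
        through the strict derivatives of \<open>b\<close> and \<open>T\<close>.\<close>
      also have "\<dots> = (T p - T x) (V x - V y) + (b x - b y - b' (x - y))
          - (T x - T y - T' (x - y)) (V y) - T' (x - y) (V y - V p)"
        using diff[OF xy0] by (simp add: blinfun.diff_left blinfun.diff_right blinfun.add_left algebra_simps)
      finally have eqn: "T p (V x - V y - L (x - y)) = \<dots>" .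
      have 1: "norm ((T p - T x) (V x - V y)) \<le> (CT * e') * (CV * norm (x - y))"
      proof (intro order_trans[OF norm_blinfun] mult_mono Vlip xy0)
        have "norm (T p - T x) \<le> CT * norm (p - x)" using xy0 d0 by (intro T1) auto
        also have "\<dots> \<le> CT * e'" using ne T1 by (intro mult_left_mono) auto
        finally show "norm (T p - T x) \<le> CT * e'" .
      qed (use T1 e' in auto)
      have 2: "norm (b x - b y - b' (x - y)) \<le> e' * norm (x - y)" using xy d by (intro d2) auto
      have 3: "norm ((T x - T y - T' (x - y)) (V y)) \<le> (e' * norm (x - y)) * BV"
        using xy d e' BV0 by (intro order_trans[OF norm_blinfun] mult_mono d1 BV xy0) auto
      have 4: "norm (T' (x - y) (V y - V p)) \<le> (norm (x - y) * K') * (CV * e')"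
      proof (intro order_trans[OF norm_blinfun] mult_mono K'(2))
        have "norm (V y - V p) \<le> CV * norm (y - p)" using xy0 d0 by (intro Vlip) auto
        also have "\<dots> \<le> CV * e'" using ne CV0 by (intro mult_left_mono) auto
        finally show "norm (V y - V p) \<le> CV * e'" .
      qed (use K' in auto)
      have tri: "norm (z1 + z2 - z3 - z4) \<le> norm z1 + norm z2 + norm z3 + norm z4" for z1 z2 z3 z4 :: 'b
        using norm_triangle_ineq4[of "z1 + z2 - z3" z4] norm_triangle_ineq4[of "z1 + z2" z3]
          norm_triangle_ineq[of z1 z2] by linarith
      have "norm (T p (V x - V y - L (x - y))) \<le> (CT * e') * (CV * norm (x - y)) + e' * norm (x - y)
          + (e' * norm (x - y)) * BV + (norm (x - y) * K') * (CV * e')"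
        unfolding eqn by (rule order_trans[OF tri]) (intro add_mono 1 2 3 4)
      also have "\<dots> = e' * M * norm (x - y)" by (simp add: M_def algebra_simps)
      also have "\<dots> = m * (e * norm (x - y))" using M by (simp add: e'_def)
      finally have "m * norm (V x - V y - L (x - y)) \<le> m * (e * norm (x - y))"
        using m(2) order_trans by blast
      then show "norm (V x - V y - L (x - y)) \<le> e * norm (x - y)" using m(1) by simp
    qed
  qed
  then show ?thesis by blast
qed

section \<open>Points trapped near an unstable fixed point\<close>

lemma negligible_line_transversal:
  fixes W :: "'a::euclidean_space set"
  assumes W: "compact W" and one: "\<And>x t. x \<in> W \<Longrightarrow> x + t *\<^sub>R v \<in> W \<Longrightarrow> t = 0"
  shows "negligible W"
proof -
  \<comment> \<open>The shifts are pairwise different but have length at most \<open>norm v\<close>,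
    so infinitely many disjoint translates of \<open>W\<close> fit into one ball.\<close>
  define T where "T n = (+) ((1 / real (Suc n)) *\<^sub>R v) ` W" for n :: nat
  have Wm: "W \<in> lmeasurable" using W by (rule lmeasurable_compact)
  have Tm: "T n \<in> lmeasurable" "measure lebesgue (T n) = measure lebesgue W" for n
    using Wm by (simp_all add: T_def measurable_translation measure_translation)
  have dis: "T m \<inter> T n = {}" if "m \<noteq> n" for m n
  proof (rule ccontr)
    assume "T m \<inter> T n \<noteq> {}"
    then obtain x y where xy: "x \<in> W" "y \<in> W"
      "(1 / real (Suc m)) *\<^sub>R v + x = (1 / real (Suc n)) *\<^sub>R v + y"
      by (auto simp: T_def)
    then have "y = x + (1 / real (Suc m) - 1 / real (Suc n)) *\<^sub>R v"
      by (simp add: scaleR_diff_left algebra_simps)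
    with one xy have "1 / real (Suc m) - 1 / real (Suc n) = 0" by metis
    then show False using that by simp
  qed
  obtain M where M: "\<And>x. x \<in> W \<Longrightarrow> norm x \<le> M"
    using compact_imp_bounded[OF W] bounded_iff by metis
  define C where "C = measure lebesgue (cball (0::'a) (M + norm v))"
  have "real N * measure lebesgue W \<le> C" for N
  proof -
    have "real N * measure lebesgue W = (\<Sum>n<N. measure lebesgue (T n))" by (simp add: Tm)
    also have "\<dots> = measure lebesgue (\<Union>n<N. T n)"
      by (rule measure_UNION'[symmetric]) (use dis Tm in \<open>auto simp: pairwise_def disjnt_def\<close>)
    also have "\<dots> \<le> C" unfolding C_def
    proof (rule measure_mono_fmeasurable)
      show "(\<Union>n<N. T n) \<subseteq> cball 0 (M + norm v)"
      proof clarify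
        fix n x assume "x \<in> T n"
        then obtain y where y: "y \<in> W" "x = (1 / real (Suc n)) *\<^sub>R v + y" by (auto simp: T_def)
        have "norm x \<le> norm ((1 / real (Suc n)) *\<^sub>R v) + norm y" unfolding y(2) by (rule norm_triangle_ineq)
        also have "norm ((1 / real (Suc n)) *\<^sub>R v) \<le> 1 * norm v"
          unfolding norm_scaleR by (intro mult_right_mono) auto
        finally show "x \<in> cball 0 (M + norm v)" using M[OF y(1)] by simp
      qed
    qed (use Tm in \<open>auto intro!: sets.finite_UN fmeasurableD\<close>)
    finally show ?thesis .
  qed
  then have "measure lebesgue W = 0"
    using real_arch_simple[of "(C + 1) / measure lebesgue W"]
    by (metis add.commute divide_le_eq less_add_one measure_nonneg not_le order_le_less order_less_le_trans)
  then show ?thesis using Wm negligible_iff_measure0 by blast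
qed

text \<open>\<open>F\<close> is continuous on \<open>C\<close> only, so its iterates cannot be
  treated as continuous maps. The sets of points that stay in \<open>C\<close> for \<open>n\<close>
  steps are instead shown closed by induction, each being the preimage of its predecessor under
  \<open>F\<close> restricted to \<open>C\<close>.\<close>

lemma compact_iterates_in:
  assumes C: "compact C" and F: "continuous_on C F"
  shows "compact {x. \<forall>n. (F ^^ n) x \<in> (C :: 'a::{metric_space} set)}"
proof -
  define W where "W n = {x. \<forall>k\<le>n. (F ^^ k) x \<in> C}" for n
  have W_Suc: "W (Suc n) = C \<inter> F -` W n" for n
  proof (rule Set.set_eqI, rule iffI)
    fix x assume x: "x \<in> W (Suc n)"
    have "(F ^^ k) (F x) \<in> C" if "k \<le> n" for k
      using x that by (auto simp: W_def funpow_swap1 dest: spec[of _ "Suc k"])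
    then show "x \<in> C \<inter> F -` W n" using x by (auto simp: W_def dest: spec[of _ 0])
  next
    fix x assume x: "x \<in> C \<inter> F -` W n"
    have "(F ^^ k) x \<in> C" if "k \<le> Suc n" for k
      using x that by (cases k) (auto simp: W_def funpow_swap1)
    then show "x \<in> W (Suc n)" by (simp add: W_def)
  qed
  have cl: "closed (W n)" for n
  proof (induction n)
    case 0
    have "W 0 = C" by (auto simp: W_def)
    then show ?case using C compact_imp_closed by simp
  next
    case (Suc n)
    then show ?case unfolding W_Suc
      by (rule continuous_closed_preimage[OF F compact_imp_closed[OF C]])
  qed
  have eq: "{x. \<forall>n. (F ^^ n) x \<in> C} = C \<inter> (\<Inter>n. W n)"
    by (auto simp: W_def dest: spec[of _ 0])
  show ?thesis unfolding eq by (intro compact_Int_closed C closed_INT ballI cl)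
qed

lemma posdef_lower_bound:
  fixes B :: "'a::euclidean_space \<Rightarrow> 'a \<Rightarrow> real"
  assumes B: "bounded_bilinear B" and pos: "\<And>x. x \<noteq> 0 \<Longrightarrow> B x x > 0"
  obtains b where "b > 0" "\<And>x. b * (norm x)\<^sup>2 \<le> B x x"
proof -
  interpret bounded_bilinear B by fact
  have "continuous_on (sphere 0 1) (\<lambda>x. B x x)"
    by (intro continuous_on continuous_on_id)
  then have "\<exists>u\<in>sphere 0 1. \<forall>x\<in>sphere 0 1. B u u \<le> B x x"
    by (intro continuous_attains_inf) auto
  then obtain u where u: "u \<in> sphere 0 1" "\<And>x. x \<in> sphere 0 1 \<Longrightarrow> B u u \<le> B x x" by blast
  show ?thesis
  proof (rule that[of "B u u"])
    show "B u u > 0" using u(1) by (intro pos) auto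
    fix x :: 'a
    show "B u u * (norm x)\<^sup>2 \<le> B x x"
    proof (cases "x = 0")
      case False
      have "B u u \<le> B (x /\<^sub>R norm x) (x /\<^sub>R norm x)" using False by (intro u(2)) simp
      also have "\<dots> = B x x / (norm x)\<^sup>2"
        by (simp add: scaleR_left scaleR_right divide_inverse power2_eq_square)
      finally show ?thesis using False by (simp add: field_simps)
    qed (simp add: zero_left)
  qed
qed

text \<open>Eigenvectors for different eigenvalues are orthogonal for \<open>B\<close>, hence
  independent. Finiteness leaves room to choose the growth factor \<theta> off the spectrum of the
  squared linearization.\<close>

lemma finite_eigenvalues_selfadjoint:
  fixes S :: "'a::euclidean_space \<Rightarrow> 'a"
  assumes B: "bounded_bilinear B" and sym: "\<And>x y. B x y = B y x"
    and pos: "\<And>x. x \<noteq> 0 \<Longrightarrow> B x x > (0::real)"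
    and adj: "\<And>x y. B (S x) y = B x (S y)"
  shows "finite {t. \<exists>x. x \<noteq> 0 \<and> S x = t *\<^sub>R x}" (is "finite ?E")
proof -
  interpret bounded_bilinear B by fact
  have "\<forall>t\<in>?E. \<exists>x. x \<noteq> 0 \<and> S x = t *\<^sub>R x" by simp
  then obtain w where "\<forall>t\<in>?E. w t \<noteq> 0 \<and> S (w t) = t *\<^sub>R w t" by (rule bchoice[THEN exE])
  then have w: "w t \<noteq> 0 \<and> S (w t) = t *\<^sub>R w t" if "t \<in> ?E" for t using that by blast
  have orth: "B (w t) (w s) = 0" if "t \<in> ?E" "s \<in> ?E" "t \<noteq> s" for t s
    using adj[of "w t" "w s"] w[OF that(1)] w[OF that(2)] that(3)
    by (simp add: scaleR_left scaleR_right)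
  have inj: "inj_on w ?E"
  proof (rule inj_onI, rule ccontr)
    fix t s assume "t \<in> ?E" "s \<in> ?E" "w t = w s" "t \<noteq> s"
    with orth[of t s] w[of t] pos[of "w t"] show False by auto
  qed
  have "independent (w ` ?E)"
    unfolding independent_explicit_finite_subsets
  proof (intro allI impI ballI)
    fix F u x assume F: "F \<subseteq> w ` ?E" "finite F" "(\<Sum>v\<in>F. u v *\<^sub>R v) = 0" "x \<in> F"
    have "0 = B (\<Sum>v\<in>F. u v *\<^sub>R v) x" using F by (simp add: zero_left)
    also have "\<dots> = (\<Sum>v\<in>F. u v * B v x)" by (simp add: sum_left scaleR_left)
    also have "\<dots> = (\<Sum>v\<in>F. if v = x then u x * B x x else 0)"
    proof (rule sum.cong)
      fix v assume "v \<in> F"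
      then obtain t s where "t \<in> ?E" "s \<in> ?E" "v = w t" "x = w s" using F by blast
      then show "u v * B v x = (if v = x then u x * B x x else 0)" using orth[of t s] by auto
    qed simp
    also have "\<dots> = u x * B x x" using F by (simp add: sum.delta)
    finally have "u x * B x x = 0" by simp
    moreover have "x \<in> w ` ?E" using F(1,4) by (rule subsetD)
    then have "x \<noteq> 0" using w by (auto simp only: image_iff)
    ultimately show "u x = 0" using pos[of x] by simp
  qed
  then have "finite (w ` ?E)" using independent_bound by blast
  then show ?thesis using inj finite_imageD by blast
qed

text \<open>Off the eigenvalues of \<open>L\<^sup>2\<close>, the quadratic form \<open>Q(x) = \<langle>(L\<^sup>2 - \<theta>) x, x\<rangle>\<close> satisfies
  \<open>Q(L x) - \<theta> Q(x) = |(L\<^sup>2 - \<theta>) x|\<^sup>2\<close>; for \<open>\<theta>\<close> between \<open>1\<close> and \<open>\<mu>\<^sup>2\<close> the form is positive at the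
  eigenvector.\<close>

lemma expanding_quadratic_form:
  fixes L :: "'a::euclidean_space \<Rightarrow> 'a"
  assumes B: "bounded_bilinear B" and sym: "\<And>x y. B x y = B y x"
    and pos: "\<And>x. x \<noteq> 0 \<Longrightarrow> B x x > (0::real)"
    and L: "linear L" and adj: "\<And>x y. B (L x) y = B x (L y)"
    and v: "v \<noteq> 0" "L v = \<mu> *\<^sub>R v" "\<bar>\<mu>\<bar> > 1"
  obtains Q \<theta> c where "bounded_bilinear Q" "\<theta> > 1" "c > 0" "Q v v > (0::real)"
    "\<And>x. Q (L x) (L x) \<ge> \<theta> * Q x x + c * (norm x)\<^sup>2"
proof -
  interpret B: bounded_bilinear B by fact
  have "finite {t. \<exists>x. x \<noteq> 0 \<and> L (L x) = t *\<^sub>R x}"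
    by (rule finite_eigenvalues_selfadjoint[OF B sym pos]) (simp_all add: adj)
  moreover have "1 < \<mu>\<^sup>2" using v(3) by (metis one_less_power power2_abs zero_less_numeral)
  then have "infinite {1<..<\<mu>\<^sup>2}" by (rule infinite_Ioo)
  ultimately have "{1<..<\<mu>\<^sup>2} - {t. \<exists>x. x \<noteq> 0 \<and> L (L x) = t *\<^sub>R x} \<noteq> {}"
    by (metis Diff_eq_empty_iff finite_subset)
  then obtain \<theta> where "\<theta> \<in> {1<..<\<mu>\<^sup>2}" "\<theta> \<notin> {t. \<exists>x. x \<noteq> 0 \<and> L (L x) = t *\<^sub>R x}" by blast
  then have \<theta>: "1 < \<theta>" "\<theta> < \<mu>\<^sup>2" and "\<forall>x. L (L x) = \<theta> *\<^sub>R x \<longrightarrow> x = 0" by auto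
  then have \<theta>_ev: "x = 0" if "L (L x) = \<theta> *\<^sub>R x" for x using that by blast
  define K where "K x = L (L x) - \<theta> *\<^sub>R x" for x
  have Llin: "L (x + y) = L x + L y" "L (x - y) = L x - L y" "L (r *\<^sub>R x) = r *\<^sub>R L x" for x y r
    using L by (simp_all add: linear_add linear_diff linear_scale)
  have linK: "linear K" by (rule linearI) (simp_all add: K_def Llin algebra_simps)
  then have K: "bounded_linear K" by (simp add: linear_conv_bounded_linear)
  have Kadj: "B (K x) y = B x (K y)" for x y
    by (simp add: K_def B.diff_left B.diff_right adj B.scaleR_left B.scaleR_right)
  have Kinj: "x = 0" if "K x = 0" for x using that by (intro \<theta>_ev) (simp add: K_def)
  obtain m where m: "m > 0" "\<And>x. m * norm x \<le> norm (K x)"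
    using linear_inj_lower_bound[OF K Kinj] by blast
  obtain b where b: "b > 0" "\<And>x. b * (norm x)\<^sup>2 \<le> B x x"
    using posdef_lower_bound[OF B pos] by blast
  show ?thesis
  \<comment> \<open>The gain \<open>b * m\<^sup>2\<close> combines the coercivity \<open>b\<close>
    of \<open>B\<close> with the lower bound \<open>m\<close> of \<open>K\<close>, which is
    injective because \<theta> is not an eigenvalue of the square of \<open>L\<close>.\<close>
  proof (rule that[of "\<lambda>x y. B (K x) y" \<theta> "b * m\<^sup>2"])
    show "bounded_bilinear (\<lambda>x y. B (K x) y)" by (rule B.comp1[OF K])
    have "K v = (\<mu>\<^sup>2 - \<theta>) *\<^sub>R v" by (simp add: K_def v Llin algebra_simps power2_eq_square)
    then show "B (K v) v > 0" using \<theta> pos[OF v(1)] by (simp add: B.scaleR_left)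
    fix x
    have KL: "K (L x) = L (K x)" by (simp add: K_def Llin)
    have "B (K (L x)) (L x) - \<theta> * B (K x) x = B (K x) (L (L x)) - \<theta> * B (K x) x"
      by (simp add: KL adj)
    also have "\<dots> = B (K x) (K x)" by (simp add: K_def[of x] B.diff_right B.scaleR_right)
    also have "\<dots> \<ge> b * (norm (K x))\<^sup>2" by (rule b)
    finally have "B (K (L x)) (L x) - \<theta> * B (K x) x \<ge> b * (norm (K x))\<^sup>2" .
    moreover have "b * (norm (K x))\<^sup>2 \<ge> b * (m * norm x)\<^sup>2"
      using m b by (intro mult_left_mono power_mono) auto
    ultimately show "B (K (L x)) (L x) \<ge> \<theta> * B (K x) x + b * m\<^sup>2 * (norm x)\<^sup>2"
      by (simp add: power_mult_distrib)
  qed (use \<theta> m b in auto)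
qed

lemma negligible_trapped_near_unstable:
  fixes F L :: "'a::euclidean_space \<Rightarrow> 'a"
  assumes sd: "strict_deriv F L p"
    and B: "bounded_bilinear B" and sym: "\<And>x y. B x y = B y x"
    and pos: "\<And>x. x \<noteq> 0 \<Longrightarrow> B x x > (0::real)"
    and adj: "\<And>x y. B (L x) y = B x (L y)"
    and v: "v \<noteq> 0" "L v = \<mu> *\<^sub>R v" "\<bar>\<mu>\<bar> > 1"
  obtains d where "d > 0" "\<And>\<delta>. \<delta> < d \<Longrightarrow> negligible {x. \<forall>n. (F ^^ n) x \<in> cball p \<delta>}"
proof -
  have L: "bounded_linear L" using sd by (rule strict_deriv_bounded_linear)
  obtain Q \<theta> c where Q: "bounded_bilinear Q" and \<theta>: "\<theta> > 1" and c: "c > 0" and Qv: "Q v v > (0::real)"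
    and QL: "\<And>x. Q (L x) (L x) \<ge> \<theta> * Q x x + c * (norm x)\<^sup>2"
    using expanding_quadratic_form[OF B sym pos bounded_linear.linear[OF L] adj v] by blast
  interpret Q: bounded_bilinear Q by fact
  obtain M where M: "M > 0" "\<And>x y. norm (Q x y) \<le> norm x * norm y * M" using Q.pos_bounded by blast
  obtain N where N: "N > 0" "\<And>x. norm (L x) \<le> norm x * N" using bounded_linear.pos_bounded[OF L] by blast
  \<comment> \<open>Replacing \<open>L (x - y)\<close> by \<open>F x - F y\<close> changes the form
    by at most \<open>e * (M * (2 * N + 1))\<close> times the squared distance; this choice lets the
    spare term with \<open>c\<close> absorb the change. The bound \<open>1\<close> gives the factor
    \<open>N + 1\<close> for \<open>F\<close>.\<close>
  define e where "e = min 1 (c / (M * (2 * N + 1)))"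
  have e: "e > 0" "e \<le> 1" "e * (M * (2 * N + 1)) \<le> c"
  proof -
    show "e > 0" "e \<le> 1" using c M N by (auto simp: e_def intro!: divide_pos_pos mult_pos_pos)
    have "e * (M * (2 * N + 1)) \<le> c / (M * (2 * N + 1)) * (M * (2 * N + 1))"
      using M N by (intro mult_right_mono) (auto simp: e_def)
    also have "\<dots> = c" using M N by simp
    finally show "e * (M * (2 * N + 1)) \<le> c" .
  qed
  obtain d where d: "d > 0" "\<And>x y. x \<in> ball p d \<Longrightarrow> y \<in> ball p d \<Longrightarrow>
      norm (F x - F y - L (x - y)) \<le> e * norm (x - y)"
    using strict_derivE[OF sd e(1)] by blast
  have expand: "Q (F x - F y) (F x - F y) \<ge> \<theta> * Q (x - y) (x - y)"
    if "x \<in> ball p d" "y \<in> ball p d" for x y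
  proof -
    define h z l where "h = x - y" and "z = F x - F y" and "l = L (x - y)"
    have n1: "norm (z - l) \<le> e * norm h" using d(2)[OF that] by (simp add: h_def z_def l_def)
    have n2: "norm l \<le> N * norm h" using N(2)[of h] by (simp add: l_def h_def mult.commute)
    have n3: "norm z \<le> (N + 1) * norm h"
    proof -
      have "norm z \<le> norm l + norm (z - l)" by (metis norm_triangle_sub)
      also have "\<dots> \<le> N * norm h + 1 * norm h"
        using n1 n2 e by (intro add_mono order_trans[OF n1] mult_right_mono) auto
      finally show ?thesis by (simp add: algebra_simps)
    qed
    have "Q z z - Q l l = Q (z - l) z + Q l (z - l)" by (simp add: Q.diff_left Q.diff_right)
    then have "\<bar>Q z z - Q l l\<bar> \<le> norm (Q (z - l) z) + norm (Q l (z - l))" by simp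
    also have "\<dots> \<le> norm (z - l) * norm z * M + norm l * norm (z - l) * M" by (intro add_mono M)
    also have "\<dots> \<le> (e * norm h) * ((N + 1) * norm h) * M + (N * norm h) * (e * norm h) * M"
      using n1 n2 n3 e N M by (intro add_mono mult_right_mono mult_mono) auto
    also have "\<dots> = e * (M * (2 * N + 1)) * (norm h)\<^sup>2" by (simp add: power2_eq_square algebra_simps)
    also have "\<dots> \<le> c * (norm h)\<^sup>2" using e by (intro mult_right_mono) auto
    finally have "Q z z \<ge> Q l l - c * (norm h)\<^sup>2" by linarith
    with QL[of h] show ?thesis unfolding h_def z_def l_def by linarith
  qed
  show ?thesis
  proof (rule that[OF d(1)])
    fix \<delta> assume \<delta>: "\<delta> < d"
    define W where "W = {x. \<forall>n. (F ^^ n) x \<in> cball p \<delta>}"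
    have sub: "cball p \<delta> \<subseteq> ball p d" using \<delta> by auto
    have "(N + 1)-lipschitz_on (ball p d) F"
    proof (rule lipschitz_onI)
      fix x y assume xy: "x \<in> ball p d" "y \<in> ball p d"
      have "norm (F x - F y) \<le> norm (L (x - y)) + norm (F x - F y - L (x - y))" by (metis norm_triangle_sub)
      also have "\<dots> \<le> norm (x - y) * N + 1 * norm (x - y)"
        using e by (intro add_mono N order_trans[OF d(2)[OF xy]] mult_right_mono) auto
      finally show "dist (F x) (F y) \<le> (N + 1) * dist x y" by (simp add: dist_norm algebra_simps)
    qed (use N in simp)
    then have "continuous_on (cball p \<delta>) F"
      using lipschitz_on_continuous_on continuous_on_subset sub by blast
    then have cW: "compact W" unfolding W_def by (intro compact_iterates_in compact_cball)
    show "negligible {x. \<forall>n. (F ^^ n) x \<in> cball p \<delta>}"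
      unfolding W_def[symmetric]
    proof (rule negligible_line_transversal[OF cW, of v], rule ccontr)
      fix x t assume x: "x \<in> W" and y: "x + t *\<^sub>R v \<in> W" and t: "t \<noteq> 0"
      \<comment> \<open>The initial difference is a nonzero multiple of \<open>v\<close>, so
        \<open>q 0\<close> is positive and \<open>q\<close> grows at least like the powers of
        \<theta>. Two orbits that remain in one ball keep \<open>q\<close> bounded, a
        contradiction.\<close>
      define q where "q n = Q ((F ^^ n) (x + t *\<^sub>R v) - (F ^^ n) x) ((F ^^ n) (x + t *\<^sub>R v) - (F ^^ n) x)" for n
      have q0: "q 0 > 0" 
      proof -
        have "q 0 = (t * t) * Q v v" by (simp add: q_def Q.scaleR_left Q.scaleR_right)
        moreover have "t * t > 0" using t by (cases "t > 0") (auto simp: mult_neg_neg)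
        ultimately show ?thesis using Qv by simp
      qed
      have inb: "(F ^^ n) x \<in> cball p \<delta>" "(F ^^ n) (x + t *\<^sub>R v) \<in> cball p \<delta>" for n
        using x y by (auto simp: W_def)
      have qs: "q (Suc n) \<ge> \<theta> * q n" for n
        unfolding q_def funpow.simps comp_def by (rule expand) (use inb sub in blast)+
      have ql: "\<theta> ^ n * q 0 \<le> q n" for n
      proof (induction n)
        case (Suc n)
        have "\<theta> ^ Suc n * q 0 \<le> \<theta> * q n" using Suc \<theta> by simp
        with qs[of n] show ?case by linarith
      qed simp
      have qu: "q n \<le> (2 * \<delta>) * (2 * \<delta>) * M" for n
      proof -
        have nn: "norm ((F ^^ n) (x + t *\<^sub>R v) - (F ^^ n) x) \<le> 2 * \<delta>"
          using dist_triangle2[of "(F ^^ n) (x + t *\<^sub>R v)" "(F ^^ n) x" p] inb[of n]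
          by (simp add: dist_norm norm_minus_commute)
        have "q n \<le> norm (q n)" by simp
        also have "\<dots> \<le> (2 * \<delta>) * (2 * \<delta>) * M"
          unfolding q_def using nn M order_trans[OF norm_ge_zero nn]
          by (intro order_trans[OF M(2)] mult_right_mono mult_mono) auto
        finally show ?thesis .
      qed
      obtain n where "\<theta> ^ n > (2 * \<delta>) * (2 * \<delta>) * M / q 0" using real_arch_pow[OF \<theta>] by blast
      then have "\<theta> ^ n * q 0 > (2 * \<delta>) * (2 * \<delta>) * M" using q0 by (simp add: pos_divide_less_eq)
      with ql[of n] qu[of n] show False by linarith
    qed
  qed
qed

section \<open>Real-analytic maps\<close>

text \<open>A power series that converges at the corner \<open>(r, \<dots>, r)\<close> converges absolutely there.\<close>

lemma real_analytic_on_expansion: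
  fixes F :: "'a::euclidean_space \<Rightarrow> 'b::euclidean_space"
  assumes F: "real_analytic_on S F" and S: "open S" "a \<in> S"
  obtains r C where "r > 0" and "(\<lambda>k. (\<Prod>i\<in>Basis. r ^ k i) * \<bar>C k\<bar>) summable_on (Basis \<rightarrow>\<^sub>E (UNIV::nat set))"
    and "\<And>y. (\<And>i. i \<in> Basis \<Longrightarrow> \<bar>y \<bullet> i\<bar> \<le> r) \<Longrightarrow> a + y \<in> S \<and>
      ((\<lambda>k. (\<Prod>i\<in>Basis. (y \<bullet> i) ^ k i) * C k) has_sum (F (a + y) \<bullet> j)) (Basis \<rightarrow>\<^sub>E (UNIV::nat set))"
proof -
  obtain \<rho> coef where \<rho>: "\<rho> > 0" and hs: "\<And>x. x \<in> S \<inter> ball a \<rho> \<Longrightarrow>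
        ((\<lambda>k. (\<Prod>i\<in>Basis. ((x - a) \<bullet> i) ^ k i) *\<^sub>R coef k) has_sum F x) (Basis \<rightarrow>\<^sub>E (UNIV :: nat set))"
    using F S(2) unfolding real_analytic_on_def by metis
  obtain e where e: "e > 0" "ball a e \<subseteq> S" using S openE by metis
  define C where "C k = coef k \<bullet> j" for k
  \<comment> \<open>The cube of half-side \<open>r\<close> lies in both balls, since the norm is at
    most the sum of the absolute coordinates.\<close>
  define r where "r = min e \<rho> / (2 * real DIM('a))"
  have r: "r > 0" using e \<rho> by (simp add: r_def)
  have "min e \<rho> > 0" "real DIM('a) * r = min e \<rho> / 2" using e \<rho> by (simp_all add: r_def)
  then have rD: "real DIM('a) * r < min e \<rho>" by linarith
  have exp: "a + y \<in> S \<and> ((\<lambda>k. (\<Prod>i\<in>Basis. (y \<bullet> i) ^ k i) * C k) has_sum (F (a + y) \<bullet> j)) (Basis \<rightarrow>\<^sub>E UNIV)"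
    if y: "\<And>i. i \<in> Basis \<Longrightarrow> \<bar>y \<bullet> i\<bar> \<le> r" for y
  proof -
    have "norm y \<le> (\<Sum>i\<in>Basis. \<bar>y \<bullet> i\<bar>)" by (rule norm_le_l1)
    also have "\<dots> \<le> (\<Sum>i\<in>(Basis::'a set). r)" by (intro sum_mono y)
    finally have "norm y < min e \<rho>" using rD by simp
    then have "a + y \<in> S \<inter> ball a \<rho>" using e by (auto simp: dist_norm subset_iff)
    then show ?thesis
      using has_sum_bounded_linear[OF bounded_linear_inner_left[of j] hs[of "a + y"]]
      by (simp add: C_def o_def)
  qed
  have "((\<lambda>k. (\<Prod>i\<in>Basis. ((\<Sum>l\<in>Basis. r *\<^sub>R l) \<bullet> i) ^ k i) * C k)
      has_sum (F (a + (\<Sum>l\<in>Basis. r *\<^sub>R l)) \<bullet> j)) (Basis \<rightarrow>\<^sub>E UNIV)"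
    using exp[of "\<Sum>l\<in>Basis. r *\<^sub>R l"] r by (simp add: inner_sum_left_Basis)
  then have "(\<lambda>k. (\<Prod>i\<in>Basis. r ^ k i) * C k) summable_on (Basis \<rightarrow>\<^sub>E (UNIV::nat set))"
    by (auto simp: inner_sum_left_Basis summable_on_def)
  then have "(\<lambda>k. norm ((\<Prod>i\<in>Basis. r ^ k i) * C k)) summable_on (Basis \<rightarrow>\<^sub>E (UNIV::nat set))"
    by (rule summable_on_iff_abs_summable_on_real[THEN iffD1])
  moreover have "norm ((\<Prod>i\<in>Basis. r ^ k i) * C k) = (\<Prod>i\<in>Basis. r ^ k i) * \<bar>C k\<bar>" for k :: "'a \<Rightarrow> nat"
    using r by (simp add: abs_mult abs_prod power_abs)
  ultimately show ?thesis using that[OF r] exp by simp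
qed

text \<open>Shrinking all variables by \<open>t\<close> gains a factor \<open>t\<^sup>2\<close> on
  every monomial of degree at least two. Summed over the series, this bounds the remainder after the
  affine part.\<close>

lemma prod_power_degree_bound:
  fixes x :: "'a \<Rightarrow> real"
  assumes "finite I" "\<And>i. i \<in> I \<Longrightarrow> \<bar>x i\<bar> \<le> t * r" "0 \<le> t" "t \<le> 1" "0 \<le> r" "2 \<le> sum k I"
  shows "\<bar>\<Prod>i\<in>I. x i ^ k i\<bar> \<le> t\<^sup>2 * (\<Prod>i\<in>I. r ^ k i)"
proof -
  have "\<bar>\<Prod>i\<in>I. x i ^ k i\<bar> = (\<Prod>i\<in>I. \<bar>x i\<bar> ^ k i)" by (simp add: abs_prod power_abs)
  also have "\<dots> \<le> (\<Prod>i\<in>I. (t * r) ^ k i)" using assms by (intro prod_mono conjI power_mono) auto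
  also have "\<dots> = t ^ sum k I * (\<Prod>i\<in>I. r ^ k i)" by (simp add: power_mult_distrib prod.distrib power_sum)
  also have "\<dots> \<le> t\<^sup>2 * (\<Prod>i\<in>I. r ^ k i)"
    using assms by (intro mult_right_mono power_decreasing prod_nonneg) auto
  finally show ?thesis .
qed

text \<open>The monomials of degree below two are finitely many and form a polynomial. The rest of
  the series is at most \<open>(norm y / r)\<^sup>2\<close> times a fixed sum, so its derivative at
  the centre is zero. The transition maps of the atlas get their differentiability from
  here.\<close>

lemma real_analytic_on_differentiable:
  fixes F :: "'a::euclidean_space \<Rightarrow> 'b::euclidean_space"
  assumes F: "real_analytic_on S F" and S: "open S" "a \<in> S"
  shows "F differentiable (at a)"
proof -
  have "(\<lambda>x. F x \<bullet> j) differentiable (at a)" for j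
  proof -
    let ?K = "(Basis :: 'a set) \<rightarrow>\<^sub>E (UNIV::nat set)"
    obtain r C where r: "r > 0" and Msum: "(\<lambda>k. (\<Prod>i\<in>Basis. r ^ k i) * \<bar>C k\<bar>) summable_on ?K"
      and exp: "\<And>y. (\<And>i. i \<in> Basis \<Longrightarrow> \<bar>y \<bullet> i\<bar> \<le> r) \<Longrightarrow> a + y \<in> S \<and>
        ((\<lambda>k. (\<Prod>i\<in>Basis. (y \<bullet> i) ^ k i) * C k) has_sum (F (a + y) \<bullet> j)) ?K"
      using real_analytic_on_expansion[OF F S, of j] by blast
    define T where "T k y = (\<Prod>i\<in>Basis. (y \<bullet> i) ^ k i) * C k" for k and y :: 'a
    define M where "M k = (\<Prod>i\<in>Basis. r ^ k i) * \<bar>C k\<bar>" for k :: "'a \<Rightarrow> nat"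
    define L where "L = {k\<in>?K. sum k Basis < 2}"
    have "L \<subseteq> Basis \<rightarrow>\<^sub>E {..<2}"
    proof
      fix k assume k: "k \<in> L"
      have "k i < 2" if "i \<in> Basis" for i
        using member_le_sum[of i Basis k] that k by (simp add: L_def)
      then show "k \<in> Basis \<rightarrow>\<^sub>E {..<2}" using k by (auto simp: L_def PiE_iff)
    qed
    then have finL: "finite L" by (rule finite_subset) (auto intro: finite_PiE)
    define P where "P y = (\<Sum>k\<in>L. T k y)" for y
    define m where "m = infsum M (?K - L)"
    have bound: "\<bar>F (a + y) \<bullet> j - P y\<bar> \<le> (norm y / r)\<^sup>2 * m" if y: "norm y \<le> r" for y
    proof -
      have yi: "\<bar>y \<bullet> i\<bar> \<le> r" "\<bar>y \<bullet> i\<bar> \<le> norm y / r * r" if "i \<in> Basis" for i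
        using Basis_le_norm[OF that, of y] y r by auto
      have 1: "((\<lambda>k. T k y) has_sum (F (a + y) \<bullet> j)) ?K"
        using exp[OF yi(1)] by (simp add: T_def[abs_def])
      have "((\<lambda>k. T k y) has_sum (F (a + y) \<bullet> j - P y)) (?K - L)"
        unfolding P_def by (rule has_sum_Diff[OF 1 has_sum_finite[OF finL]]) (auto simp: L_def)
      moreover have "((\<lambda>k. (norm y / r)\<^sup>2 * M k) has_sum ((norm y / r)\<^sup>2 * m)) (?K - L)"
        unfolding m_def using summable_on_subset_banach[OF Msum, of "?K - L"]
        by (intro has_sum_cmult_right has_sum_infsum) (auto simp: M_def[abs_def])
      ultimately have "norm (F (a + y) \<bullet> j - P y) \<le> (norm y / r)\<^sup>2 * m"
      proof (rule norm_infsum_le)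
        show "\<And>k. k \<in> ?K - L \<Longrightarrow> norm (T k y) \<le> (norm y / r)\<^sup>2 * M k"
        proof -
          fix k assume "k \<in> ?K - L"
          then have "2 \<le> sum k Basis" by (auto simp: L_def)
          then have "\<bar>\<Prod>i\<in>Basis. (y \<bullet> i) ^ k i\<bar> \<le> (norm y / r)\<^sup>2 * (\<Prod>i\<in>Basis. r ^ k i)"
            using yi(2) y r by (intro prod_power_degree_bound) auto
          then have "\<bar>\<Prod>i\<in>Basis. (y \<bullet> i) ^ k i\<bar> * \<bar>C k\<bar> \<le> (norm y / r)\<^sup>2 * (\<Prod>i\<in>Basis. r ^ k i) * \<bar>C k\<bar>"
            by (intro mult_right_mono) auto
          then show "norm (T k y) \<le> (norm y / r)\<^sup>2 * M k"
            by (simp add: T_def M_def abs_mult mult.assoc)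
        qed
      qed
      then show ?thesis by simp
    qed
    define R where "R y = F (a + y) \<bullet> j - P y" for y
    have "(R has_derivative (\<lambda>h. 0)) (at 0)"
    proof (rule has_derivativeI_sandwich[OF r, where H="\<lambda>y. norm y * (m / r\<^sup>2)"])
      fix y :: 'a assume y: "y \<noteq> 0" "dist y 0 < r"
      have "R 0 = 0" using bound[of 0] r by (simp add: R_def)
      then have "norm (R y - R 0 - 0) \<le> (norm y / r)\<^sup>2 * m" using bound[of y] y by (simp add: R_def)
      then have "norm (R y - R 0 - 0) / norm (y - 0) \<le> (norm y / r)\<^sup>2 * m / norm y"
        using y by (simp add: divide_right_mono)
      also have "\<dots> = norm y * (m / r\<^sup>2)" using y by (simp add: power2_eq_square)
      finally show "norm (R y - R 0 - 0) / norm (y - 0) \<le> norm y * (m / r\<^sup>2)" .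
    next
      have "((\<lambda>y. norm (y::'a) * (m / r\<^sup>2)) \<longlongrightarrow> norm (0::'a) * (m / r\<^sup>2)) (at 0)"
        by (intro tendsto_intros)
      then show "((\<lambda>y. norm (y::'a) * (m / r\<^sup>2)) \<longlongrightarrow> 0) (at 0)" by simp
    qed simp
    then have "R differentiable (at 0)" by (rule differentiableI)
    moreover have "P differentiable (at 0)"
      unfolding P_def[abs_def] T_def
    proof (intro differentiable_sum[OF finL] ballI differentiable_mult differentiable_const)
      fix k
      have "\<forall>i. \<exists>D. ((\<lambda>y. (y \<bullet> i) ^ k i) has_derivative D) (at (0::'a))"
        unfolding differentiable_def[symmetric]
        by (intro allI differentiable_power differentiable_inner differentiable_ident differentiable_const)
      then obtain D where "\<And>i. ((\<lambda>y. (y \<bullet> i) ^ k i) has_derivative D i) (at (0::'a))" by metis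
      then show "(\<lambda>y. \<Prod>i\<in>Basis. (y \<bullet> i) ^ k i) differentiable (at (0::'a))"
        by (intro differentiableI[OF has_derivative_prod])
    qed
    ultimately have "(\<lambda>y. P y + R y) differentiable (at 0)" by (rule differentiable_add[rotated])
    then have D: "(\<lambda>y. F (a + y) \<bullet> j) differentiable (at (- a + a))" by (simp add: R_def)
    have "(\<lambda>x. - a + x) differentiable (at a)" by (intro derivative_intros)
    from differentiable_chain_at[OF this D] show ?thesis by (simp add: o_def)
  qed
  then show ?thesis using differentiable_componentwise_within[of F a UNIV] by simp
qed

text \<open>The directional derivative of \<open>F\<close> along a line is the derivative at \<open>s = 0\<close> of
  \<open>F(a + \<beta> u + s h)\<close>; the power series of the latter converges for complex \<open>\<beta>\<close>, \<open>s\<close>, and Cauchy's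
  inequality in \<open>s\<close> makes the series of the derivatives uniformly convergent in \<open>\<beta>\<close>.\<close>

lemma real_analytic_on_derivative_extension:
  fixes F :: "'a::euclidean_space \<Rightarrow> 'b::euclidean_space"
  assumes F: "real_analytic_on S F" and S: "open S" "a \<in> S"
  obtains \<delta> \<Phi> where "\<delta> > 0" "\<Phi> holomorphic_on ball 0 \<delta>"
    "\<And>\<beta>. \<bar>\<beta>\<bar> < \<delta> \<Longrightarrow> a + \<beta> *\<^sub>R u \<in> S \<and>
       \<Phi> (of_real \<beta>) = of_real (frechet_derivative F (at (a + \<beta> *\<^sub>R u)) h \<bullet> j)"
proof -
  define K where "K = (Basis :: 'a set) \<rightarrow>\<^sub>E (UNIV::nat set)"
  obtain r C where r: "r > 0" and Msum: "(\<lambda>k. (\<Prod>i\<in>Basis. r ^ k i) * \<bar>C k\<bar>) summable_on K"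
    and exp: "\<And>y. (\<And>i. i \<in> Basis \<Longrightarrow> \<bar>y \<bullet> i\<bar> \<le> r) \<Longrightarrow> a + y \<in> S \<and>
      ((\<lambda>k. (\<Prod>i\<in>Basis. (y \<bullet> i) ^ k i) * C k) has_sum (F (a + y) \<bullet> j)) K"
    using real_analytic_on_expansion[OF F S, of j] unfolding K_def by blast
  define N where "N = norm u + norm h + 1"
  have N: "N > 0" "norm u \<le> N" "norm h \<le> N" by (auto simp: N_def add_nonneg_pos)
  \<comment> \<open>For complex \<beta> and \<open>s\<close> of modulus at most \<delta>, every
    coordinate of the complexified point has modulus at most \<open>r\<close>, where the majorant
    \<open>M\<close> applies.\<close>
  define \<delta> where "\<delta> = r / (2 * N)"
  have \<delta>: "\<delta> > 0" "\<delta> * N + \<delta> * N = r" using r N by (auto simp: \<delta>_def field_simps)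
  define z where "z \<beta> s i = \<beta> * of_real (u \<bullet> i) + s * of_real (h \<bullet> i)" for \<beta> s :: complex and i
  define P where "P k \<beta> s = (\<Prod>i\<in>Basis. z \<beta> s i ^ k i) * of_real (C k)" for k \<beta> s
  \<comment> \<open>\<open>P'\<close> is the \<open>s\<close>-derivative of the term
    \<open>P\<close>, by the product rule over the coordinates.\<close>
  define P' where "P' k \<beta> s = (\<Sum>i\<in>Basis. (of_nat (k i) * (z \<beta> s i ^ (k i - 1) * of_real (h \<bullet> i))) *
      (\<Prod>l\<in>Basis - {i}. z \<beta> s l ^ k l)) * of_real (C k)" for k \<beta> s
  define M where "M k = (\<Prod>i\<in>Basis. r ^ k i) * \<bar>C k\<bar>" for k :: "'a \<Rightarrow> nat"
  have zb: "norm (z \<beta> s i) \<le> r" if "norm \<beta> \<le> \<delta>" "norm s \<le> \<delta>" "i \<in> Basis" for \<beta> s i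
  proof -
    have "norm (z \<beta> s i) \<le> norm \<beta> * \<bar>u \<bullet> i\<bar> + norm s * \<bar>h \<bullet> i\<bar>"
      unfolding z_def by (rule order_trans[OF norm_triangle_ineq]) (simp add: norm_mult)
    also have "\<dots> \<le> \<delta> * N + \<delta> * N"
      using that N Basis_le_norm[OF that(3), of u] Basis_le_norm[OF that(3), of h] \<delta>
      by (intro add_mono mult_mono) auto
    finally show ?thesis using \<delta> by simp
  qed
  have PM: "norm (P k \<beta> s) \<le> M k" if "norm \<beta> \<le> \<delta>" "norm s \<le> \<delta>" for k \<beta> s
    unfolding P_def M_def norm_mult prod_norm[symmetric] norm_power norm_of_real
    using that zb by (intro mult_right_mono prod_mono conjI power_mono) auto
  have PD: "(P k \<beta> has_field_derivative P' k \<beta> s) (at s)" for k \<beta> s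
    unfolding P_def[abs_def] P'_def z_def
    by (intro DERIV_cmult_right has_field_derivative_prod) (auto intro!: derivative_eq_intros)
  have P'M: "norm (P' k \<beta> 0) \<le> M k / \<delta>" if "norm \<beta> \<le> \<delta>" for k \<beta>
  proof -
    have "cmod ((deriv ^^ 1) (P k \<beta>) 0) \<le> fact 1 * M k / \<delta> ^ 1"
    proof (rule Cauchy_inequality)
      show "P k \<beta> holomorphic_on ball 0 \<delta>" "continuous_on (cball 0 \<delta>) (P k \<beta>)"
        unfolding P_def[abs_def] z_def by (auto intro!: holomorphic_intros continuous_intros)
    qed (use \<delta> PM that in auto)
    then show ?thesis using DERIV_imp_deriv[OF PD] by simp
  qed
  have Mnn: "M k \<ge> 0" for k using r by (auto simp: M_def intro!: mult_nonneg_nonneg prod_nonneg)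
  have MS: "M summable_on K" using Msum by (simp add: M_def[abs_def])
  define \<Phi> where "\<Phi> \<beta> = infsum (\<lambda>k. P' k \<beta> 0) K" for \<beta>
  have ul\<Phi>: "uniform_limit (cball 0 \<delta>) (\<lambda>X \<beta>. \<Sum>k\<in>X. P' k \<beta> 0) \<Phi> (finite_subsets_at_top K)"
    unfolding \<Phi>_def[abs_def]
  proof (rule Weierstrass_m_test_general)
    show "(\<lambda>k. M k / \<delta>) summable_on K"
      using summable_on_cmult_left[OF MS, of "1 / \<delta>"] by simp
  qed (use P'M in auto)
  have hol: "\<Phi> holomorphic_on ball 0 \<delta>"
  proof (rule holomorphic_uniform_limit[OF _ ul\<Phi>])
    show "\<forall>\<^sub>F X in finite_subsets_at_top K. continuous_on (cball 0 \<delta>) (\<lambda>\<beta>. \<Sum>k\<in>X. P' k \<beta> 0) \<and>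
        (\<lambda>\<beta>. \<Sum>k\<in>X. P' k \<beta> 0) holomorphic_on ball 0 \<delta>"
      unfolding P'_def z_def by (intro always_eventually allI conjI continuous_intros holomorphic_intros)
  qed auto
  show ?thesis
  proof (rule that[OF \<delta>(1) hol])
    fix \<beta> :: real assume \<beta>: "\<bar>\<beta>\<bar> < \<delta>"
    have real: "a + (\<beta> *\<^sub>R u + s *\<^sub>R h) \<in> S \<and>
        (P k (of_real \<beta>) (of_real s) = of_real ((\<Prod>i\<in>Basis. ((\<beta> *\<^sub>R u + s *\<^sub>R h) \<bullet> i) ^ k i) * C k)) \<and>
        infsum (\<lambda>k. P k (of_real \<beta>) (of_real s)) K = of_real (F (a + (\<beta> *\<^sub>R u + s *\<^sub>R h)) \<bullet> j)"
      if "\<bar>s\<bar> \<le> \<delta>" for s k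
    proof -
      have zr: "z (of_real \<beta>) (of_real s) i = of_real ((\<beta> *\<^sub>R u + s *\<^sub>R h) \<bullet> i)" for i
        by (simp add: z_def inner_add_left)
      have Pr: "P k (of_real \<beta>) (of_real s) = of_real ((\<Prod>i\<in>Basis. ((\<beta> *\<^sub>R u + s *\<^sub>R h) \<bullet> i) ^ k i) * C k)" for k
        unfolding P_def zr by simp
      have "\<bar>(\<beta> *\<^sub>R u + s *\<^sub>R h) \<bullet> i\<bar> \<le> r" if "i \<in> Basis" for i
        using zb[of "of_real \<beta>" "of_real s" i] \<open>\<bar>s\<bar> \<le> \<delta>\<close> \<beta> that unfolding zr by simp
      note e = exp[OF this]
      have "((\<lambda>k. P k (of_real \<beta>) (of_real s)) has_sum of_real (F (a + (\<beta> *\<^sub>R u + s *\<^sub>R h)) \<bullet> j)) K"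
        unfolding Pr by (rule has_sum_of_real) (use e in simp)
      then show ?thesis using e Pr by (auto intro: infsumI)
    qed
    have aS: "a + \<beta> *\<^sub>R u \<in> S" using real[of 0] \<delta> by simp
    \<comment> \<open>For fixed real \<beta>, \<open>H\<close> extends \<open>F\<close> along the
      line in direction \<open>h\<close> to complex \<open>s\<close>. Its derivative at
      \<open>0\<close> is computed twice: termwise it is the value of \<Phi>, and along real
      \<open>s\<close> it is the directional derivative of \<open>F\<close>.\<close>
    define H where "H s = infsum (\<lambda>k. P k (of_real \<beta>) s) K" for s
    have ulH: "uniform_limit (cball 0 \<delta>) (\<lambda>X s. \<Sum>k\<in>X. P k (of_real \<beta>) s) H (finite_subsets_at_top K)"
      unfolding H_def[abs_def] by (rule Weierstrass_m_test_general[OF _ MS]) (use PM \<beta> in auto)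
    have ev: "\<forall>\<^sub>F X in finite_subsets_at_top K. continuous_on (cball 0 \<delta>) (\<lambda>s. \<Sum>k\<in>X. P k (of_real \<beta>) s) \<and>
        (\<forall>w\<in>ball 0 \<delta>. ((\<lambda>s. \<Sum>k\<in>X. P k (of_real \<beta>) s) has_field_derivative (\<Sum>k\<in>X. P' k (of_real \<beta>) w)) (at w))"
    proof (intro always_eventually allI conjI ballI)
      show "continuous_on (cball 0 \<delta>) (\<lambda>s. \<Sum>k\<in>X. P k (of_real \<beta>) s)" for X
        unfolding P_def z_def by (intro continuous_intros)
      show "((\<lambda>s. \<Sum>k\<in>X. P k (of_real \<beta>) s) has_field_derivative (\<Sum>k\<in>X. P' k (of_real \<beta>) w)) (at w)" for X w
        by (intro DERIV_sum PD)
    qed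
    obtain g' where g': "\<And>w. w \<in> ball 0 \<delta> \<Longrightarrow> (H has_field_derivative g' w) (at w) \<and>
        ((\<lambda>X. \<Sum>k\<in>X. P' k (of_real \<beta>) w) \<longlongrightarrow> g' w) (finite_subsets_at_top K)"
      using has_complex_derivative_uniform_limit[OF ev ulH _ \<delta>(1)] by auto
    have "((\<lambda>X. \<Sum>k\<in>X. P' k (of_real \<beta>) 0) \<longlongrightarrow> \<Phi> (of_real \<beta>)) (finite_subsets_at_top K)"
      using tendsto_uniform_limitI[OF ul\<Phi>, of "of_real \<beta>"] \<beta> by simp
    then have g0: "g' 0 = \<Phi> (of_real \<beta>)"
      using g'[of 0] \<delta> tendsto_unique[of "finite_subsets_at_top K"] by auto
    have "(H has_field_derivative g' 0) (at (of_real 0))" using g'[of 0] \<delta> by simp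
    then have v1: "((\<lambda>s. H (of_real s)) has_vector_derivative g' 0) (at 0)"
      by (rule has_vector_derivative_real_field)
    have dF: "(F has_derivative frechet_derivative F (at (a + \<beta> *\<^sub>R u))) (at (a + \<beta> *\<^sub>R u))"
      using real_analytic_on_differentiable[OF F S(1) aS] by (simp add: frechet_derivative_works)
    have lin: "linear (frechet_derivative F (at (a + \<beta> *\<^sub>R u)))"
      using dF by (rule has_derivative_linear)
    have "((\<lambda>s. F (a + \<beta> *\<^sub>R u + s *\<^sub>R h)) has_derivative
        (\<lambda>s. frechet_derivative F (at (a + \<beta> *\<^sub>R u)) (s *\<^sub>R h))) (at (0::real))"
      by (rule has_derivative_compose[where g=F]) (auto intro!: derivative_eq_intros dF)
    then have "((\<lambda>s. F (a + \<beta> *\<^sub>R u + s *\<^sub>R h) \<bullet> j) has_derivative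
        (\<lambda>s. frechet_derivative F (at (a + \<beta> *\<^sub>R u)) (s *\<^sub>R h) \<bullet> j)) (at (0::real))"
      by (rule has_derivative_inner_left)
    then have "((\<lambda>s. F (a + \<beta> *\<^sub>R u + s *\<^sub>R h) \<bullet> j) has_real_derivative
        frechet_derivative F (at (a + \<beta> *\<^sub>R u)) h \<bullet> j) (at 0)"
      by (rule has_derivative_imp_has_field_derivative) (simp add: linear_scale[OF lin] mult.commute)
    then have "((\<lambda>s. of_real (F (a + \<beta> *\<^sub>R u + s *\<^sub>R h) \<bullet> j)) has_vector_derivative
        complex_of_real (frechet_derivative F (at (a + \<beta> *\<^sub>R u)) h \<bullet> j)) (at 0)"
      by (rule has_vector_derivative_of_real)
    then have "((\<lambda>s. H (of_real s)) has_vector_derivative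
        complex_of_real (frechet_derivative F (at (a + \<beta> *\<^sub>R u)) h \<bullet> j)) (at 0)"
    proof (rule has_vector_derivative_transform_within_open[of _ _ _ "ball 0 \<delta>"])
      fix s :: real assume "s \<in> ball 0 \<delta>"
      then show "complex_of_real (F (a + \<beta> *\<^sub>R u + s *\<^sub>R h) \<bullet> j) = H (of_real s)"
        using real[THEN conjunct2, THEN conjunct2, of s] by (simp add: H_def add.assoc)
    qed (use \<delta> in auto)
    then have "g' 0 = of_real (frechet_derivative F (at (a + \<beta> *\<^sub>R u)) h \<bullet> j)"
      using vector_derivative_unique_at v1 by blast
    then show "a + \<beta> *\<^sub>R u \<in> S \<and> \<Phi> (of_real \<beta>) = of_real (frechet_derivative F (at (a + \<beta> *\<^sub>R u)) h \<bullet> j)"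
      using aS g0 by simp
  qed
qed

section \<open>Jacobian determinants and zeros of analytic functions\<close>

definition basis_list :: "'e::euclidean_space list" where
  "basis_list = (SOME bs. set bs = Basis \<and> distinct bs)"

lemma basis_list:
  shows "set basis_list = (Basis :: 'e::euclidean_space set)"
    and "distinct (basis_list :: 'e list)"
    and "length (basis_list :: 'e list) = DIM('e)"
proof -
  have *: "set basis_list = (Basis :: 'e set) \<and> distinct (basis_list :: 'e list)"
    using someI_ex[OF finite_distinct_list[OF finite_Basis]] unfolding basis_list_def by blast
  then show "set basis_list = (Basis :: 'e set)" "distinct (basis_list :: 'e list)" by simp_all
  then show "length (basis_list :: 'e list) = DIM('e)" by (metis distinct_card)
qed

text \<open>The Leibniz formula over an arbitrary commutative ring: real entries can be replaced by
  holomorphic extensions, and the value remains holomorphic and agrees on the real axis.\<close>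

definition basis_det :: "('e::euclidean_space \<Rightarrow> 'e \<Rightarrow> 'c::comm_ring_1) \<Rightarrow> 'c" where
  "basis_det M = (\<Sum>p | p permutes {0..<DIM('e)}.
     of_int (sign p) * (\<Prod>i = 0..<DIM('e). M (basis_list ! i) (basis_list ! p i)))"

lemma basis_det_eq_0_iff:
  fixes L :: "'e::euclidean_space \<Rightarrow> 'e"
  assumes L: "linear L"
  shows "basis_det (\<lambda>i j. L j \<bullet> i) = 0 \<longleftrightarrow> (\<exists>x. x \<noteq> 0 \<and> L x = 0)"
proof -
  define bs where "bs = (basis_list :: 'e list)"
  define n where "n = DIM('e)"
  have bs: "set bs = Basis" "distinct bs" and len: "length bs = n"
    unfolding bs_def n_def by (rule basis_list)+
  define A where "A = mat n n (\<lambda>(i, j). L (bs ! j) \<bullet> (bs ! i))"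
  have A: "A \<in> carrier_mat n n" by (simp add: A_def)
  have "p i < n" if "p permutes {0..<n}" "i < n" for p i
    using permutes_in_image[OF that(1), of i] that(2) by simp
  then have "Determinant.det A = basis_det (\<lambda>i j. L j \<bullet> i)"
    unfolding det_def'[OF A] basis_det_def bs_def[symmetric] n_def[symmetric]
    by (intro sum.cong refl arg_cong2[where f="(*)"] prod.cong) (auto simp: A_def)
  moreover define vec_of where "vec_of v = (\<Sum>j<n. (v $v j) *\<^sub>R (bs ! j))" for v
  have vec_comp: "vec_of v \<bullet> (bs ! i) = v $v i" if "i < n" for v i
  proof -
    have "vec_of v \<bullet> (bs ! i) = (\<Sum>j<n. (v $v j) * ((bs ! j) \<bullet> (bs ! i)))"
      by (simp add: vec_of_def inner_sum_left)
    also have "\<dots> = (\<Sum>j<n. if j = i then v $v i else 0)"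
    proof (rule sum.cong)
      fix j assume "j \<in> {..<n}"
      then show "(v $v j) * ((bs ! j) \<bullet> (bs ! i)) = (if j = i then v $v i else 0)"
        using that len bs nth_eq_iff_index_eq[OF bs(2), of j i] nth_mem[of j bs] nth_mem[of i bs]
        by (auto simp: inner_Basis)
    qed simp
    finally show ?thesis using that by simp
  qed
  have mult: "(A *\<^sub>v v) $v i = L (vec_of v) \<bullet> (bs ! i)" if "i < n" "v \<in> carrier_vec n" for v i
  proof -
    have "L (vec_of v) = (\<Sum>j<n. (v $v j) *\<^sub>R L (bs ! j))"
      using L by (simp add: vec_of_def linear_sum linear_scale)
    then show ?thesis using that
      by (simp add: A_def scalar_prod_def inner_sum_left atLeast0LessThan mult.commute)
  qed
  have eq0: "x = 0" if "\<And>i. i < n \<Longrightarrow> x \<bullet> (bs ! i) = 0" for x :: 'e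
  proof (rule euclidean_eqI)
    fix b :: 'e assume "b \<in> Basis"
    then obtain i where "i < n" "b = bs ! i" using bs(1) len by (metis in_set_conv_nth)
    then show "x \<bullet> b = 0 \<bullet> b" using that by simp
  qed
  have "(\<exists>v. v \<in> carrier_vec n \<and> v \<noteq> 0\<^sub>v n \<and> A *\<^sub>v v = 0\<^sub>v n) \<longleftrightarrow> (\<exists>x. x \<noteq> 0 \<and> L x = 0)"
  proof (intro iffI; clarify)
    fix v assume v: "v \<in> carrier_vec n" "v \<noteq> 0\<^sub>v n" "A *\<^sub>v v = 0\<^sub>v n"
    have "vec_of v \<noteq> 0"
    proof
      assume "vec_of v = 0"
      then have "v = 0\<^sub>v n" using v(1) vec_comp[of _ v] by (intro eq_vecI) auto
      then show False using v by simp
    qed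
    moreover have "L (vec_of v) = 0"
      using v mult[of _ v] by (intro eq0) auto
    ultimately show "\<exists>x. x \<noteq> 0 \<and> L x = 0" by blast
  next
    fix x assume x: "x \<noteq> 0" "L x = 0"
    define v where "v = vec n (\<lambda>i. x \<bullet> (bs ! i))"
    have v: "v \<in> carrier_vec n" by (simp add: v_def)
    have "vec_of v - x = 0" by (rule eq0) (simp add: inner_diff_left vec_comp v_def)
    then have vx: "vec_of v = x" by simp
    have "v \<noteq> 0\<^sub>v n"
    proof
      assume "v = 0\<^sub>v n"
      then have "vec_of v = 0" by (simp add: vec_of_def)
      then show False using vx x by simp
    qed
    moreover have "A *\<^sub>v v = 0\<^sub>v n" using A v mult[OF _ v] vx x by (intro eq_vecI) auto
    ultimately show "\<exists>v. v \<in> carrier_vec n \<and> v \<noteq> 0\<^sub>v n \<and> A *\<^sub>v v = 0\<^sub>v n" using v by blast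
  qed
  ultimately show ?thesis using det_0_iff_vec_prod_zero[OF A] by metis
qed

lemma basis_det_cong:
  fixes M M' :: "'e::euclidean_space \<Rightarrow> 'e \<Rightarrow> 'c::comm_ring_1"
  assumes "\<And>i j. i \<in> Basis \<Longrightarrow> j \<in> Basis \<Longrightarrow> M i j = M' i j"
  shows "basis_det M = basis_det M'"
proof -
  let ?bs = "basis_list :: 'e list"
  have "M (?bs ! i) (?bs ! p i) = M' (?bs ! i) (?bs ! p i)"
    if "p permutes {0..<DIM('e)}" "i \<in> {0..<DIM('e)}" for p i
  proof -
    have "p i \<in> {0..<DIM('e)}" using permutes_in_image[OF that(1)] that(2) by simp
    then show ?thesis
      using nth_mem[of i ?bs] nth_mem[of "p i" ?bs] that(2) basis_list[where 'e='e] by (intro assms) simp_all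
  qed
  then show ?thesis
    unfolding basis_det_def
    by (intro sum.cong refl arg_cong2[where f="(*)"] prod.cong) auto
qed

lemma continuous_on_basis_det:
  fixes M :: "'z::topological_space \<Rightarrow> 'e::euclidean_space \<Rightarrow> 'e \<Rightarrow> real"
  assumes "\<And>i j. continuous_on S (\<lambda>z. M z i j)"
  shows "continuous_on S (\<lambda>z. basis_det (M z))"
  unfolding basis_det_def by (intro continuous_intros assms)

lemma holomorphic_on_basis_det:
  fixes M :: "complex \<Rightarrow> 'e::euclidean_space \<Rightarrow> 'e \<Rightarrow> complex"
  assumes "\<And>i j. (\<lambda>z. M z i j) holomorphic_on S"
  shows "(\<lambda>z. basis_det (M z)) holomorphic_on S"
  unfolding basis_det_def by (intro holomorphic_intros assms)

lemma basis_det_of_real: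
  fixes M :: "'e::euclidean_space \<Rightarrow> 'e \<Rightarrow> real"
  shows "basis_det (\<lambda>i j. complex_of_real (M i j)) = of_real (basis_det M)"
  by (simp add: basis_det_def)

text \<open>If real zeros accumulate at \<open>a\<close>, the zeros of \<Phi> accumulate at
  \<open>0\<close>, and the identity theorem gives \<Phi> = 0 on the disc.\<close>

lemma real_zeros_isolated_or_locally_all:
  fixes \<phi> :: "real \<Rightarrow> real"
  assumes "\<delta> > 0" "\<Phi> holomorphic_on ball 0 \<delta>"
    and ext: "\<And>\<beta>. \<bar>\<beta>\<bar> < \<delta> \<Longrightarrow> \<Phi> (of_real \<beta>) = of_real (\<phi> (a + \<beta>))"
  shows "\<exists>d>0. (\<forall>t\<in>ball a d. \<phi> t = 0) \<or> (\<forall>t\<in>ball a d - {a}. \<phi> t \<noteq> 0)"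
proof (cases "\<exists>d>0. \<forall>t\<in>ball a d - {a}. \<phi> t \<noteq> 0")
  case False
  define U where "U = complex_of_real ` {\<beta>. \<bar>\<beta>\<bar> < \<delta> \<and> \<phi> (a + \<beta>) = 0}"
  have "0 islimpt U"
    unfolding islimpt_approachable
  proof (intro allI impI)
    fix e :: real assume "e > 0"
    then have "min e \<delta> > 0" using assms by simp
    then obtain t where t: "t \<in> ball a (min e \<delta>) - {a}" "\<phi> t = 0" using False by blast
    have "complex_of_real (t - a) \<in> U" 
      unfolding U_def using t by (intro imageI) (auto simp: dist_real_def)
    moreover have "complex_of_real (t - a) \<noteq> 0" using t by simp
    moreover have "dist (complex_of_real (t - a)) 0 = \<bar>t - a\<bar>" by (simp only: dist_norm diff_zero norm_of_real)
    then have "dist (complex_of_real (t - a)) 0 < e"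
      using t by (simp only: Diff_iff mem_ball dist_real_def abs_minus_commute[of a]) linarith
    ultimately show "\<exists>x'\<in>U. x' \<noteq> 0 \<and> dist x' 0 < e" by blast
  qed
  then have \<Phi>0: "\<Phi> w = 0" if "w \<in> ball 0 \<delta>" for w
    using assms that by (intro analytic_continuation[of \<Phi> "ball 0 \<delta>" U 0 w]) (auto simp: U_def)
  have "\<phi> t = 0" if "t \<in> ball a \<delta>" for t
  proof -
    have t: "\<bar>t - a\<bar> < \<delta>" using that by (simp add: dist_real_def abs_minus_commute)
    then have "of_real (t - a) \<in> ball (0::complex) \<delta>" by (simp only: mem_ball dist_0_norm norm_of_real)
    then show ?thesis using ext[OF t] \<Phi>0 by simp
  qed
  then show ?thesis using assms by blast
qed blast

text \<open>The dichotomy makes the interior of \<open>S\<close> closed as well as open; since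
  \<open>b\<close> lies outside \<open>S\<close> and the line is connected, the interior is empty.
  Only the isolated alternative remains, so \<open>S\<close> has no limit points. The hypothesis is
  local, which allows a different analytic function near each point.\<close>

lemma countable_of_isolated_or_locally_all:
  fixes S :: "real set"
  assumes loc: "\<And>a. \<exists>d>0. (\<forall>t\<in>ball a d. t \<in> S) \<or> (\<forall>t\<in>ball a d - {a}. t \<notin> S)"
    and "b \<notin> S"
  shows "countable S"
proof -
  have "closed (interior S)"
    unfolding closed_limpt
  proof (intro allI impI)
    fix a assume a: "a islimpt interior S"
    obtain d where d: "d > 0" "(\<forall>t\<in>ball a d. t \<in> S) \<or> (\<forall>t\<in>ball a d - {a}. t \<notin> S)" using loc by blast
    obtain t where t: "t \<in> interior S" "t \<noteq> a" "dist t a < d"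
      using a d(1) unfolding islimpt_approachable by blast
    have "t \<in> ball a d - {a}" "t \<in> S" using t interior_subset by (auto simp: dist_commute)
    then have "\<forall>t\<in>ball a d. t \<in> S" using d(2) by blast
    then show "a \<in> interior S" using d(1) by (auto simp: mem_interior)
  qed
  then have "interior S = {}" using clopen[of "interior S"] assms(2) interior_subset by blast
  then have iso: "\<exists>d>0. \<forall>t\<in>ball a d - {a}. t \<notin> S" for a
  proof -
    obtain d where d: "d > 0" "(\<forall>t\<in>ball a d. t \<in> S) \<or> (\<forall>t\<in>ball a d - {a}. t \<notin> S)" using loc by blast
    moreover have "\<not> (\<forall>t\<in>ball a d. t \<in> S)"
      using \<open>interior S = {}\<close> d(1) mem_interior[of a S] by auto
    ultimately show ?thesis by blast
  qed
  have "S sparse_in UNIV"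
    unfolding sparse_in_def
  proof (intro ballI)
    have "\<not> y islimpt S" for y
    proof
      assume "y islimpt S"
      moreover obtain d where "d > 0" "\<forall>t\<in>ball y d - {y}. t \<notin> S" using iso by blast
      ultimately show False unfolding islimpt_approachable by (auto simp: dist_commute)
    qed
    then show "\<exists>B. x \<in> B \<and> open B \<and> (\<forall>y\<in>B. \<not> y islimpt S)" for x :: real by (intro exI[of _ UNIV]) auto
  qed
  from sparse_imp_countable[OF open_UNIV this] show ?thesis by simp
qed

text \<open>Division by \<tau>^k preserves null sets, and there are countably many \<open>k\<close>.
  Thus one null set of initial step sizes covers every step size that backtracking can
  produce.\<close>

lemma AE_lebesgue_scaled_powers:
  fixes \<tau> :: real
  assumes "AE \<alpha> in lborel. P \<alpha>" "\<tau> \<noteq> 0"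
  shows "AE a in lebesgue. \<forall>k::nat. P (\<tau> ^ k * a)"
proof -
  obtain N where N: "{\<alpha>. \<not> P \<alpha>} \<subseteq> N" "N \<in> null_sets lborel"
    using assms(1) by (auto elim!: AE_E simp: null_sets_def)
  have "negligible N" using N(2) negligible_iff_null_sets null_sets_completionI by blast
  have "negligible ((\<lambda>x. (1 / \<tau> ^ k) * x) ` N)" for k
    by (rule negligible_differentiable_image_negligible[OF order_refl \<open>negligible N\<close>])
      (intro differentiable_on_mult differentiable_on_const differentiable_on_ident)
  then have "negligible (\<Union>(range (\<lambda>k. (\<lambda>x. (1 / \<tau> ^ k) * x) ` N)))"
    by (intro negligible_countable_Union) auto
  then have "(\<Union>(range (\<lambda>k. (\<lambda>x. (1 / \<tau> ^ k) * x) ` N))) \<in> null_sets lebesgue"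
    by (simp add: negligible_iff_null_sets)
  then show ?thesis
  proof (rule AE_I', intro subsetI)
    fix a assume "a \<in> {a \<in> space lebesgue. \<not> (\<forall>k. P (\<tau> ^ k * a))}"
    then obtain k where "\<tau> ^ k * a \<in> N" using N(1) by blast
    moreover have "a = (1 / \<tau> ^ k) * (\<tau> ^ k * a)" using assms(2) by simp
    ultimately show "a \<in> \<Union>(range (\<lambda>k. (\<lambda>x. (1 / \<tau> ^ k) * x) ` N))" by blast
  qed
qed

text \<open>Only finitely many values of the form \<open>\<tau>\<^sup>k a\<close> exceed a positive bound, so the step sizes, which
  eventually decrease and stop changing once they are small, are eventually constant.\<close>

lemma eventually_constant_geometric:
  fixes s :: "nat \<Rightarrow> real"
  assumes \<tau>: "0 < \<tau>" "\<tau> < 1" and a: "a > 0" "a0 > 0"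
    and pw: "\<And>t. \<exists>k. s t = \<tau> ^ k * a"
    and dec: "\<And>t. t \<ge> T \<Longrightarrow> s (Suc t) \<le> s t"
    and const: "\<And>t. t \<ge> T \<Longrightarrow> s t < a0 \<Longrightarrow> s (Suc t) = s t"
  obtains T' where "T' \<ge> T" "\<And>t. t \<ge> T' \<Longrightarrow> s t = s T'"
proof (cases "\<exists>t\<ge>T. s t < a0")
  case True
  then obtain t0 where t0: "t0 \<ge> T" "s t0 < a0" by blast
  have "s t = s t0" if "t \<ge> t0" for t
    using that by (induction t rule: dec_induct) (use const t0 in auto)
  with t0(1) show ?thesis by (rule that)
next
  case False
  obtain K where K: "\<tau> ^ K < a0 / a" using real_arch_pow_inv[of "a0 / a" \<tau>] a \<tau> by auto
  have "s ` {T..} \<subseteq> (\<lambda>k. \<tau> ^ k * a) ` {..<K}"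
  proof clarify
    fix t assume t: "t \<ge> T"
    obtain k where k: "s t = \<tau> ^ k * a" using pw by blast
    have "k < K"
    proof (rule ccontr)
      assume "\<not> k < K"
      then have "\<tau> ^ k \<le> \<tau> ^ K" using \<tau> by (intro power_decreasing) auto
      with K have "\<tau> ^ k < a0 / a" by linarith
      then have "s t < a0" unfolding k using a by (simp add: pos_less_divide_eq)
      with False t show False by blast
    qed
    with k show "s t \<in> (\<lambda>k. \<tau> ^ k * a) ` {..<K}" by blast
  qed
  then have fin: "finite (s ` {T..})" by (rule finite_subset) simp
  then have "Min (s ` {T..}) \<in> s ` {T..}" by (intro Min_in) auto
  then obtain t0 where t0: "t0 \<ge> T" "s t0 = Min (s ` {T..})" by auto
  have "s t = s t0" if "t \<ge> t0" for t
  proof (rule antisym)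
    show "s t \<le> s t0"
      using that by (induction t rule: dec_induct) (use dec t0(1) in \<open>auto intro: order_trans\<close>)
    show "s t0 \<le> s t" unfolding t0(2) using fin that t0(1) by (intro Min_le) auto
  qed
  with t0(1) show ?thesis by (rule that)
qed

section \<open>The gradient in coordinates\<close>

lemma strict_deriv_scaleR_const:
  assumes "strict_deriv h h' p" shows "strict_deriv (\<lambda>q. h q *\<^sub>R y) (\<lambda>u. h' u *\<^sub>R y) p"
  using bounded_bilinear.strict_deriv_prod[OF bounded_bilinear_scaleR assms strict_deriv_const, of y] by simp

section \<open>Charts and their inverses\<close>

lemma chart_inv_in_dom: "p \<in> chart_img c \<Longrightarrow> chart_inv c p \<in> chart_dom c"
  by (rule inv_into_into)

lemma chart_chart_inv: "p \<in> chart_img c \<Longrightarrow> snd c (chart_inv c p) = p"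
  by (rule f_inv_into_f)

lemma chart_inv_chart: "is_chart c \<Longrightarrow> x \<in> chart_dom c \<Longrightarrow> chart_inv c (snd c x) = x"
  by (simp add: is_chart_def homeomorphism_def)

lemma chart_image_eq:
  assumes "is_chart c"
  shows "snd c ` (S \<inter> chart_dom c) = {p \<in> chart_img c. chart_inv c p \<in> S}"
proof
  show "snd c ` (S \<inter> chart_dom c) \<subseteq> {p \<in> chart_img c. chart_inv c p \<in> S}"
    using chart_inv_chart[OF assms] by auto
  show "{p \<in> chart_img c. chart_inv c p \<in> S} \<subseteq> snd c ` (S \<inter> chart_dom c)"
  proof
    fix p assume "p \<in> {p \<in> chart_img c. chart_inv c p \<in> S}"
    then have p: "p \<in> chart_img c" "chart_inv c p \<in> S" by simp_all
    then show "p \<in> snd c ` (S \<inter> chart_dom c)"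
      using chart_chart_inv[OF p(1)] chart_inv_in_dom[OF p(1)]
      by (intro image_eqI[of p "snd c" "chart_inv c p"]) simp_all
  qed
qed

lemma open_chart_preimage:
  assumes "is_chart c" "open U"
  shows "open {p \<in> chart_img c. chart_inv c p \<in> U}"
proof -
  have "open (chart_img c \<inter> chart_inv c -` U)"
    using assms by (intro continuous_open_preimage) (auto simp: is_chart_def homeomorphism_def)
  then show ?thesis by (simp add: Int_def vimage_def)
qed

lemma open_chart_inv_image:
  assumes "is_chart c" "open V" "V \<subseteq> chart_img c"
  shows "open (chart_inv c ` V)"
proof -
  have "chart_inv c ` V = chart_dom c \<inter> snd c -` V"
  proof
    show "chart_inv c ` V \<subseteq> chart_dom c \<inter> snd c -` V"
    proof
      fix x assume "x \<in> chart_inv c ` V"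
      then obtain p where "p \<in> V" "p \<in> chart_img c" "x = chart_inv c p" using assms(3) by blast
      then show "x \<in> chart_dom c \<inter> snd c -` V"
        using chart_inv_in_dom[of p c] chart_chart_inv[of p c] by simp
    qed
    show "chart_dom c \<inter> snd c -` V \<subseteq> chart_inv c ` V"
      using chart_inv_chart[OF assms(1)] by (metis Int_iff image_eqI subsetI vimageE)
  qed
  moreover have "open (chart_dom c \<inter> snd c -` V)"
    using assms by (intro continuous_open_preimage) (auto simp: is_chart_def homeomorphism_def)
  ultimately show ?thesis by simp
qed

locale riemannian_retraction =
  fixes A :: "('m::{t2_space, second_countable_topology}, 'e::euclidean_space) chart set"
    and g :: "('m, 'e) metric"
    and R :: "'m \<Rightarrow> ('m, 'e) tangent_vector \<Rightarrow> 'm"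
    and f :: "'m \<Rightarrow> real"
  assumes atlas: "real_analytic_atlas A"
    and metric: "riemannian_metric A g"
    and retraction: "is_retraction A R"
    and analytic_retraction: "real_analytic_bundle_map A R"
    and C2: "C2_function A f"
begin

lemma chart: "c \<in> A \<Longrightarrow> is_chart c"
  using atlas by (simp add: real_analytic_atlas_def)

lemma open_img: "c \<in> A \<Longrightarrow> open (chart_img c)"
  using chart is_chart_def by blast

lemma chart_at: "chart_at A x \<in> A" "x \<in> chart_dom (chart_at A x)"
proof -
  have "\<exists>c. c \<in> A \<and> x \<in> chart_dom c" using atlas unfolding real_analytic_atlas_def by blast
  from someI_ex[OF this] show "chart_at A x \<in> A" "x \<in> chart_dom (chart_at A x)"
    unfolding chart_at_def by auto
qed

section \<open>Change of charts and tangent vectors\<close>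

definition DT :: "('m, 'e) chart \<Rightarrow> ('m, 'e) chart \<Rightarrow> 'm \<Rightarrow> 'e \<Rightarrow> 'e" where
  "DT c d x = frechet_derivative (transition c d) (at (snd c x))"

lemma open_overlap:
  assumes "c \<in> A" "d \<in> A" shows "open (snd c ` (chart_dom c \<inter> chart_dom d))"
  using open_chart_preimage[OF chart[OF assms(1)], of "chart_dom d"] chart[OF assms(2)]
    chart_image_eq[OF chart[OF assms(1)], of "chart_dom d"]
  by (simp add: is_chart_def Int_commute)

lemma transition_differentiable:
  assumes "c \<in> A" "d \<in> A" "x \<in> chart_dom c" "x \<in> chart_dom d"
  shows "(transition c d has_derivative DT c d x) (at (snd c x))"
proof -
  have "real_analytic_on (snd c ` (chart_dom c \<inter> chart_dom d)) (transition c d)"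
    using atlas assms by (simp add: real_analytic_atlas_def)
  from real_analytic_on_differentiable[OF this open_overlap[OF assms(1,2)], of "snd c x"] assms
  show ?thesis unfolding DT_def by (simp add: frechet_derivative_works)
qed

lemma DT_linear:
  assumes "c \<in> A" "d \<in> A" "x \<in> chart_dom c" "x \<in> chart_dom d"
  shows "linear (DT c d x)"
  using transition_differentiable[OF assms] by (rule has_derivative_linear)

lemma transition_chart: "c \<in> A \<Longrightarrow> x \<in> chart_dom c \<Longrightarrow> transition c d (snd c x) = snd d x"
  using chart_inv_chart[OF chart] by simp

text \<open>The chain rule on the overlap. It is the compatibility that makes the family built by
  \<open>tv_of_coord\<close> a tangent vector.\<close>

lemma DT_cocycle:
  assumes "c \<in> A" "d \<in> A" "e \<in> A" "x \<in> chart_dom c" "x \<in> chart_dom d" "x \<in> chart_dom e"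
  shows "DT d e x (DT c d x u) = DT c e x u"
proof -
  have "(transition d e has_derivative DT d e x) (at (transition c d (snd c x)))"
    using transition_differentiable[of d e x] assms by (simp only: transition_chart)
  from diff_chain_at[OF transition_differentiable[OF assms(1,2,4,5)] this]
  have "(transition d e \<circ> transition c d has_derivative DT d e x \<circ> DT c d x) (at (snd c x))" .
  then have "(transition c e has_derivative DT d e x \<circ> DT c d x) (at (snd c x))"
  proof (rule has_derivative_transform_within_open[OF _ open_overlap[OF assms(1,2)]])
    show "snd c x \<in> snd c ` (chart_dom c \<inter> chart_dom d)" using assms by blast
    fix p assume "p \<in> snd c ` (chart_dom c \<inter> chart_dom d)"
    then obtain y where "y \<in> chart_dom c" "y \<in> chart_dom d" "p = snd c y" by blast
    then show "(transition d e \<circ> transition c d) p = transition c e p"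
      using chart_inv_chart[OF chart] assms by simp
  qed
  with transition_differentiable[OF assms(1,3,4,6)] have "DT c e x = DT d e x \<circ> DT c d x"
    using has_derivative_unique by blast
  then show ?thesis by simp
qed

lemma DT_self:
  assumes "c \<in> A" "x \<in> chart_dom c" shows "DT c c x u = u"
proof -
  have "((\<lambda>p. p) has_derivative (\<lambda>u. u)) (at (snd c x))" by (rule has_derivative_ident)
  then have "(transition c c has_derivative (\<lambda>u. u)) (at (snd c x))"
  proof (rule has_derivative_transform_within_open[OF _ open_img[OF assms(1)]])
    show "snd c x \<in> chart_img c" using assms by blast
    show "\<And>p. p \<in> chart_img c \<Longrightarrow> p = transition c c p" using chart_chart_inv by (metis comp_apply)
  qed
  with transition_differentiable[OF assms(1,1,2,2)] have "DT c c x = (\<lambda>u. u)"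
    using has_derivative_unique by blast
  then show ?thesis by simp
qed

lemma tv_of_coord_eq_DT:
  "tv_of_coord A c x u = (\<lambda>d. if d \<in> A \<and> x \<in> chart_dom d then DT c d x u else 0)"
  unfolding tv_of_coord_def DT_def by (rule refl)

lemma tv_of_coord_apply:
  "d \<in> A \<Longrightarrow> x \<in> chart_dom d \<Longrightarrow> tv_of_coord A c x u d = DT c d x u"
  by (simp add: tv_of_coord_def DT_def)

lemma tv_of_coord_in_tangent_space:
  assumes "c \<in> A" "x \<in> chart_dom c" shows "tv_of_coord A c x u \<in> tangent_space A x"
  unfolding tangent_space_def
proof (intro CollectI conjI ballI allI impI)
  fix d e assume "d \<in> A" "e \<in> A" "x \<in> chart_dom d" "x \<in> chart_dom e"
  then show "tv_of_coord A c x u e = frechet_derivative (transition d e) (at (snd d x)) (tv_of_coord A c x u d)"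
    using DT_cocycle[of c d e x u] assms by (simp add: tv_of_coord_apply DT_def[symmetric])
qed (auto simp: tv_of_coord_def)

lemma tv_of_coord_self: "c \<in> A \<Longrightarrow> x \<in> chart_dom c \<Longrightarrow> tv_of_coord A c x u c = u"
  by (simp add: tv_of_coord_apply DT_self)

lemma tangent_eq_tv_of_coord:
  assumes "v \<in> tangent_space A x" "c \<in> A" "x \<in> chart_dom c"
  shows "tv_of_coord A c x (v c) = v"
proof (rule ext)
  fix d show "tv_of_coord A c x (v c) d = v d"
  proof (cases "d \<in> A \<and> x \<in> chart_dom d")
    case True
    then have "v d = DT c d x (v c)"
      using assms unfolding tangent_space_def DT_def by blast
    then show ?thesis using True by (simp add: tv_of_coord_eq_DT)
  next
    case False
    then have "v d = 0" using assms unfolding tangent_space_def by blast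
    then show ?thesis using False by (simp only: tv_of_coord_eq_DT if_False)
  qed
qed

lemma tv_of_coord_add:
  assumes "c \<in> A" "x \<in> chart_dom c"
  shows "tv_of_coord A c x (u + w) = tv_add (tv_of_coord A c x u) (tv_of_coord A c x w)"
  unfolding tv_of_coord_eq_DT tv_add_def
  by (rule ext) (simp add: linear_add[OF DT_linear] assms)

lemma tv_of_coord_scale:
  assumes "c \<in> A" "x \<in> chart_dom c"
  shows "tv_of_coord A c x (a *\<^sub>R u) = tv_scale a (tv_of_coord A c x u)"
  unfolding tv_of_coord_eq_DT tv_scale_def
  by (rule ext) (simp add: linear_scale[OF DT_linear] assms)

lemma tv_of_coord_zero:
  assumes "c \<in> A" "x \<in> chart_dom c" shows "tv_of_coord A c x 0 = tv_zero"
  unfolding tv_of_coord_eq_DT tv_zero_def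
  by (rule ext) (simp add: linear_0[OF DT_linear] assms)

section \<open>The metric and the differential in a chart\<close>

abbreviation G :: "('m, 'e) chart \<Rightarrow> 'e \<Rightarrow> 'e \<Rightarrow> 'e \<Rightarrow> real" where
  "G \<equiv> metric_coord A g"

lemma metric_eq_G:
  assumes "c \<in> A" "x \<in> chart_dom c" "v \<in> tangent_space A x" "w \<in> tangent_space A x"
  shows "g x v w = G c (snd c x) (v c) (w c)"
  using assms by (simp add: metric_coord_def chart_inv_chart[OF chart] tangent_eq_tv_of_coord)

lemma G_sym:
  assumes "c \<in> A" "p \<in> chart_img c" shows "G c p u w = G c p w u"
  using metric tv_of_coord_in_tangent_space[OF assms(1) chart_inv_in_dom[OF assms(2)]]
  unfolding riemannian_metric_def metric_coord_def by meson

lemma G_add_left: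
  assumes "c \<in> A" "p \<in> chart_img c" shows "G c p (u + v) w = G c p u w + G c p v w"
  using metric tv_of_coord_in_tangent_space[OF assms(1) chart_inv_in_dom[OF assms(2)]]
  unfolding riemannian_metric_def metric_coord_def
    tv_of_coord_add[OF assms(1) chart_inv_in_dom[OF assms(2)]] by meson

lemma G_scale_left:
  assumes "c \<in> A" "p \<in> chart_img c" shows "G c p (a *\<^sub>R u) w = a * G c p u w"
  using metric tv_of_coord_in_tangent_space[OF assms(1) chart_inv_in_dom[OF assms(2)]]
  unfolding riemannian_metric_def metric_coord_def
    tv_of_coord_scale[OF assms(1) chart_inv_in_dom[OF assms(2)]] by meson

lemma G_pos:
  assumes "c \<in> A" "p \<in> chart_img c" "u \<noteq> 0" shows "G c p u u > 0"
proof -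
  have "tv_of_coord A c (chart_inv c p) u c = u"
    by (rule tv_of_coord_self[OF assms(1) chart_inv_in_dom[OF assms(2)]])
  then have "tv_of_coord A c (chart_inv c p) u \<noteq> tv_zero" using assms by (metis tv_zero_def)
  then show ?thesis
    using metric tv_of_coord_in_tangent_space[OF assms(1) chart_inv_in_dom[OF assms(2)]]
    unfolding riemannian_metric_def metric_coord_def by blast
qed

lemma G_bounded_bilinear:
  assumes "c \<in> A" "p \<in> chart_img c" shows "bounded_bilinear (G c p)"
  unfolding bilinear_conv_bounded_bilinear[symmetric] bilinear_def
  using G_sym[OF assms] G_add_left[OF assms] G_scale_left[OF assms]
  by (auto intro!: linearI) 

text \<open>Smoothness of the metric is given for constant arguments only; expanding in the basis
  reduces arguments that vary with the point to that case.\<close>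

lemma G_expand_left:
  assumes "c \<in> A" "p \<in> chart_img c" shows "G c p u w = (\<Sum>i\<in>Basis. (u \<bullet> i) * G c p i w)"
proof -
  interpret B: bounded_bilinear "G c p" by (rule G_bounded_bilinear[OF assms])
  show ?thesis
    using B.sum_left[of "\<lambda>i. (u \<bullet> i) *\<^sub>R i" Basis w] by (simp add: euclidean_representation B.scaleR_left)
qed

lemma G_Ck1: "c \<in> A \<Longrightarrow> Ck_on (Suc 0) (chart_img c) (\<lambda>p. G c p u w)"
  using metric unfolding riemannian_metric_def smooth_on_def by blast

lemma f_Ck2: "c \<in> A \<Longrightarrow> Ck_on 2 (chart_img c) (f \<circ> chart_inv c)"
  using C2 by (simp add: C2_function_def)

definition Df :: "('m, 'e) chart \<Rightarrow> 'e \<Rightarrow> 'e \<Rightarrow> real" where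
  "Df c p = frechet_derivative (f \<circ> chart_inv c) (at p)"

lemma Df_has_derivative:
  assumes "c \<in> A" "p \<in> chart_img c" shows "(f \<circ> chart_inv c has_derivative Df c p) (at p)"
  unfolding Df_def
  by (rule Ck_on_1_has_derivative[OF Ck_on_2D(2)[OF f_Ck2[OF assms(1)] open_img[OF assms(1)]] assms(2)])

lemma Df_linear: "c \<in> A \<Longrightarrow> p \<in> chart_img c \<Longrightarrow> linear (Df c p)"
  using Df_has_derivative has_derivative_linear by blast

text \<open>\<open>differential\<close> is computed in an arbitrarily chosen chart at the point; the
  chain rule makes the value available in every chart.\<close>

lemma Df_change_chart:
  assumes "c \<in> A" "d \<in> A" "x \<in> chart_dom c" "x \<in> chart_dom d"
  shows "Df d (snd d x) (DT c d x u) = Df c (snd c x) u"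
proof -
  have "(f \<circ> chart_inv d has_derivative Df d (snd d x)) (at (transition c d (snd c x)))"
    using Df_has_derivative[of d "snd d x"] assms by (simp only: transition_chart) blast
  from diff_chain_at[OF transition_differentiable[OF assms] this]
  have "(f \<circ> chart_inv c has_derivative Df d (snd d x) \<circ> DT c d x) (at (snd c x))"
  proof (rule has_derivative_transform_within_open[OF _ open_overlap[OF assms(1,2)]])
    show "snd c x \<in> snd c ` (chart_dom c \<inter> chart_dom d)" using assms by blast
    fix p assume "p \<in> snd c ` (chart_dom c \<inter> chart_dom d)"
    then obtain y where "y \<in> chart_dom c" "y \<in> chart_dom d" "p = snd c y" by blast
    then show "(f \<circ> chart_inv d \<circ> transition c d) p = (f \<circ> chart_inv c) p"
      using chart_inv_chart[OF chart] assms by simp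
  qed
  with Df_has_derivative[of c "snd c x"] assms have "Df c (snd c x) = Df d (snd d x) \<circ> DT c d x"
    using has_derivative_unique by blast
  then show ?thesis by simp
qed

lemma differential_eq_Df:
  assumes "c \<in> A" "x \<in> chart_dom c" "v \<in> tangent_space A x"
  shows "differential A f x v = Df c (snd c x) (v c)"
proof -
  let ?d = "chart_at A x"
  have "v ?d = DT c ?d x (v c)"
    using tv_of_coord_apply[OF chart_at[of x], of c "v c"] tangent_eq_tv_of_coord[OF assms(3,1,2)]
    by (simp only:)
  then show ?thesis
    using Df_change_chart[OF assms(1) chart_at(1) assms(2) chart_at(2)]
    by (simp add: differential_def Let_def Df_def)
qed

text \<open>Positive definiteness makes the Gram map injective, hence surjective in finite
  dimension. The unique existence justifies the definite descriptions in \<open>grad\<close> and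
  \<open>covariant_derivative\<close>.\<close>

lemma riesz_tangent:
  assumes "c \<in> A" "x \<in> chart_dom c" "linear l"
  shows "\<exists>!z. z \<in> tangent_space A x \<and> (\<forall>w\<in>tangent_space A x. g x z w = l (w c))"
proof -
  have p: "snd c x \<in> chart_img c" using assms by blast
  interpret B: bounded_bilinear "G c (snd c x)" by (rule G_bounded_bilinear[OF assms(1) p])
  define T where "T u = (\<Sum>i\<in>Basis. G c (snd c x) u i *\<^sub>R i)" for u
  have "linear T"
    by (rule linearI) (simp_all add: T_def B.add_left B.scaleR_left scaleR_add_left sum.distrib scaleR_sum_right)
  have Ti: "T u \<bullet> i = G c (snd c x) u i" if "i \<in> Basis" for u i using that by (simp add: T_def)
  have ext: "G c (snd c x) u w = l w"
    if "linear l" "\<And>i. i \<in> Basis \<Longrightarrow> G c (snd c x) u i = l i" for u w and l :: "'e \<Rightarrow> real"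
    using linear_eq_stdbasis[OF bounded_linear.linear[OF B.bounded_linear_right] that] by metis
  have inj: "u = 0" if "T u = 0" for u
  proof (rule ccontr)
    assume "u \<noteq> 0"
    have "G c (snd c x) u i = 0" if "i \<in> Basis" for i using Ti[OF that, of u] \<open>T u = 0\<close> by simp
    then have "G c (snd c x) u u = 0" by (rule ext[of "\<lambda>_. 0", rotated]) (simp_all add: linear_iff)
    then show False using G_pos[OF assms(1) p \<open>u \<noteq> 0\<close>] by simp
  qed
  then have "inj T" using \<open>linear T\<close> by (simp add: linear_injective_0)
  then have "surj T" using \<open>linear T\<close> linear_injective_imp_surjective by blast
  then obtain u where u: "T u = (\<Sum>i\<in>Basis. l i *\<^sub>R i)" by (metis surjD)
  have "G c (snd c x) u i = l i" if "i \<in> Basis" for i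
    using Ti[OF that, of u] that by (simp add: u inner_sum_left_Basis)
  then have lu: "G c (snd c x) u w = l w" for w by (rule ext[OF assms(3)])
  show ?thesis
  proof (rule ex1I[of _ "tv_of_coord A c x u"], intro conjI ballI)
    show "tv_of_coord A c x u \<in> tangent_space A x" using assms by (intro tv_of_coord_in_tangent_space)
    then show "g x (tv_of_coord A c x u) w = l (w c)" if "w \<in> tangent_space A x" for w
      using metric_eq_G[OF assms(1,2) _ that] lu assms by (simp add: tv_of_coord_self)
    fix z assume z: "z \<in> tangent_space A x \<and> (\<forall>w\<in>tangent_space A x. g x z w = l (w c))"
    have "G c (snd c x) (z c) w = G c (snd c x) u w" for w
      using z metric_eq_G[OF assms(1,2), of z "tv_of_coord A c x w"] assms lu
      by (simp add: tv_of_coord_in_tangent_space tv_of_coord_self)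
    then have "G c (snd c x) (z c - u) (z c - u) = 0" by (simp add: B.diff_left)
    then have "z c = u" using G_pos[OF assms(1) p, of "z c - u"] by auto
    then show "z = tv_of_coord A c x u" using tangent_eq_tv_of_coord[of z x c] z assms by simp
  qed
qed

lemma grad_properties:
  shows "grad A g f x \<in> tangent_space A x"
    and "w \<in> tangent_space A x \<Longrightarrow> g x (grad A g f x) w = differential A f x w"
proof -
  have "\<exists>!z. z \<in> tangent_space A x \<and> (\<forall>w\<in>tangent_space A x. g x z w = differential A f x w)"
    using riesz_tangent[OF chart_at[of x] Df_linear[OF chart_at(1)[of x] imageI[OF chart_at(2)[of x]]]]
    by (simp cong: ball_cong add: differential_eq_Df[OF chart_at[of x]])
  from theI'[OF this]
  have *: "grad A g f x \<in> tangent_space A x \<and>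
      (\<forall>w\<in>tangent_space A x. g x (grad A g f x) w = differential A f x w)"
    unfolding grad_def .
  show "grad A g f x \<in> tangent_space A x" using * by (rule conjunct1)
  show "w \<in> tangent_space A x \<Longrightarrow> g x (grad A g f x) w = differential A f x w"
    using conjunct2[OF *] by (rule bspec)
qed

definition V :: "('m, 'e) chart \<Rightarrow> 'e \<Rightarrow> 'e" where
  "V c p = grad A g f (chart_inv c p) c"

lemma grad_eq_V:
  assumes "c \<in> A" "p \<in> chart_img c"
  shows "grad A g f (chart_inv c p) = tv_of_coord A c (chart_inv c p) (V c p)"
  using tangent_eq_tv_of_coord[OF grad_properties(1) assms(1) chart_inv_in_dom[OF assms(2)]]
  by (simp add: V_def)

lemma G_V:
  assumes "c \<in> A" "p \<in> chart_img c"
  shows "G c p (V c p) w = Df c p w"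
proof -
  let ?x = "chart_inv c p" let ?w = "tv_of_coord A c ?x w"
  note x = chart_inv_in_dom[OF assms(2)] chart_chart_inv[OF assms(2)]
  note w = tv_of_coord_in_tangent_space[OF assms(1) x(1), of w] tv_of_coord_self[OF assms(1) x(1), of w]
  have "G c p (V c p) w = g ?x (grad A g f ?x) ?w"
    using metric_eq_G[OF assms(1) x(1) grad_properties(1) w(1)] by (simp add: x w V_def)
  also have "\<dots> = Df c p w"
    using grad_properties(2)[OF w(1)] differential_eq_Df[OF assms(1) x(1) w(1)] by (simp add: x w)
  finally show ?thesis .
qed

text \<open>In coordinates the gradient solves the Gram system with right-hand side
  \<open>Df\<close>. The entries of the matrix and of the right-hand side have continuous
  derivatives, so the solution is strictly differentiable at every point, which amounts to
  C^1.\<close>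

lemma V_strict_deriv:
  assumes "c \<in> A" "p \<in> chart_img c"
  shows "strict_deriv (V c) (frechet_derivative (V c) (at p)) p"
proof -
  \<comment> \<open>The matrix units write \<open>T q\<close> as a sum of real functions times
    constant operators, so its strict derivative can be read off entry by entry.\<close>
  define E where "E j i = Blinfun (\<lambda>u::'e. (u \<bullet> j) *\<^sub>R (i::'e))" for j i
  have E: "blinfun_apply (E j i) u = (u \<bullet> j) *\<^sub>R i" for j i u
    unfolding E_def by (subst bounded_linear_Blinfun_apply) (auto intro!: bounded_linear_intros)
  define T where "T q = (\<Sum>i\<in>Basis. \<Sum>j\<in>Basis. G c q j i *\<^sub>R E j i)" for q
  define b where "b q = (\<Sum>i\<in>Basis. Df c q i *\<^sub>R i)" for q
  have T: "blinfun_apply (T q) u = (\<Sum>i\<in>Basis. G c q u i *\<^sub>R i)" if "q \<in> chart_img c" for q u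
    unfolding G_expand_left[OF assms(1) that, of u]
    by (simp add: T_def blinfun.sum_left blinfun.scaleR_left E scaleR_sum_left mult.commute)
  have Tsd: "strict_deriv T (\<lambda>u. \<Sum>i\<in>Basis. \<Sum>j\<in>Basis. frechet_derivative (\<lambda>q. G c q j i) (at p) u *\<^sub>R E j i) p"
    unfolding T_def[abs_def]
    by (intro strict_deriv_sum strict_deriv_scaleR_const finite_Basis
        Ck_on_1_strict_deriv[OF G_Ck1[OF assms(1)] open_img[OF assms(1)] assms(2)])
  have bsd: "strict_deriv b (\<lambda>u. \<Sum>i\<in>Basis. frechet_derivative (\<lambda>q. Df c q i) (at p) u *\<^sub>R i) p"
    unfolding b_def[abs_def] Df_def
    by (intro strict_deriv_sum strict_deriv_scaleR_const finite_Basis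
        Ck_on_1_strict_deriv[OF Ck_on_2D(1)[OF f_Ck2[OF assms(1)]] open_img[OF assms(1)] assms(2)])
  have eq: "blinfun_apply (T q) (V c q) = b q" if "q \<in> chart_img c" for q
    using G_V[OF assms(1) that] by (simp add: T[OF that] b_def)
  have inj: "u = 0" if "blinfun_apply (T p) u = 0" for u
  proof (rule ccontr)
    assume u: "u \<noteq> 0"
    have "G c p i u = 0" if "i \<in> Basis" for i
      using that \<open>blinfun_apply (T p) u = 0\<close> unfolding T[OF assms(2)] G_sym[OF assms, of i]
      by (metis inner_sum_left_Basis inner_zero_left)
    then have "G c p u u = 0" by (simp add: G_expand_left[OF assms, of u])
    then show False using G_pos[OF assms u] by simp
  qed
  obtain L where L: "strict_deriv (V c) L p"
    using strict_deriv_solve[OF Tsd bsd open_img[OF assms(1)] assms(2) eq inj] by blast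
  then show ?thesis using strict_deriv_unique by metis
qed

section \<open>The gradient step in coordinates\<close>

abbreviation bm :: "('m, 'e) chart \<Rightarrow> 'e \<times> 'e \<Rightarrow> 'm" where
  "bm \<equiv> bundle_map_coord A R"

abbreviation step :: "'m \<Rightarrow> real \<Rightarrow> 'm" where
  "step \<equiv> gd_step A g R f"

definition F :: "('m, 'e) chart \<Rightarrow> ('m, 'e) chart \<Rightarrow> 'e \<times> 'e \<Rightarrow> 'e" where
  "F c d = snd d \<circ> bm c"

definition Om :: "('m, 'e) chart \<Rightarrow> ('m, 'e) chart \<Rightarrow> ('e \<times> 'e) set" where
  "Om c d = {z \<in> chart_img c \<times> UNIV. bm c z \<in> chart_dom d}"

lemma bm_continuous: "c \<in> A \<Longrightarrow> continuous_on (chart_img c \<times> UNIV) (bm c)"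
  using retraction unfolding is_retraction_def regular_bundle_map_def by blast

lemma Om_open:
  assumes "c \<in> A" "d \<in> A" shows "open (Om c d)"
proof -
  have "open ((chart_img c \<times> UNIV) \<inter> bm c -` chart_dom d)"
    using open_img[OF assms(1)] chart[OF assms(2)]
    by (intro continuous_open_preimage bm_continuous assms open_Times) (auto simp: is_chart_def)
  moreover have "Om c d = (chart_img c \<times> UNIV) \<inter> bm c -` chart_dom d"
    unfolding Om_def by (auto simp only: Int_iff vimage_eq mem_Collect_eq)
  ultimately show ?thesis by simp
qed

lemma F_Ck: "c \<in> A \<Longrightarrow> d \<in> A \<Longrightarrow> Ck_on k (Om c d) (F c d)"
  using retraction unfolding is_retraction_def regular_bundle_map_def smooth_on_def Om_def F_def by blast

lemma F_analytic: "c \<in> A \<Longrightarrow> d \<in> A \<Longrightarrow> real_analytic_on (Om c d) (F c d)"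
  using analytic_retraction unfolding real_analytic_bundle_map_def regular_bundle_map_def Om_def F_def
  by blast

definition DF :: "('m, 'e) chart \<Rightarrow> ('m, 'e) chart \<Rightarrow> 'e \<times> 'e \<Rightarrow> 'e \<times> 'e \<Rightarrow> 'e" where
  "DF c d z = frechet_derivative (F c d) (at z)"

lemma F_strict_deriv:
  "c \<in> A \<Longrightarrow> d \<in> A \<Longrightarrow> z \<in> Om c d \<Longrightarrow> strict_deriv (F c d) (DF c d z) z"
  unfolding DF_def by (rule Ck_on_1_strict_deriv[OF F_Ck Om_open])

lemma DF_linear: "c \<in> A \<Longrightarrow> d \<in> A \<Longrightarrow> z \<in> Om c d \<Longrightarrow> linear (DF c d z)"
  using F_strict_deriv strict_deriv_bounded_linear bounded_linear.linear by blast

lemma R_zero: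
  assumes "c \<in> A" "p \<in> chart_img c" shows "bm c (p, 0) = chart_inv c p"
proof -
  let ?x = "chart_inv c p"
  have x: "?x \<in> chart_dom c" by (rule chart_inv_in_dom[OF assms(2)])
  have "bm c (p, 0) = R ?x (tv_of_coord A c ?x (0 *\<^sub>R 0))" by (simp add: bundle_map_coord_def)
  also have "\<dots> = R ?x (tv_scale 0 (tv_of_coord A c ?x 0))" by (simp only: tv_of_coord_scale[OF assms(1) x])
  also have "\<dots> = ?x"
    using retraction tv_of_coord_in_tangent_space[OF assms(1) x] unfolding is_retraction_def by blast
  finally show ?thesis .
qed

lemma zero_in_Om:
  assumes "c \<in> A" "p \<in> chart_img c" shows "(p, 0) \<in> Om c c"
  unfolding Om_def using assms R_zero[OF assms] chart_inv_in_dom[OF assms(2)] by simp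

text \<open>On the zero section the retraction is the identity. With \<open>DF_zero_fibre\<close>
  this shows that the derivative there sends \<open>(h, u)\<close> to \<open>h + u\<close>.\<close>

lemma DF_zero_base:
  assumes "c \<in> A" "p \<in> chart_img c" shows "DF c c (p, 0) (h, 0) = h"
proof -
  have "(F c c has_derivative DF c c (p, 0)) (at (p, 0))"
    by (rule strict_deriv_has_derivative[OF F_strict_deriv[OF assms(1,1) zero_in_Om[OF assms]]])
  then have "((\<lambda>q. F c c (q, 0)) has_derivative (\<lambda>h. DF c c (p, 0) (h, 0))) (at p)"
    by (rule has_derivative_compose[rotated]) (intro has_derivative_Pair has_derivative_ident has_derivative_const)
  then have "((\<lambda>q. q) has_derivative (\<lambda>h. DF c c (p, 0) (h, 0))) (at p)"
    by (rule has_derivative_transform_within_open[OF _ open_img[OF assms(1)] assms(2)])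
      (simp add: F_def R_zero[OF assms(1)] chart_chart_inv)
  then have "(\<lambda>h. DF c c (p, 0) (h, 0)) = (\<lambda>h. h)"
    using has_derivative_unique has_derivative_ident by blast
  then show ?thesis by metis
qed

lemma DF_zero_fibre:
  assumes "c \<in> A" "p \<in> chart_img c" shows "DF c c (p, 0) (0, u) = u"
proof -
  let ?x = "chart_inv c p"
  note x = chart_inv_in_dom[OF assms(2)]
  have "((\<lambda>t. snd c (R ?x (tv_scale t (tv_of_coord A c ?x u)))) has_vector_derivative tv_of_coord A c ?x u c) (at 0)"
    using retraction tv_of_coord_in_tangent_space[OF assms(1) x] assms(1) x unfolding is_retraction_def by blast
  then have "((\<lambda>t. F c c (p, t *\<^sub>R u)) has_vector_derivative u) (at 0)"
    by (simp only: tv_of_coord_self[OF assms(1) x] F_def o_def bundle_map_coord_def prod.case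
        tv_of_coord_scale[OF assms(1) x])
  moreover have "(F c c has_derivative DF c c (p, 0)) (at (p, 0 *\<^sub>R u))"
    using strict_deriv_has_derivative[OF F_strict_deriv[OF assms(1,1) zero_in_Om[OF assms]]] by simp
  then have "((\<lambda>t. F c c (p, t *\<^sub>R u)) has_derivative (\<lambda>t. DF c c (p, 0) (0, t *\<^sub>R u))) (at 0)"
    by (rule has_derivative_compose[rotated])
      (intro has_derivative_Pair has_derivative_scaleR_left has_derivative_ident has_derivative_const)
  then have "((\<lambda>t. F c c (p, t *\<^sub>R u)) has_vector_derivative DF c c (p, 0) (0, u)) (at 0)"
    unfolding has_vector_derivative_def
    using linear_scale[OF DF_linear[OF assms(1,1) zero_in_Om[OF assms]], of _ "(0, u)"] by simp
  ultimately show ?thesis using vector_derivative_unique_at by blast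
qed

section \<open>The step as a function of the point and the step size\<close>

lemma step_eq_bm:
  assumes "c \<in> A" "p \<in> chart_img c"
  shows "step (chart_inv c p) \<alpha> = bm c (p, - \<alpha> *\<^sub>R V c p)"
  by (simp only: gd_step_def grad_eq_V[OF assms] bundle_map_coord_def prod.case
      tv_of_coord_scale[OF assms(1) chart_inv_in_dom[OF assms(2)]])

lemma V_continuous: "c \<in> A \<Longrightarrow> continuous_on (chart_img c) (V c)"
  by (intro differentiable_imp_continuous_on differentiable_at_imp_differentiable_on)
    (blast intro: differentiableI strict_deriv_has_derivative V_strict_deriv)

abbreviation zt :: "('m, 'e) chart \<Rightarrow> 'e \<times> real \<Rightarrow> 'e \<times> 'e" where
  "zt c \<equiv> (\<lambda>(p, \<alpha>). (p, - \<alpha> *\<^sub>R V c p))"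

text \<open>Point and step size are kept together for the Fubini argument. The step size ranges over
  the whole line, so that \<alpha> = 0, where the step is the identity, belongs to the same
  connected set.\<close>

definition Dom :: "('m, 'e) chart \<Rightarrow> ('m, 'e) chart \<Rightarrow> ('e \<times> real) set" where
  "Dom c d = {(p, \<alpha>). p \<in> chart_img c \<and> step (chart_inv c p) \<alpha> \<in> chart_dom d}"

lemma Dom_iff:
  assumes "c \<in> A" "p \<in> chart_img c"
  shows "(p, \<alpha>) \<in> Dom c d \<longleftrightarrow> (p, - \<alpha> *\<^sub>R V c p) \<in> Om c d"
  using assms by (simp add: Dom_def Om_def step_eq_bm)

lemma Dom_in_img: "(p, \<alpha>) \<in> Dom c d \<Longrightarrow> p \<in> chart_img c"
  by (simp add: Dom_def)

lemma zt_continuous: "c \<in> A \<Longrightarrow> continuous_on (chart_img c \<times> UNIV) (zt c)"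
  unfolding case_prod_beta
  by (intro continuous_intros continuous_on_compose2[OF V_continuous]) auto

lemma Dom_open:
  assumes "c \<in> A" "d \<in> A" shows "open (Dom c d)"
proof -
  have "open ((chart_img c \<times> UNIV) \<inter> zt c -` Om c d)"
    by (intro continuous_open_preimage zt_continuous Om_open open_Times open_img open_UNIV assms)
  moreover have "Dom c d = (chart_img c \<times> UNIV) \<inter> zt c -` Om c d"
    using Dom_iff[OF assms(1)] Dom_in_img by fast
  ultimately show ?thesis by simp
qed

abbreviation DV :: "('m, 'e) chart \<Rightarrow> 'e \<Rightarrow> 'e \<Rightarrow> 'e" where
  "DV c p \<equiv> frechet_derivative (V c) (at p)"

text \<open>The chain rule for the step. For fixed \<open>p\<close>, \<alpha> enters only through a
  point moving along a line and through a linear factor, which is the source of analyticity in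
  \<alpha>.\<close>

definition Dstep :: "('m, 'e) chart \<Rightarrow> ('m, 'e) chart \<Rightarrow> 'e \<Rightarrow> real \<Rightarrow> 'e \<Rightarrow> 'e" where
  "Dstep c d p \<alpha> h = DF c d (p, - \<alpha> *\<^sub>R V c p) (h, - \<alpha> *\<^sub>R DV c p h)"

lemma step_strict_deriv:
  assumes "c \<in> A" "d \<in> A" "(p, \<alpha>) \<in> Dom c d"
  shows "strict_deriv (\<lambda>q. snd d (step (chart_inv c q) \<alpha>)) (Dstep c d p \<alpha>) p"
proof -
  note p = Dom_in_img[OF assms(3)]
  have "strict_deriv (\<lambda>q. (q, - \<alpha> *\<^sub>R V c q)) (\<lambda>h. (h, - \<alpha> *\<^sub>R DV c p h)) p"
    by (intro strict_deriv_Pair strict_deriv_linear bounded_linear_ident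
        strict_deriv_compose[OF V_strict_deriv[OF assms(1) p] strict_deriv_linear[OF bounded_linear_scaleR_right]])
  from strict_deriv_compose[OF this F_strict_deriv[OF assms(1,2)]]
  have "strict_deriv (\<lambda>q. F c d (q, - \<alpha> *\<^sub>R V c q)) (Dstep c d p \<alpha>) p"
    using Dom_iff[OF assms(1) p] assms(3) by (simp add: Dstep_def[abs_def])
  then show ?thesis
    by (rule strict_deriv_cong[OF _ open_img[OF assms(1)] p]) (simp add: F_def step_eq_bm[OF assms(1)])
qed

lemma Dstep_linear:
  assumes "c \<in> A" "d \<in> A" "(p, \<alpha>) \<in> Dom c d" shows "linear (Dstep c d p \<alpha>)"
  using step_strict_deriv[OF assms] strict_deriv_bounded_linear bounded_linear.linear by blast

text \<open>Continuity and holomorphic extension of \<open>DF\<close> are known for fixed vectors;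
  the expansion removes the dependence on \<open>p\<close> and \<alpha> from its vector
  argument.\<close>

lemma Dstep_expand:
  assumes "c \<in> A" "d \<in> A" "(p, \<alpha>) \<in> Dom c d"
  shows "Dstep c d p \<alpha> h = DF c d (p, - \<alpha> *\<^sub>R V c p) (h, 0)
      - \<alpha> *\<^sub>R (\<Sum>k\<in>Basis. (DV c p h \<bullet> k) *\<^sub>R DF c d (p, - \<alpha> *\<^sub>R V c p) (0, k))"
proof -
  note p = Dom_in_img[OF assms(3)]
  have lin: "linear (DF c d (p, - \<alpha> *\<^sub>R V c p))"
    using DF_linear assms Dom_iff[OF assms(1) p] by blast
  have l0: "linear (\<lambda>k. DF c d (p, - \<alpha> *\<^sub>R V c p) (0, k))"
    using linear_compose[OF _ lin, of "\<lambda>k. (0, k)"] by (simp add: o_def linear_iff)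
  have "Dstep c d p \<alpha> h = DF c d (p, - \<alpha> *\<^sub>R V c p) ((h, 0) - \<alpha> *\<^sub>R (0, DV c p h))"
    by (simp add: Dstep_def)
  also have "\<dots> = DF c d (p, - \<alpha> *\<^sub>R V c p) (h, 0) - \<alpha> *\<^sub>R DF c d (p, - \<alpha> *\<^sub>R V c p) (0, DV c p h)"
    by (simp only: linear_diff[OF lin] linear_scale[OF lin])
  also have "DF c d (p, - \<alpha> *\<^sub>R V c p) (0, DV c p h) =
      DF c d (p, - \<alpha> *\<^sub>R V c p) (0, \<Sum>k\<in>Basis. (DV c p h \<bullet> k) *\<^sub>R k)"
    by (simp only: euclidean_representation)
  also have "\<dots> = (\<Sum>k\<in>Basis. (DV c p h \<bullet> k) *\<^sub>R DF c d (p, - \<alpha> *\<^sub>R V c p) (0, k))"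
    by (simp only: linear_sum[OF l0] linear_scale[OF l0])
  finally show ?thesis .
qed

definition Jac :: "('m, 'e) chart \<Rightarrow> ('m, 'e) chart \<Rightarrow> 'e \<times> real \<Rightarrow> real" where
  "Jac c d = (\<lambda>(p, \<alpha>). basis_det (\<lambda>i j. Dstep c d p \<alpha> j \<bullet> i))"

lemma Jac_eq_0_iff:
  assumes "c \<in> A" "d \<in> A" "(p, \<alpha>) \<in> Dom c d"
  shows "Jac c d (p, \<alpha>) = 0 \<longleftrightarrow> (\<exists>h. h \<noteq> 0 \<and> Dstep c d p \<alpha> h = 0)"
  using basis_det_eq_0_iff[OF Dstep_linear[OF assms]] by (simp add: Jac_def)

text \<open>Joint continuity makes the set of singular pairs Borel, as exchanging the order of the
  two variables requires.\<close>

lemma Jac_continuous: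
  assumes "c \<in> A" "d \<in> A" shows "continuous_on (Dom c d) (Jac c d)"
proof -
  have zc: "continuous_on (Dom c d) (\<lambda>y. (fst y, - snd y *\<^sub>R V c (fst y)))"
  proof -
    have "Dom c d \<subseteq> chart_img c \<times> UNIV" using Dom_in_img by fast
    from continuous_on_subset[OF zt_continuous[OF assms(1)] this] show ?thesis by (simp add: case_prod_beta)
  qed
  have DFc: "continuous_on (Dom c d) (\<lambda>y. DF c d (fst y, - snd y *\<^sub>R V c (fst y)) h)" for h
  proof (rule continuous_on_compose2[OF _ zc])
    show "continuous_on (Om c d) (\<lambda>z. DF c d z h)"
      using F_Ck[OF assms, of "Suc 0"] unfolding DF_def Ck_on.simps by blast
    show "(\<lambda>y. (fst y, - snd y *\<^sub>R V c (fst y))) ` Dom c d \<subseteq> Om c d"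
      using Dom_iff[OF assms(1)] Dom_in_img by fastforce
  qed
  have DVc: "continuous_on (Dom c d) (\<lambda>y. DV c (fst y) h)" for h
    by (rule continuous_on_compose2[OF strict_deriv_continuous[OF V_strict_deriv[OF assms(1)]]])
      (auto intro: continuous_intros dest: Dom_in_img)
  have "continuous_on (Dom c d) (\<lambda>y. DF c d (fst y, - snd y *\<^sub>R V c (fst y)) (h, 0)
      - snd y *\<^sub>R (\<Sum>k\<in>Basis. (DV c (fst y) h \<bullet> k) *\<^sub>R DF c d (fst y, - snd y *\<^sub>R V c (fst y)) (0, k)))" for h
    by (intro continuous_intros DFc DVc)
  then have "continuous_on (Dom c d) (\<lambda>y. Dstep c d (fst y) (snd y) h)" for h
    by (rule continuous_on_eq) (simp add: Dstep_expand[OF assms])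
  then have "continuous_on (Dom c d) (\<lambda>y. basis_det (\<lambda>i j. Dstep c d (fst y) (snd y) j \<bullet> i))"
    by (intro continuous_on_basis_det continuous_intros)
  then show ?thesis by (simp add: Jac_def case_prod_beta)
qed

lemma Dstep_change_chart:
  assumes "c \<in> A" "d \<in> A" "e \<in> A" "(p, \<alpha>) \<in> Dom c d" "(p, \<alpha>) \<in> Dom c e"
  shows "Dstep c e p \<alpha> h = DT d e (step (chart_inv c p) \<alpha>) (Dstep c d p \<alpha> h)"
proof -
  let ?x = "step (chart_inv c p) \<alpha>"
  have x: "?x \<in> chart_dom d" "?x \<in> chart_dom e" using assms by (auto simp: Dom_def)
  have "((\<lambda>q. transition d e (snd d (step (chart_inv c q) \<alpha>))) has_derivative
      (\<lambda>h. DT d e ?x (Dstep c d p \<alpha> h))) (at p)"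
    by (rule has_derivative_compose[OF strict_deriv_has_derivative[OF step_strict_deriv[OF assms(1,2,4)]]
          transition_differentiable[OF assms(2,3) x]])
  moreover have "open {q. (q, \<alpha>) \<in> Dom c d}"
  proof -
    have "open ((\<lambda>q. (q, \<alpha>)) -` Dom c d)"
      by (intro open_vimage Dom_open assms) (auto intro: continuous_intros)
    then show ?thesis by (simp add: vimage_def)
  qed
  ultimately have "((\<lambda>q. snd e (step (chart_inv c q) \<alpha>)) has_derivative
      (\<lambda>h. DT d e ?x (Dstep c d p \<alpha> h))) (at p)"
  proof (rule has_derivative_transform_within_open)
    show "p \<in> {q. (q, \<alpha>) \<in> Dom c d}" using assms by simp
    fix q assume "q \<in> {q. (q, \<alpha>) \<in> Dom c d}"
    then show "transition d e (snd d (step (chart_inv c q) \<alpha>)) = snd e (step (chart_inv c q) \<alpha>)"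
      by (intro transition_chart[OF assms(2)]) (simp add: Dom_def)
  qed
  with strict_deriv_has_derivative[OF step_strict_deriv[OF assms(1,3,5)]]
  have "Dstep c e p \<alpha> = (\<lambda>h. DT d e ?x (Dstep c d p \<alpha> h))" using has_derivative_unique by blast
  then show ?thesis by metis
qed

text \<open>A change of the target chart composes the derivative with a linear map, so kernel
  vectors persist. Singularity is thus a property of the step and not of the chart in which the new
  point is seen.\<close>

lemma Jac_zero_change_chart:
  assumes "c \<in> A" "d \<in> A" "e \<in> A" "(p, \<alpha>) \<in> Dom c d" "(p, \<alpha>) \<in> Dom c e" "Jac c d (p, \<alpha>) = 0"
  shows "Jac c e (p, \<alpha>) = 0"
proof -
  obtain h where "h \<noteq> 0" "Dstep c d p \<alpha> h = 0" using assms Jac_eq_0_iff by blast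
  moreover have "linear (DT d e (step (chart_inv c p) \<alpha>))"
    using assms by (intro DT_linear) (auto simp: Dom_def)
  ultimately have "h \<noteq> 0 \<and> Dstep c e p \<alpha> h = 0"
    using Dstep_change_chart[OF assms(1-5)] by (simp add: linear_0)
  then show ?thesis using Jac_eq_0_iff[OF assms(1,3,5)] by blast
qed

text \<open>Varying \<alpha> moves the argument of \<open>DF\<close> along the line in direction
  \<open>(0, - V c p)\<close>. Each entry extends holomorphically along it, and the Leibniz formula
  extends the determinant.\<close>

lemma Jac_extension:
  assumes "c \<in> A" "d \<in> A" "(p, a) \<in> Dom c d"
  obtains \<delta> \<Phi> where "\<delta> > 0" "\<Phi> holomorphic_on ball 0 \<delta>"
    "\<And>\<beta>. \<bar>\<beta>\<bar> < \<delta> \<Longrightarrow> (p, a + \<beta>) \<in> Dom c d \<and> \<Phi> (of_real \<beta>) = of_real (Jac c d (p, a + \<beta>))"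
proof -
  note p = Dom_in_img[OF assms(3)]
  define u where "u = (0::'e, - V c p)"
  have z0: "(p, - a *\<^sub>R V c p) \<in> Om c d" using Dom_iff[OF assms(1) p] assms(3) by simp
  have zb: "(p, - a *\<^sub>R V c p) + \<beta> *\<^sub>R u = (p, - (a + \<beta>) *\<^sub>R V c p)" for \<beta>
    by (simp add: u_def algebra_simps)
  have "\<exists>\<delta> \<Phi>. \<delta> > 0 \<and> \<Phi> holomorphic_on ball 0 \<delta> \<and>
    (\<forall>\<beta>. \<bar>\<beta>\<bar> < \<delta> \<longrightarrow> (p, - (a + \<beta>) *\<^sub>R V c p) \<in> Om c d \<and>
       \<Phi> (of_real \<beta>) = of_real (DF c d (p, - (a + \<beta>) *\<^sub>R V c p) h \<bullet> j))" for h j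
    using real_analytic_on_derivative_extension[OF F_analytic[OF assms(1,2)] Om_open[OF assms(1,2)] z0, of u h j]
    unfolding zb DF_def by metis
  then obtain D P where DP: "\<And>h j. D h j > (0::real)" "\<And>h j. P h j holomorphic_on ball 0 (D h j)"
    "\<And>h j \<beta>. \<bar>\<beta>\<bar> < D h j \<Longrightarrow> (p, - (a + \<beta>) *\<^sub>R V c p) \<in> Om c d \<and>
       P h j (of_real \<beta>) = of_real (DF c d (p, - (a + \<beta>) *\<^sub>R V c p) h \<bullet> j)"
    by metis
  define \<delta> where "\<delta> = Min (case_prod D ` (Basis \<times> Basis))"
  have \<delta>: "\<delta> > 0" "\<And>h j. h \<in> Basis \<Longrightarrow> j \<in> Basis \<Longrightarrow> \<delta> \<le> D h j"
  proof -
    have "Basis \<times> Basis \<noteq> ({} :: (('e \<times> 'e) \<times> 'e) set)" by simp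
    then show "\<delta> > 0" unfolding \<delta>_def using DP(1) by (subst Min_gr_iff) auto
    show "\<delta> \<le> D h j" if "h \<in> Basis" "j \<in> Basis" for h j
      unfolding \<delta>_def using that by (intro Min_le) auto
  qed
  \<comment> \<open>This is \<open>Dstep_expand\<close> with complex \<beta>. The default
    \<open>0\<close> off the basis gives holomorphy for all index pairs; the determinant reads only
    basis entries.\<close>
  define M where "M \<beta> i j = (if i \<in> Basis \<and> j \<in> Basis then P (j, 0) i \<beta> -
      (of_real a + \<beta>) * (\<Sum>k\<in>Basis. of_real (DV c p j \<bullet> k) * P (0, k) i \<beta>) else 0)" for \<beta> i j
  have b1: "(j, 0) \<in> Basis" "(0, j) \<in> Basis" if "j \<in> Basis" for j :: 'e
    using that by (auto simp: Basis_prod_def)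
  show ?thesis
  proof (rule that[OF \<delta>(1)])
    have hol: "P h i holomorphic_on ball 0 \<delta>" if "h \<in> Basis" "i \<in> Basis" for h i
      using DP(2) by (rule holomorphic_on_subset) (use \<delta>(2)[OF that] in auto)
    have "(\<lambda>\<beta>. M \<beta> i j) holomorphic_on ball 0 \<delta>" for i j
    proof (cases "i \<in> Basis \<and> j \<in> Basis")
      case True
      then show ?thesis unfolding M_def by (auto intro!: holomorphic_intros hol b1)
    next
      case False
      then show ?thesis unfolding M_def by (simp only: if_False holomorphic_on_const)
    qed
    then show "(\<lambda>\<beta>. basis_det (M \<beta>)) holomorphic_on ball 0 \<delta>" by (rule holomorphic_on_basis_det)
    fix \<beta> :: real assume \<beta>: "\<bar>\<beta>\<bar> < \<delta>"
    have val: "(p, - (a + \<beta>) *\<^sub>R V c p) \<in> Om c d"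
      "P h j (of_real \<beta>) = of_real (DF c d (p, - (a + \<beta>) *\<^sub>R V c p) h \<bullet> j)"
      if "h \<in> Basis" "j \<in> Basis" for h j
      using DP(3)[of \<beta> h j] \<delta>(2)[OF that] \<beta> by auto
    obtain b :: 'e where "b \<in> Basis" using nonempty_Basis by blast
    then have dom: "(p, a + \<beta>) \<in> Dom c d"
      using val(1)[OF b1(1)] Dom_iff[OF assms(1) p] by blast
    have "basis_det (M (of_real \<beta>)) = basis_det (\<lambda>i j. complex_of_real (Dstep c d p (a + \<beta>) j \<bullet> i))"
    proof (rule basis_det_cong)
      fix i j :: 'e assume ij: "i \<in> Basis" "j \<in> Basis"
      show "M (of_real \<beta>) i j = complex_of_real (Dstep c d p (a + \<beta>) j \<bullet> i)"
      proof -
        note v1 = val(2)[OF b1(1)[OF ij(2)] ij(1)]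
        have v2: "P (0, k) i (of_real \<beta>) = of_real (DF c d (p, - (a + \<beta>) *\<^sub>R V c p) (0, k) \<bullet> i)"
          if "k \<in> Basis" for k by (rule val(2)[OF b1(2)[OF that] ij(1)])
        show ?thesis
          unfolding Dstep_expand[OF assms(1,2) dom] M_def
          using ij v1 v2 by (simp add: inner_diff_left inner_sum_left)
      qed
    qed
    then have "basis_det (M (of_real \<beta>)) = of_real (Jac c d (p, a + \<beta>))"
      by (simp add: basis_det_of_real Jac_def)
    with dom show "(p, a + \<beta>) \<in> Dom c d \<and> basis_det (M (of_real \<beta>)) = of_real (Jac c d (p, a + \<beta>))"
      by simp
  qed
qed

text \<open>Near each \<open>a\<close> the set is the zero set of one determinant with a holomorphic
  extension, so the isolated-or-all dichotomy applies. At \<alpha> = 0 the derivative is the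
  identity, which supplies a point outside the set.\<close>

lemma countable_singular_steps:
  assumes "c \<in> A" "p \<in> chart_img c"
  shows "countable {\<alpha>. \<exists>d\<in>A. (p, \<alpha>) \<in> Dom c d \<and> Jac c d (p, \<alpha>) = 0}" (is "countable ?S")
proof (rule countable_of_isolated_or_locally_all)
  fix a
  \<comment> \<open>The target chart is chosen around the new point for step size \<open>a\<close>;
    by chart independence it decides singularity for all nearby step sizes.\<close>
  let ?d = "chart_at A (step (chart_inv c p) a)"
  have d: "?d \<in> A" "(p, a) \<in> Dom c ?d" using chart_at assms(2) by (auto simp: Dom_def)
  obtain \<delta> \<Phi> where \<delta>: "\<delta> > 0" "\<Phi> holomorphic_on ball 0 \<delta>"
    "\<And>\<beta>. \<bar>\<beta>\<bar> < \<delta> \<Longrightarrow> (p, a + \<beta>) \<in> Dom c ?d \<and> \<Phi> (of_real \<beta>) = of_real (Jac c ?d (p, a + \<beta>))"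
    using Jac_extension[OF assms(1) d] by blast
  obtain e where e: "e > 0" "(\<forall>t\<in>ball a e. Jac c ?d (p, t) = 0) \<or> (\<forall>t\<in>ball a e - {a}. Jac c ?d (p, t) \<noteq> 0)"
    using real_zeros_isolated_or_locally_all[of \<delta> \<Phi> "\<lambda>t. Jac c ?d (p, t)" a] \<delta> by blast
  have iff: "t \<in> ?S \<longleftrightarrow> Jac c ?d (p, t) = 0" if "t \<in> ball a \<delta>" for t
  proof -
    have "(p, t) \<in> Dom c ?d" using \<delta>(3)[of "t - a"] that by (simp add: dist_real_def abs_minus_commute)
    then show ?thesis using Jac_zero_change_chart[OF assms(1) _ d(1)] d(1) by blast
  qed
  show "\<exists>r>0. (\<forall>t\<in>ball a r. t \<in> ?S) \<or> (\<forall>t\<in>ball a r - {a}. t \<notin> ?S)"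
  proof (intro exI[of _ "min \<delta> e"] conjI)
    have sub: "ball a (min \<delta> e) \<subseteq> ball a \<delta>" "ball a (min \<delta> e) \<subseteq> ball a e" by auto
    show "(\<forall>t\<in>ball a (min \<delta> e). t \<in> ?S) \<or> (\<forall>t\<in>ball a (min \<delta> e) - {a}. t \<notin> ?S)"
      using e(2) iff sub by blast
  qed (use \<delta>(1) e(1) in simp)
next
  have dom: "(p, 0) \<in> Dom c c"
    using Dom_iff[OF assms, of 0 c] zero_in_Om[OF assms] by simp
  have "Dstep c c p 0 h = h" for h
    using DF_zero_base[OF assms] by (simp add: Dstep_def)
  then have "Jac c c (p, 0) \<noteq> 0" using Jac_eq_0_iff[OF assms(1,1) dom] by auto
  then show "0 \<notin> ?S" using Jac_zero_change_chart[OF assms(1) _ assms(1) _ dom] by blast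
qed

definition Sing :: "('m, 'e) chart \<Rightarrow> ('m, 'e) chart \<Rightarrow> real \<Rightarrow> 'e set" where
  "Sing c d \<alpha> = {p. (p, \<alpha>) \<in> Dom c d \<and> Jac c d (p, \<alpha>) = 0}"

text \<open>For every point the bad step sizes are countable, hence null. Fubini turns this into
  null sets of bad points for almost every step size.\<close>

lemma AE_negligible_Sing:
  assumes "c \<in> A" "d \<in> A"
  shows "AE \<alpha> in lborel. negligible (Sing c d \<alpha>)"
proof -
  define Z where "Z = {y \<in> Dom c d. Jac c d y = 0}"
  have "closedin (top_of_set (Dom c d)) (Dom c d \<inter> Jac c d -` {0})"
    by (rule continuous_closedin_preimage[OF Jac_continuous[OF assms]]) simp
  then obtain T where T: "closed T" "Dom c d \<inter> Jac c d -` {0} = T \<inter> Dom c d"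
    unfolding closedin_closed by (metis Int_commute)
  have "Z = T \<inter> Dom c d" using T(2) by (auto simp: Z_def)
  then have Zb: "Z \<in> sets borel" using T(1) Dom_open[OF assms] by auto
  have sl: "AE \<alpha> in lborel. (p, \<alpha>) \<notin> Z" for p
  proof -
    have "countable {\<alpha>. (p, \<alpha>) \<in> Z}"
    proof (cases "p \<in> chart_img c")
      case True
      show ?thesis
        by (rule countable_subset[OF _ countable_singular_steps[OF assms(1) True]]) (use assms in \<open>auto simp: Z_def\<close>)
    next
      case False
      then have "{\<alpha>. (p, \<alpha>) \<in> Z} = {}" using Dom_in_img[of p _ c d] by (simp add: Z_def) blast
      then show ?thesis by simp
    qed
    then have "{\<alpha>. (p, \<alpha>) \<in> Z} \<in> null_sets lborel" by (rule countable_imp_null_set_lborel)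
    then show ?thesis by (rule AE_I') auto
  qed
  have "{y \<in> space (lborel \<Otimes>\<^sub>M lborel). (fst y, snd y) \<notin> Z} \<in> sets (lborel \<Otimes>\<^sub>M (lborel :: real measure))"
    unfolding lborel_prod using Zb by (simp add: Compl_eq[symmetric] borel_comp)
  then have "(AE p in lborel. AE \<alpha> in lborel. (p, \<alpha>) \<notin> Z) = (AE \<alpha> in lborel. AE p in lborel. (p, \<alpha>) \<notin> Z)"
    by (rule lborel_pair.AE_commute)
  with sl have "AE \<alpha> in lborel. AE p in lborel. (p, \<alpha>) \<notin> Z" by simp
  then show ?thesis
  proof (rule AE_mp, intro AE_I2 impI)
    fix \<alpha> assume "AE p in lborel. (p, \<alpha>) \<notin> Z"
    then obtain N where N: "{p. \<not> (p, \<alpha>) \<notin> Z} \<subseteq> N" "N \<in> null_sets lborel"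
      by (auto elim!: AE_E simp: null_sets_def)
    have "negligible N" using N(2) negligible_iff_null_sets null_sets_completionI by blast
    then show "negligible (Sing c d \<alpha>)" by (rule negligible_subset) (use N(1) in \<open>auto simp: Sing_def Z_def\<close>)
  qed
qed

section \<open>Null sets and strict saddles\<close>

lemma countable_cover: "\<exists>A0\<subseteq>A. countable A0 \<and> (\<Union>c\<in>A0. chart_dom c) = UNIV"
proof -
  have "open S" if "S \<in> chart_dom ` A" for S using that chart by (auto simp: is_chart_def)
  then obtain F' where F': "F' \<subseteq> chart_dom ` A" "countable F'" "\<Union>F' = \<Union>(chart_dom ` A)"
    by (rule Lindelof)
  then obtain A0 where "countable A0" "A0 \<subseteq> A" "F' = chart_dom ` A0"
    by (metis countable_subset_image)
  moreover have "\<Union>(chart_dom ` A) = UNIV" using atlas by (simp add: real_analytic_atlas_def)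
  ultimately show ?thesis using F' by auto
qed

definition A0 :: "('m, 'e) chart set" where
  "A0 = (SOME A0. A0 \<subseteq> A \<and> countable A0 \<and> (\<Union>c\<in>A0. chart_dom c) = UNIV)"

lemma A0: "A0 \<subseteq> A" "countable A0" "(\<Union>c\<in>A0. chart_dom c) = UNIV"
proof -
  have "\<exists>A0. A0 \<subseteq> A \<and> countable A0 \<and> (\<Union>c\<in>A0. chart_dom c) = UNIV" using countable_cover by blast
  from someI_ex[OF this] show "A0 \<subseteq> A" "countable A0" "(\<Union>c\<in>A0. chart_dom c) = UNIV"
    unfolding A0_def by blast+
qed

text \<open>Testing on a countable subatlas keeps all unions over charts countable; nullity in every
  smooth chart follows, because transition maps are differentiable.\<close>

definition mnull :: "'m set \<Rightarrow> bool" where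
  "mnull S \<longleftrightarrow> (\<forall>c\<in>A0. negligible (snd c ` (S \<inter> chart_dom c)))"

lemma negligible_chart_change:
  fixes d :: "('m, 'e) chart"
  assumes "c \<in> A"
    and diff: "\<And>x. x \<in> chart_dom c \<Longrightarrow> x \<in> chart_dom d \<Longrightarrow> transition c d differentiable (at (snd c x))"
    and null: "negligible (snd c ` (S \<inter> chart_dom c))"
  shows "negligible (snd d ` (S \<inter> chart_dom c \<inter> chart_dom d))"
proof -
  let ?N = "snd c ` (S \<inter> chart_dom c \<inter> chart_dom d)"
  have "negligible ?N" by (rule negligible_subset[OF null]) blast
  moreover have "transition c d differentiable_on ?N"
    by (rule differentiable_at_imp_differentiable_on) (use diff in blast)
  ultimately have "negligible (transition c d ` ?N)"
    by (rule negligible_differentiable_image_negligible[OF order_refl])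
  moreover have "transition c d ` ?N = snd d ` (S \<inter> chart_dom c \<inter> chart_dom d)"
    unfolding image_image by (rule image_cong[OF refl]) (use transition_chart[OF assms(1)] in blast)
  ultimately show ?thesis by simp
qed

lemma mnull_imp_negligible:
  fixes d :: "('m, 'e) chart"
  assumes "mnull S"
    and diff: "\<And>c x. c \<in> A \<Longrightarrow> x \<in> chart_dom c \<Longrightarrow> x \<in> chart_dom d \<Longrightarrow>
      transition c d differentiable (at (snd c x))"
  shows "negligible (snd d ` (S \<inter> chart_dom d))"
proof -
  have "negligible (\<Union>((\<lambda>c. snd d ` (S \<inter> chart_dom c \<inter> chart_dom d)) ` A0))"
  proof (rule negligible_countable_Union)
    show "countable ((\<lambda>c. snd d ` (S \<inter> chart_dom c \<inter> chart_dom d)) ` A0)" using A0(2) by simp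
    fix T assume "T \<in> (\<lambda>c. snd d ` (S \<inter> chart_dom c \<inter> chart_dom d)) ` A0"
    then obtain c where c: "c \<in> A0" "T = snd d ` (S \<inter> chart_dom c \<inter> chart_dom d)" by blast
    have cA: "c \<in> A" using c A0 by blast
    show "negligible T" unfolding c(2)
      by (rule negligible_chart_change[OF cA diff[OF cA]]) (use assms(1) c mnull_def in auto)
  qed
  then show ?thesis
  proof (rule negligible_subset, intro subsetI)
    fix p assume "p \<in> snd d ` (S \<inter> chart_dom d)"
    then obtain x where x: "x \<in> S" "x \<in> chart_dom d" "p = snd d x" by blast
    then obtain c where "c \<in> A0" "x \<in> chart_dom c" using A0(3) by blast
    with x show "p \<in> \<Union>((\<lambda>c. snd d ` (S \<inter> chart_dom c \<inter> chart_dom d)) ` A0)" by blast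
  qed
qed

lemma mnull_imp_manifold_measure_zero:
  assumes "mnull S" shows "manifold_measure_zero A S"
  unfolding manifold_measure_zero_def negligible_iff_null_sets[symmetric]
proof (intro allI impI)
  fix d assume d: "smooth_chart A d"
  show "negligible (snd d ` (S \<inter> chart_dom d))"
  proof (rule mnull_imp_negligible[OF assms])
    fix c x assume c: "c \<in> A" and x: "x \<in> chart_dom c" "x \<in> chart_dom d"
    have "Ck_on (Suc 0) (snd c ` (chart_dom c \<inter> chart_dom d)) (transition c d)"
      using d c unfolding smooth_chart_def smooth_on_def by blast
    then have "\<forall>p\<in>snd c ` (chart_dom c \<inter> chart_dom d). transition c d differentiable (at p)"
      unfolding Ck_on.simps by blast
    with x show "transition c d differentiable (at (snd c x))" by blast
  qed
qed

lemma mnull_in_chart: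
  assumes "c \<in> A" "S \<subseteq> chart_dom c" "negligible (snd c ` S)"
  shows "mnull S"
  unfolding mnull_def
proof
  fix d assume "d \<in> A0"
  then have d: "d \<in> A" using A0 by blast
  have Sc: "S \<inter> chart_dom c = S" using assms(2) by blast
  have "negligible (snd d ` (S \<inter> chart_dom c \<inter> chart_dom d))"
    by (rule negligible_chart_change[OF assms(1)])
      (use transition_differentiable[OF assms(1) d] assms(3) Sc in \<open>auto intro: differentiableI\<close>)
  then show "negligible (snd d ` (S \<inter> chart_dom d))" by (simp only: Sc)
qed

lemma mnull_subset: "mnull T \<Longrightarrow> S \<subseteq> T \<Longrightarrow> mnull S"
  unfolding mnull_def by (meson Int_mono image_mono negligible_subset order_refl)

lemma mnull_UN:
  assumes "countable I" "\<And>i. i \<in> I \<Longrightarrow> mnull (S i)" shows "mnull (\<Union>i\<in>I. S i)"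
  unfolding mnull_def
proof
  fix c assume c: "c \<in> A0"
  have "negligible (\<Union>((\<lambda>i. snd c ` (S i \<inter> chart_dom c)) ` I))"
    by (rule negligible_countable_Union) (use assms c mnull_def in auto)
  moreover have "snd c ` ((\<Union>i\<in>I. S i) \<inter> chart_dom c) = \<Union>((\<lambda>i. snd c ` (S i \<inter> chart_dom c)) ` I)" by blast
  ultimately show "negligible (snd c ` ((\<Union>i\<in>I. S i) \<inter> chart_dom c))" by simp
qed

definition regular_step :: "real \<Rightarrow> bool" where
  "regular_step \<alpha> \<longleftrightarrow> (\<forall>c\<in>A0. \<forall>d\<in>A0. negligible (Sing c d \<alpha>))"

lemma AE_regular_step: "AE \<alpha> in lborel. regular_step \<alpha>"
proof -
  have "AE \<alpha> in lborel. \<forall>d\<in>A0. negligible (Sing c d \<alpha>)" if "c \<in> A0" for c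
    unfolding AE_ball_countable[OF A0(2)] using AE_negligible_Sing A0(1) that by blast
  then show ?thesis unfolding regular_step_def AE_ball_countable[OF A0(2)] by blast
qed

text \<open>In a chart the preimage is covered by pieces indexed by countably many target charts.
  The singular points of a piece are null by regularity of \<alpha>; at its other points the
  derivative is injective, and \<open>strict_deriv_negligible_preimage\<close> applies.\<close>

lemma mnull_step_preimage:
  assumes reg: "regular_step \<alpha>" and S: "mnull S"
  shows "mnull {x. step x \<alpha> \<in> S}"
  unfolding mnull_def
proof
  fix c assume c: "c \<in> A0"
  then have cA: "c \<in> A" using A0 by blast
  define Y where "Y d = {p. (p, \<alpha>) \<in> Dom c d \<and> Jac c d (p, \<alpha>) \<noteq> 0 \<and> step (chart_inv c p) \<alpha> \<in> S}" for d
  have Y: "negligible (Y d)" if d: "d \<in> A0" for d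
  proof (rule strict_deriv_negligible_preimage)
    have dA: "d \<in> A" using d A0 by blast
    show "negligible (snd d ` (S \<inter> chart_dom d))" using S d by (simp add: mnull_def)
    show "(\<lambda>q. snd d (step (chart_inv c q) \<alpha>)) ` Y d \<subseteq> snd d ` (S \<inter> chart_dom d)"
      by (auto simp: Y_def Dom_def)
    fix p assume "p \<in> Y d"
    then have p: "(p, \<alpha>) \<in> Dom c d" "Jac c d (p, \<alpha>) \<noteq> 0" by (simp_all add: Y_def)
    show "\<exists>L. strict_deriv (\<lambda>q. snd d (step (chart_inv c q) \<alpha>)) L p \<and> (\<forall>x. L x = 0 \<longrightarrow> x = 0)"
      using step_strict_deriv[OF cA dA p(1)] Jac_eq_0_iff[OF cA dA p(1)] p(2) by blast
  qed
  have "negligible (\<Union>((\<lambda>d. Sing c d \<alpha> \<union> Y d) ` A0))"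
    using Y reg c A0(2) by (intro negligible_countable_Union) (auto simp: regular_step_def)
  moreover have "snd c ` ({x. step x \<alpha> \<in> S} \<inter> chart_dom c) \<subseteq> \<Union>((\<lambda>d. Sing c d \<alpha> \<union> Y d) ` A0)"
  proof
    fix p assume "p \<in> snd c ` ({x. step x \<alpha> \<in> S} \<inter> chart_dom c)"
    then have p: "p \<in> chart_img c" "step (chart_inv c p) \<alpha> \<in> S"
      unfolding chart_image_eq[OF chart[OF cA]] by simp_all
    obtain d where "d \<in> A0" "step (chart_inv c p) \<alpha> \<in> chart_dom d" using A0(3) by blast
    then show "p \<in> \<Union>((\<lambda>d. Sing c d \<alpha> \<union> Y d) ` A0)"
      using p by (intro UN_I[of d]) (auto simp: Sing_def Y_def Dom_def)
  qed
  ultimately show "negligible (snd c ` ({x. step x \<alpha> \<in> S} \<inter> chart_dom c))" by (rule negligible_subset)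
qed

section \<open>The Hessian at critical points and the trap at a strict saddle\<close>

lemma G_DV_critical:
  assumes "c \<in> A" "p \<in> chart_img c" "V c p = 0"
  shows "G c p (DV c p u) w = frechet_derivative (\<lambda>q. Df c q w) (at p) u"
proof -
  note G_sum = G_expand_left[OF assms(1)]
  have dV: "(V c has_derivative DV c p) (at p)"
    by (rule strict_deriv_has_derivative[OF V_strict_deriv[OF assms(1,2)]])
  have dG: "((\<lambda>q. G c q i w) has_derivative frechet_derivative (\<lambda>q. G c q i w) (at p)) (at p)" for i
    by (rule Ck_on_1_has_derivative[OF G_Ck1[OF assms(1)] assms(2)])
  have "((\<lambda>q. \<Sum>i\<in>Basis. (V c q \<bullet> i) * G c q i w) has_derivative
      (\<lambda>u. \<Sum>i\<in>Basis. (V c p \<bullet> i) * frechet_derivative (\<lambda>q. G c q i w) (at p) u + (DV c p u \<bullet> i) * G c p i w)) (at p)"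
    by (intro has_derivative_sum has_derivative_mult has_derivative_inner_left dV dG)
  \<comment> \<open>Since \<open>V c p = 0\<close>, the terms with derivatives of the metric vanish.
    Differentiating \<open>G_V\<close> then identifies the form of \<open>DV\<close> with the second
    derivative of \<open>f\<close>.\<close>
  then have "((\<lambda>q. \<Sum>i\<in>Basis. (V c q \<bullet> i) * G c q i w) has_derivative (\<lambda>u. G c p (DV c p u) w)) (at p)"
    by (simp add: assms(3) G_sum[OF assms(2), symmetric])
  then have "((\<lambda>q. Df c q w) has_derivative (\<lambda>u. G c p (DV c p u) w)) (at p)"
    by (rule has_derivative_transform_within_open[OF _ open_img[OF assms(1)] assms(2)])
      (simp add: G_sum[symmetric] G_V[OF assms(1)])
  then show ?thesis using frechet_derivative_at by metis
qed

lemma DV_selfadjoint_critical: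
  assumes "c \<in> A" "p \<in> chart_img c" "V c p = 0"
  shows "G c p (DV c p u) w = G c p u (DV c p w)"
proof -
  have "G c p (DV c p u) w = frechet_derivative (\<lambda>q. Df c q w) (at p) u" by (rule G_DV_critical[OF assms])
  also have "\<dots> = frechet_derivative (\<lambda>q. Df c q u) (at p) w"
    unfolding Df_def by (rule Ck_on_2_symmetric[OF f_Ck2[OF assms(1)] open_img[OF assms(1)] assms(2)])
  also have "\<dots> = G c p (DV c p w) u" by (rule G_DV_critical[OF assms, symmetric])
  also have "\<dots> = G c p u (DV c p w)" by (rule G_sym[OF assms(1,2)])
  finally show ?thesis .
qed

text \<open>Each of the three Christoffel terms contains the gradient at \<open>x\<close>, either as
  an argument of the metric or as the direction of differentiation. At a critical point only the
  ordinary derivative of the coordinate field remains.\<close>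

lemma hessian_critical:
  assumes "grad A g f x = tv_zero" "v \<in> tangent_space A x"
  shows "hessian A g f x v (chart_at A x) = DV (chart_at A x) (snd (chart_at A x) x) (v (chart_at A x))"
proof -
  define c where "c = chart_at A x"
  have c: "c \<in> A" "x \<in> chart_dom c" unfolding c_def by (rule chart_at)+
  define p where "p = snd c x"
  have p: "p \<in> chart_img c" using c by (simp add: p_def)
  have x0: "grad A g f x c = 0" using assms by (simp add: tv_zero_def)
  have z1: "frechet_derivative (\<lambda>q. G c q 0 w) (at p) = (\<lambda>h. 0)" for w
  proof (rule frechet_derivative_at[symmetric])
    show "((\<lambda>q. G c q 0 w) has_derivative (\<lambda>h. 0)) (at p)"
      by (rule has_derivative_transform_within_open[OF has_derivative_const open_img[OF c(1)] p])
        (simp add: bounded_bilinear.zero_left[OF G_bounded_bilinear[OF c(1)]])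
  qed
  have z3: "frechet_derivative (\<lambda>q. G c q w 0) (at p) = (\<lambda>h. 0)" for w
  proof (rule frechet_derivative_at[symmetric])
    show "((\<lambda>q. G c q w 0) has_derivative (\<lambda>h. 0)) (at p)"
      by (rule has_derivative_transform_within_open[OF has_derivative_const open_img[OF c(1)] p])
        (simp add: bounded_bilinear.zero_right[OF G_bounded_bilinear[OF c(1)]])
  qed
  have z2: "frechet_derivative (\<lambda>q. G c q u w) (at p) 0 = 0" for u w
    using has_derivative_linear[OF Ck_on_1_has_derivative[OF G_Ck1[OF c(1)] p]] by (rule linear_0)
  have Vc: "(\<lambda>q. grad A g f (chart_inv c q) c) = V c" by (simp add: V_def fun_eq_iff)
  have "hessian A g f x v = (THE z. z \<in> tangent_space A x \<and>
      (\<forall>w\<in>tangent_space A x. g x z w = G c p (DV c p (v c)) (w c)))"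
    unfolding hessian_def covariant_derivative_def Let_def c_def[symmetric] p_def[symmetric] Vc x0 z1 z2 z3
    by simp
  also have "\<dots> = tv_of_coord A c x (DV c p (v c))"
  proof (rule the1_equality)
    show "\<exists>!z. z \<in> tangent_space A x \<and> (\<forall>w\<in>tangent_space A x. g x z w = G c p (DV c p (v c)) (w c))"
      by (rule riesz_tangent[OF c])
        (rule bounded_linear.linear[OF bounded_bilinear.bounded_linear_right[OF G_bounded_bilinear[OF c(1) p]]])
    show "tv_of_coord A c x (DV c p (v c)) \<in> tangent_space A x \<and>
        (\<forall>w\<in>tangent_space A x. g x (tv_of_coord A c x (DV c p (v c))) w = G c p (DV c p (v c)) (w c))"
      using tv_of_coord_in_tangent_space[OF c] metric_eq_G[OF c] tv_of_coord_self[OF c] p_def by simp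
  qed
  finally show ?thesis using tv_of_coord_self[OF c] unfolding c_def p_def by simp
qed

lemma Dstep_critical:
  assumes "c \<in> A" "p \<in> chart_img c" "V c p = 0"
  shows "(p, \<alpha>) \<in> Dom c c" "Dstep c c p \<alpha> h = h - \<alpha> *\<^sub>R DV c p h"
proof -
  note z = zero_in_Om[OF assms(1,2)]
  show "(p, \<alpha>) \<in> Dom c c" using Dom_iff[OF assms(1,2)] z assms(3) by simp
  have "Dstep c c p \<alpha> h = DF c c (p, 0) ((h, 0) + (0, - \<alpha> *\<^sub>R DV c p h))"
    by (simp add: Dstep_def assms(3))
  also have "\<dots> = DF c c (p, 0) (h, 0) + DF c c (p, 0) (0, - \<alpha> *\<^sub>R DV c p h)"
    by (rule linear_add[OF DF_linear[OF assms(1,1) z]])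
  also have "\<dots> = h - \<alpha> *\<^sub>R DV c p h" by (simp add: DF_zero_base[OF assms(1,2)] DF_zero_fibre[OF assms(1,2)])
  finally show "Dstep c c p \<alpha> h = h - \<alpha> *\<^sub>R DV c p h" .
qed

text \<open>An eigenvalue \<open>ev < 0\<close> of the Hessian becomes the eigenvalue
  \<open>1 - \<alpha> * ev > 1\<close> of the linearized step, which is self-adjoint for the metric
  at the saddle. So the trapping lemma applies in a chart.\<close>

lemma strict_saddle_trap:
  assumes saddle: "strict_saddle A g f x" and \<alpha>: "\<alpha> > 0"
  obtains U where "open U" "x \<in> U" "mnull {y. \<forall>n. ((\<lambda>y. step y \<alpha>) ^^ n) y \<in> U}"
proof -
  obtain ev v where ev: "grad A g f x = tv_zero" "ev < 0" "v \<in> tangent_space A x" "v \<noteq> tv_zero"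
    "hessian A g f x v = tv_scale ev v"
    using saddle unfolding strict_saddle_def by blast
  define c where "c = chart_at A x"
  have c: "c \<in> A" "x \<in> chart_dom c" unfolding c_def by (rule chart_at)+
  define p where "p = snd c x"
  have p: "p \<in> chart_img c" using c by (simp add: p_def)
  have xp: "chart_inv c p = x" unfolding p_def by (rule chart_inv_chart[OF chart[OF c(1)] c(2)])
  have V0: "V c p = 0" using ev(1) by (simp add: V_def xp tv_zero_def)
  have vc: "v c \<noteq> 0"
  proof
    assume "v c = 0"
    then have "v = tv_zero" using tangent_eq_tv_of_coord[OF ev(3) c] tv_of_coord_zero[OF c] by simp
    then show False using ev by simp
  qed
  have DVv: "DV c p (v c) = ev *\<^sub>R v c"
    using hessian_critical[OF ev(1,3)] ev(5) by (simp add: c_def[symmetric] p_def[symmetric] tv_scale_def)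
  note crit = Dstep_critical[OF c(1) p V0]
  let ?P = "\<lambda>q. snd c (step (chart_inv c q) \<alpha>)"
  interpret B: bounded_bilinear "G c p" by (rule G_bounded_bilinear[OF c(1) p])
  have adj: "G c p (Dstep c c p \<alpha> u) w = G c p u (Dstep c c p \<alpha> w)" for u w
    by (simp add: crit(2) B.diff_left B.diff_right B.scaleR_left B.scaleR_right
        DV_selfadjoint_critical[OF c(1) p V0])
  have eig: "Dstep c c p \<alpha> (v c) = (1 - \<alpha> * ev) *\<^sub>R v c"
    by (simp add: crit(2) DVv algebra_simps)
  have "\<alpha> * ev < 0" using \<alpha> ev(2) by (rule mult_pos_neg)
  then have big: "\<bar>1 - \<alpha> * ev\<bar> > 1" by simp
  obtain d where d: "d > 0" "\<And>\<delta>. \<delta> < d \<Longrightarrow> negligible {q. \<forall>n. (?P ^^ n) q \<in> cball p \<delta>}"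
    using negligible_trapped_near_unstable[OF step_strict_deriv[OF c(1,1) crit(1)]
        G_bounded_bilinear[OF c(1) p] G_sym[OF c(1) p] G_pos[OF c(1) p] adj vc eig big] by blast
  obtain e where e: "e > 0" "ball p e \<subseteq> chart_img c" using p open_img[OF c(1)] openE by metis
  define \<delta> where "\<delta> = min (d / 2) e"
  have \<delta>: "\<delta> > 0" "\<delta> < d" "\<delta> \<le> e" using d e by (auto simp: \<delta>_def)
  have sub: "ball p \<delta> \<subseteq> chart_img c" using e \<delta>(3) by auto
  define U where "U = chart_inv c ` ball p \<delta>"
  show ?thesis
  proof (rule that[of U])
    show "open U" unfolding U_def by (rule open_chart_inv_image[OF chart[OF c(1)] open_ball sub])
    show "x \<in> U" unfolding U_def using \<delta>(1) xp by (intro image_eqI[of _ _ p]) auto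
    have U: "y \<in> chart_dom c" "snd c y \<in> ball p \<delta>" if "y \<in> U" for y
    proof -
      have "y \<in> chart_inv c ` ball p \<delta>" using \<open>y \<in> U\<close> unfolding U_def .
      then obtain q where q: "q \<in> ball p \<delta>" "y = chart_inv c q" by blast
      then have "q \<in> chart_img c" using sub by blast
      with q show "y \<in> chart_dom c" "snd c y \<in> ball p \<delta>"
        using chart_inv_in_dom[of q c] chart_chart_inv[of q c] by simp_all
    qed
    let ?W = "{y. \<forall>n. ((\<lambda>y. step y \<alpha>) ^^ n) y \<in> U}"
    have W0: "y \<in> U" if "y \<in> ?W" for y using that by (auto dest: spec[of _ 0])
    show "mnull ?W"
    proof (rule mnull_in_chart[OF c(1)])
      show "?W \<subseteq> chart_dom c" using W0 U by blast
      show "negligible (snd c ` ?W)"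
      proof (rule negligible_subset[OF d(2)[OF \<delta>(2)]], clarify)
        fix y n assume y: "\<forall>n. ((\<lambda>y. step y \<alpha>) ^^ n) y \<in> U"
        \<comment> \<open>As long as the orbit stays in \<open>U\<close>, it stays in the chart
          domain, and the iterates of the coordinate map \<open>?P\<close> are the coordinates of
          the orbit.\<close>
        have "(?P ^^ n) (snd c y) = snd c (((\<lambda>y. step y \<alpha>) ^^ n) y)" for n
        proof (induction n)
          case (Suc n)
          have "chart_inv c (snd c (((\<lambda>y. step y \<alpha>) ^^ n) y)) = ((\<lambda>y. step y \<alpha>) ^^ n) y"
            using y U(1) by (intro chart_inv_chart[OF chart[OF c(1)]]) blast
          with Suc show ?case by simp
        qed simp
        then show "(?P ^^ n) (snd c y) \<in> cball p \<delta>" using U(2) y by (metis ball_subset_cball subsetD)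
      qed
    qed
  qed
qed

text \<open>A convergent orbit is eventually trapped in a neighbourhood of its limit. By Lindelof,
  countably many such neighbourhoods cover all strict saddles, and the time of entry
  \<open>N\<close> is another countable index.\<close>

lemma mnull_converge_to_strict_saddle:
  assumes reg: "regular_step \<alpha>" and \<alpha>: "\<alpha> > 0"
  shows "mnull {y. \<exists>x. strict_saddle A g f x \<and> (\<lambda>n. ((\<lambda>y. step y \<alpha>) ^^ n) y) \<longlonglongrightarrow> x}"
proof -
  define Loc where "Loc U = {y. \<forall>n. ((\<lambda>y. step y \<alpha>) ^^ n) y \<in> U}" for U
  define \<U> where "\<U> = {U. open U \<and> mnull (Loc U)}"
  obtain \<V> where \<V>: "\<V> \<subseteq> \<U>" "countable \<V>" "\<Union>\<V> = \<Union>\<U>"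
    using Lindelof[of \<U>] unfolding \<U>_def by blast
  have pre: "mnull {y. ((\<lambda>y. step y \<alpha>) ^^ N) y \<in> Loc U}" if "U \<in> \<V>" for U N
  proof (induction N)
    case 0
    then show ?case using that \<V>(1) by (auto simp: \<U>_def)
  next
    case (Suc N)
    from mnull_step_preimage[OF reg Suc] show ?case by (simp only: funpow_Suc_right comp_def mem_Collect_eq)
  qed
  have "mnull (\<Union>(U, N)\<in>\<V> \<times> UNIV. {y. ((\<lambda>y. step y \<alpha>) ^^ N) y \<in> Loc U})"
    using pre \<V>(2) by (intro mnull_UN countable_SIGMA) auto
  then show ?thesis
  proof (rule mnull_subset, clarify)
    fix y x assume x: "strict_saddle A g f x" "(\<lambda>n. ((\<lambda>y. step y \<alpha>) ^^ n) y) \<longlonglongrightarrow> x"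
    obtain U0 where "open U0" "x \<in> U0" "mnull (Loc U0)"
      using strict_saddle_trap[OF x(1) \<alpha>] unfolding Loc_def by blast
    then obtain U where U: "U \<in> \<V>" "x \<in> U" using \<V>(3) by (auto simp: \<U>_def)
    then have "open U" using \<V>(1) by (auto simp: \<U>_def)
    then obtain N where "\<And>n. n \<ge> N \<Longrightarrow> ((\<lambda>y. step y \<alpha>) ^^ n) y \<in> U"
      using topological_tendstoD[OF x(2) _ U(2)] by (auto simp: eventually_sequentially)
    then have "((\<lambda>y. step y \<alpha>) ^^ N) y \<in> Loc U"
      unfolding Loc_def by (simp add: funpow_add[symmetric, THEN fun_cong, unfolded comp_def])
    with U(1) show "y \<in> (\<Union>(U, N)\<in>\<V> \<times> UNIV. {y. ((\<lambda>y. step y \<alpha>) ^^ N) y \<in> Loc U})" by blast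
  qed
qed

section \<open>Backtracking\<close>

lemma Df_continuous: "c \<in> A \<Longrightarrow> continuous_on (chart_img c) (\<lambda>q. Df c q i)"
  using Ck_on_2D(2)[OF f_Ck2 open_img] unfolding Df_def Ck_on.simps by blast

lemma grad_norm_square:
  assumes "c \<in> A" "q \<in> chart_img c"
  shows "g (chart_inv c q) (grad A g f (chart_inv c q)) (grad A g f (chart_inv c q)) = Df c q (V c q)"
    and "0 \<le> Df c q (V c q)"
    and "tv_norm g (chart_inv c q) (grad A g f (chart_inv c q)) = sqrt (Df c q (V c q))"
proof -
  show 1: "g (chart_inv c q) (grad A g f (chart_inv c q)) (grad A g f (chart_inv c q)) = Df c q (V c q)"
    using grad_properties(2)[OF grad_properties(1)]
      differential_eq_Df[OF assms(1) chart_inv_in_dom[OF assms(2)] grad_properties(1)]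
    by (simp add: chart_chart_inv[OF assms(2)] V_def)
  show "0 \<le> Df c q (V c q)"
    using G_pos[OF assms, of "V c q"] G_V[OF assms, of "V c q"] linear_0[OF Df_linear[OF assms]]
    by (cases "V c q = 0") auto
  show "tv_norm g (chart_inv c q) (grad A g f (chart_inv c q)) = sqrt (Df c q (V c q))"
    by (simp add: tv_norm_def 1)
qed

text \<open>Ensures that a run converging to a critical point stops resetting its step size.\<close>

lemma grad_norm_small_near_critical:
  assumes "grad A g f x = tv_zero" "\<epsilon> > 0"
  obtains U where "open U" "x \<in> U" "\<And>y. y \<in> U \<Longrightarrow> tv_norm g y (grad A g f y) < \<epsilon>"
proof -
  define c where "c = chart_at A x"
  have c: "c \<in> A" "x \<in> chart_dom c" unfolding c_def by (rule chart_at)+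
  define p where "p = snd c x"
  have p: "p \<in> chart_img c" using c by (simp add: p_def)
  have xp: "chart_inv c p = x" unfolding p_def by (rule chart_inv_chart[OF chart[OF c(1)] c(2)])
  have eq: "Df c q (V c q) = (\<Sum>i\<in>Basis. (V c q \<bullet> i) * Df c q i)" if "q \<in> chart_img c" for q
  proof -
    have "Df c q (V c q) = Df c q (\<Sum>i\<in>Basis. (V c q \<bullet> i) *\<^sub>R i)" by (simp only: euclidean_representation)
    then show ?thesis by (simp add: linear_sum[OF Df_linear[OF c(1) that]] linear_scale[OF Df_linear[OF c(1) that]])
  qed
  have "continuous_on (chart_img c) (\<lambda>q. \<Sum>i\<in>Basis. (V c q \<bullet> i) * Df c q i)"
    by (intro continuous_intros V_continuous Df_continuous c)
  then have "continuous_on (chart_img c) (\<lambda>q. Df c q (V c q))"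
    by (rule continuous_on_eq) (simp add: eq)
  then have "open (chart_img c \<inter> (\<lambda>q. Df c q (V c q)) -` {..<\<epsilon>\<^sup>2})"
    by (intro continuous_open_preimage open_img c open_lessThan)
  then have op: "open (chart_inv c ` (chart_img c \<inter> (\<lambda>q. Df c q (V c q)) -` {..<\<epsilon>\<^sup>2}))"
    by (rule open_chart_inv_image[OF chart[OF c(1)]]) blast
  show ?thesis
  proof (rule that[OF op])
    have "V c p = 0" using assms(1) by (simp add: V_def xp tv_zero_def)
    then have "p \<in> chart_img c \<inter> (\<lambda>q. Df c q (V c q)) -` {..<\<epsilon>\<^sup>2}"
      using p assms(2) by (simp add: linear_0[OF Df_linear[OF c(1) p]])
    then show "x \<in> chart_inv c ` (chart_img c \<inter> (\<lambda>q. Df c q (V c q)) -` {..<\<epsilon>\<^sup>2})"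
      using xp by (intro image_eqI[of _ _ p]) simp_all
    fix y assume "y \<in> chart_inv c ` (chart_img c \<inter> (\<lambda>q. Df c q (V c q)) -` {..<\<epsilon>\<^sup>2})"
    then obtain q where q: "q \<in> chart_img c" "Df c q (V c q) < \<epsilon>\<^sup>2" "y = chart_inv c q" by auto
    have "sqrt (Df c q (V c q)) < sqrt (\<epsilon>\<^sup>2)" using q(2) by (rule real_sqrt_less_mono)
    then show "tv_norm g y (grad A g f y) < \<epsilon>"
      using grad_norm_square(3)[OF c(1) q(1)] assms(2) q(3) by simp
  qed
qed

text \<open>The minimum over a compact ball of points times the unit sphere serves all nearby points
  at once.\<close>

lemma G_locally_coercive:
  assumes "c \<in> A" "p \<in> chart_img c"
  obtains d m where "d > 0" "m > 0" "ball p d \<subseteq> chart_img c"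
    "\<And>q u. q \<in> ball p d \<Longrightarrow> m * (norm u)\<^sup>2 \<le> G c q u u"
proof -
  obtain d where d: "d > 0" "cball p d \<subseteq> chart_img c"
    using open_img[OF assms(1)] assms(2) open_contains_cball by blast
  let ?K = "cball p d \<times> sphere (0::'e) 1"
  have eq: "G c q u u = (\<Sum>i\<in>Basis. \<Sum>j\<in>Basis. (u \<bullet> i) * (u \<bullet> j) * G c q i j)" if "q \<in> chart_img c" for q u
  proof -
    have "G c q i u = (\<Sum>j\<in>Basis. (u \<bullet> j) * G c q i j)" for i
      unfolding G_sym[OF assms(1) that, of i] by (rule G_expand_left[OF assms(1) that])
    then show ?thesis
      unfolding G_expand_left[OF assms(1) that, of u] by (simp add: sum_distrib_left mult.assoc)
  qed
  have Gc: "continuous_on (chart_img c) (\<lambda>q. G c q i j)" for i j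
    using metric assms(1) unfolding riemannian_metric_def smooth_on_def by (metis Ck_on.simps(1))
  have "continuous_on ?K (\<lambda>z. \<Sum>i\<in>Basis. \<Sum>j\<in>Basis. (snd z \<bullet> i) * (snd z \<bullet> j) * G c (fst z) i j)"
    by (intro continuous_intros continuous_on_compose2[OF Gc]) (use d in auto)
  then have "continuous_on ?K (\<lambda>z. G c (fst z) (snd z) (snd z))"
    by (rule continuous_on_eq) (use d eq in auto)
  moreover have "compact ?K" by (intro compact_Times compact_cball compact_sphere)
  moreover have "?K \<noteq> {}" using d(1) by (auto simp: vector_choose_size)
  ultimately have "\<exists>z\<in>?K. \<forall>y\<in>?K. G c (fst z) (snd z) (snd z) \<le> G c (fst y) (snd y) (snd y)"
    by (intro continuous_attains_inf)
  then obtain q0 u0 where z: "q0 \<in> cball p d" "u0 \<in> sphere 0 1"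
    "\<And>q u. q \<in> cball p d \<Longrightarrow> u \<in> sphere 0 1 \<Longrightarrow> G c q0 u0 u0 \<le> G c q u u" by force
  show ?thesis
  proof (rule that[OF d(1), of "G c q0 u0 u0"])
    show "G c q0 u0 u0 > 0" using z d by (intro G_pos[OF assms(1)]) auto
    show "ball p d \<subseteq> chart_img c" using d(2) by auto
    fix q u assume q: "q \<in> ball p d"
    then have qi: "q \<in> chart_img c" using d(2) by auto
    interpret B: bounded_bilinear "G c q" by (rule G_bounded_bilinear[OF assms(1) qi])
    show "G c q0 u0 u0 * (norm u)\<^sup>2 \<le> G c q u u"
    proof (cases "u = 0")
      case False
      have "G c q0 u0 u0 \<le> G c q (u /\<^sub>R norm u) (u /\<^sub>R norm u)" using False q by (intro z(3)) auto
      also have "\<dots> = G c q u u / (norm u)\<^sup>2"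
        by (simp add: B.scaleR_left B.scaleR_right divide_inverse power2_eq_square)
      finally show ?thesis using False by (simp add: field_simps)
    qed (simp add: B.zero_left)
  qed
qed

abbreviation armijo :: "real \<Rightarrow> 'm \<Rightarrow> real \<Rightarrow> bool" where
  "armijo r x \<alpha> \<equiv> r * \<alpha> * (tv_norm g x (grad A g f x))\<^sup>2 \<le> f x - f (step x \<alpha>)"

text \<open>Let \<open>n\<close> be the coordinate norm of the gradient and \<open>N\<close> its
  squared Riemannian norm. The linearization errors of the retraction and of \<open>f\<close> change
  the first-order decrease \<open>\<alpha> * N\<close> by at most
  \<open>Q * \<alpha>\<^sup>2 * n\<^sup>2\<close>. Since \<open>m * n\<^sup>2 \<le> N\<close>, a
  small \<alpha> absorbs this, and the bound on \<alpha> does not degenerate near critical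
  points.\<close>

lemma armijo_locally_uniform:
  assumes r: "r < 1"
  obtains U a0 where "open U" "x \<in> U" "a0 > 0" "\<And>y \<alpha>. y \<in> U \<Longrightarrow> 0 < \<alpha> \<Longrightarrow> \<alpha> < a0 \<Longrightarrow> armijo r y \<alpha>"
proof -
  define c where "c = chart_at A x"
  have c: "c \<in> A" "x \<in> chart_dom c" unfolding c_def by (rule chart_at)+
  define p where "p = snd c x"
  have p: "p \<in> chart_img c" using c by (simp add: p_def)
  have xp: "chart_inv c p = x" unfolding p_def by (rule chart_inv_chart[OF chart[OF c(1)] c(2)])
  obtain d1 C1 where 1: "d1 > 0" "C1 > 0" "ball (p, 0) d1 \<subseteq> Om c c"
    "\<And>z z'. z \<in> ball (p, 0) d1 \<Longrightarrow> z' \<in> ball (p, 0) d1 \<Longrightarrow>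
       norm (F c c z' - F c c z - DF c c z (z' - z)) \<le> C1 * (norm (z' - z))\<^sup>2"
    using Ck_on_2_linearization_error[OF F_Ck[OF c(1,1)] Om_open[OF c(1,1)] zero_in_Om[OF c(1) p]]
    unfolding DF_def by metis
  obtain d2 C2 where 2: "d2 > 0" "C2 > 0" "ball p d2 \<subseteq> chart_img c"
    "\<And>q q'. q \<in> ball p d2 \<Longrightarrow> q' \<in> ball p d2 \<Longrightarrow>
       norm ((f \<circ> chart_inv c) q' - (f \<circ> chart_inv c) q - Df c q (q' - q)) \<le> C2 * (norm (q' - q))\<^sup>2"
    using Ck_on_2_linearization_error[OF f_Ck2[OF c(1)] open_img[OF c(1)] p] unfolding Df_def by metis
  obtain d3 B where 3: "d3 > 0" "B > 0" "ball p d3 \<subseteq> chart_img c"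
    "\<And>q h. q \<in> ball p d3 \<Longrightarrow> \<bar>Df c q h\<bar> \<le> B * norm h"
    using linear_family_locally_bounded[OF open_img[OF c(1)] p Df_linear[OF c(1)] Df_continuous[OF c(1)]] by metis
  obtain d4 m where 4: "d4 > 0" "m > 0" "ball p d4 \<subseteq> chart_img c"
    "\<And>q u. q \<in> ball p d4 \<Longrightarrow> m * (norm u)\<^sup>2 \<le> G c q u u"
    using G_locally_coercive[OF c(1) p] by metis
  obtain d5 K where 5: "d5 > 0" "K > 0"
    "\<And>q q'. q \<in> ball p d5 \<Longrightarrow> q' \<in> ball p d5 \<Longrightarrow> norm (V c q - V c q') \<le> K * norm (q - q')"
    using strict_deriv_lipschitz[OF V_strict_deriv[OF c(1) p]] by metis
  define M where "M = norm (V c p) + K * d5 + 1"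
  have M0: "M > 0" using 5 by (simp add: M_def add_nonneg_pos)
  have M: "norm (V c q) \<le> M" if "q \<in> ball p d5" for q
  proof -
    have "norm (V c q - V c p) \<le> K * norm (q - p)" using that 5 by (intro 5(3)) auto
    also have "\<dots> \<le> K * d5" using that 5 by (intro mult_left_mono) (auto simp: dist_norm norm_minus_commute)
    finally show ?thesis using norm_triangle_sub[of "V c q" "V c p"] by (simp add: M_def)
  qed
  \<comment> \<open>\<open>P\<close> bounds the coordinate displacement of a step relative to
    \<open>\<alpha> * n\<close>. Below, \<open>Q\<close> collects \<open>B * C1\<close>, the
    retraction error seen through the differential, and the error of \<open>f\<close>
    itself.\<close>
  define P where "P = 1 + C1 * M"
  have P: "P > 0" using 1 M0 by (simp add: P_def add_pos_pos)
  define Q where "Q = B * C1 + C2 * P\<^sup>2"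
  have Q: "Q > 0" using 1 2 3 P by (simp add: Q_def add_pos_pos)
  define \<delta> where "\<delta> = Min {d1 / 2, d2 / 2, d3, d4, d5}"
  have \<delta>: "\<delta> > 0" "\<delta> \<le> d1 / 2" "\<delta> \<le> d2 / 2" "\<delta> \<le> d3" "\<delta> \<le> d4" "\<delta> \<le> d5"
    using 1 2 3 4 5 by (auto simp: \<delta>_def)
  \<comment> \<open>The four bounds in turn give \<open>\<alpha> * n \<le> M\<close>, keep the
    tangent vector where the retraction estimate holds, keep the new point where the estimate for
    \<open>f\<close> holds, and make \<open>Q * \<alpha> \<le> (1 - r) * m\<close>.\<close>
  define a0 where "a0 = Min {1, d1 / (2 * M), d2 / (2 * M * P), (1 - r) * m / Q}"
  have a0: "a0 > 0" "a0 \<le> 1" "a0 \<le> d1 / (2 * M)" "a0 \<le> d2 / (2 * M * P)" "a0 \<le> (1 - r) * m / Q"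
    using 1 2 4 M0 P Q r by (auto simp: a0_def)
  have sub: "ball p \<delta> \<subseteq> chart_img c" using \<delta> 3 by auto
  show ?thesis
  proof (rule that[of "chart_inv c ` ball p \<delta>" a0])
    show "open (chart_inv c ` ball p \<delta>)" by (rule open_chart_inv_image[OF chart[OF c(1)] open_ball sub])
    show "x \<in> chart_inv c ` ball p \<delta>" using \<delta>(1) xp by (intro image_eqI[of _ _ p]) auto
    show "a0 > 0" by (rule a0)
    fix y \<alpha> assume "y \<in> chart_inv c ` ball p \<delta>" and \<alpha>: "0 < \<alpha>" "\<alpha> < a0"
    then obtain q where q: "q \<in> ball p \<delta>" "y = chart_inv c q" by blast
    have qi: "q \<in> chart_img c" using q sub by blast
    have qd: "q \<in> ball p d2" "q \<in> ball p d3" "q \<in> ball p d4" "q \<in> ball p d5" using q(1) \<delta> 2(1) by auto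
    let ?v = "V c q" let ?q' = "F c c (q, - \<alpha> *\<^sub>R ?v)"
    define n where "n = norm ?v"
    have n: "0 \<le> n" "n \<le> M" using M[OF qd(4)] by (auto simp: n_def)
    have "\<alpha> * n \<le> \<alpha> * M" using n \<alpha> by (intro mult_left_mono) auto
    also have "\<dots> < d1 / (2 * M) * M" using \<alpha> a0 M0 by (intro mult_strict_right_mono) auto
    also have "\<dots> = d1 / 2" using M0 by simp
    finally have an: "\<alpha> * n < d1 / 2" .
    have dq: "norm (q - p) < \<delta>" using q(1) by (simp add: dist_norm norm_minus_commute)
    have z: "(q, 0) \<in> ball (p, 0) d1"
      using dq \<delta>(2) 1(1) by (simp add: dist_Pair_Pair dist_norm norm_minus_commute)
    have "norm ((q, - \<alpha> *\<^sub>R ?v) - (p, 0)) \<le> norm (q - p) + norm (- \<alpha> *\<^sub>R ?v)"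
      using norm_Pair_le[of "q - p" "- \<alpha> *\<^sub>R ?v"] by simp
    also have "\<dots> < d1" using dq \<delta>(2) an \<alpha> by (simp add: n_def)
    finally have z': "(q, - \<alpha> *\<^sub>R ?v) \<in> ball (p, 0) d1" by (simp only: mem_ball dist_norm norm_minus_commute)
    have zO: "(q, - \<alpha> *\<^sub>R ?v) \<in> Om c c" using z' 1(3) by blast
    have Fq: "F c c (q, 0) = q" by (simp add: F_def R_zero[OF c(1) qi] chart_chart_inv[OF qi])
    have zz: "(q, - \<alpha> *\<^sub>R ?v) - (q, 0) = (0, - \<alpha> *\<^sub>R ?v)" by simp
    \<comment> \<open>Expanding at the zero vector over \<open>q\<close>, where the fibre derivative
      is the identity, leaves an error quadratic in the gradient.\<close>
    have T1: "norm (?q' - q + \<alpha> *\<^sub>R ?v) \<le> C1 * (\<alpha> * n)\<^sup>2"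
      using 1(4)[OF z z'] \<alpha> unfolding zz Fq DF_zero_fibre[OF c(1) qi] by (simp add: n_def)
    have "norm (?q' - q) \<le> \<alpha> * n + C1 * (\<alpha> * n)\<^sup>2"
      using norm_triangle_ineq4[of "?q' - q + \<alpha> *\<^sub>R ?v" "\<alpha> *\<^sub>R ?v"] T1 \<alpha> by (simp add: n_def)
    also have "\<dots> = \<alpha> * n * (1 + C1 * (\<alpha> * n))" by (simp add: power2_eq_square algebra_simps)
    also have "\<dots> \<le> \<alpha> * n * P" unfolding P_def
    proof (intro mult_left_mono add_left_mono)
      have "\<alpha> * n \<le> 1 * M" using \<alpha> a0 n by (intro mult_mono) auto
      then show "\<alpha> * n \<le> M" by simp
    qed (use 1 \<alpha> n in auto)
    finally have T2: "norm (?q' - q) \<le> \<alpha> * n * P" .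
    have "\<alpha> * n * P \<le> \<alpha> * (M * P)" using n \<alpha> P by (simp add: mult.assoc mult_right_mono)
    also have "\<dots> < d2 / (2 * M * P) * (M * P)" using \<alpha> a0 M0 P by (intro mult_strict_right_mono) auto
    also have "\<dots> = d2 / 2" using M0 P by simp
    finally have "norm (?q' - q) < d2 / 2" using T2 by simp
    then have "norm (?q' - p) < d2"
      using norm_triangle_ineq[of "?q' - q" "q - p"] dq \<delta>(3) by simp
    then have q'd: "?q' \<in> ball p d2" by (simp add: dist_norm norm_minus_commute)
    have stepd: "step y \<alpha> \<in> chart_dom c" "step y \<alpha> = chart_inv c ?q'"
    proof -
      have "(q, \<alpha>) \<in> Dom c c" using Dom_iff[OF c(1) qi] zO by simp
      then show sd: "step y \<alpha> \<in> chart_dom c" by (simp add: Dom_def q(2))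
      have "?q' = snd c (step y \<alpha>)" by (simp add: F_def step_eq_bm[OF c(1) qi] q(2))
      then show "step y \<alpha> = chart_inv c ?q'" using chart_inv_chart[OF chart[OF c(1)] sd] by simp
    qed
    define N where "N = Df c q ?v"
    have mN: "m * n\<^sup>2 \<le> N" using 4(4)[OF qd(3), of ?v] G_V[OF c(1) qi, of ?v] by (simp add: N_def n_def)
    have "f (step y \<alpha>) - f y - Df c q (?q' - q) \<le> C2 * (norm (?q' - q))\<^sup>2"
    proof -
      have "(f \<circ> chart_inv c) ?q' = f (step y \<alpha>)" unfolding stepd(2) by (rule comp_apply)
      moreover have "(f \<circ> chart_inv c) q = f y" unfolding q(2) by (rule comp_apply)
      ultimately show ?thesis using 2(4)[OF qd(1) q'd] by (simp only: real_norm_def abs_le_iff)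
    qed
    also have "\<dots> \<le> C2 * (\<alpha> * n * P)\<^sup>2" using T2 2(2) by (intro mult_left_mono power_mono) auto
    finally have U1: "f (step y \<alpha>) - f y \<le> Df c q (?q' - q) + C2 * (\<alpha> * n * P)\<^sup>2" by simp
    have "Df c q (?q' - q) = Df c q ((?q' - q + \<alpha> *\<^sub>R ?v) - \<alpha> *\<^sub>R ?v)" by simp
    also have "\<dots> = Df c q (?q' - q + \<alpha> *\<^sub>R ?v) - \<alpha> * N"
      by (simp only: linear_diff[OF Df_linear[OF c(1) qi]] linear_scale[OF Df_linear[OF c(1) qi]] N_def real_scaleR_def)
    also have "\<dots> \<le> B * (C1 * (\<alpha> * n)\<^sup>2) - \<alpha> * N"
    proof -
      have "Df c q (?q' - q + \<alpha> *\<^sub>R ?v) \<le> B * norm (?q' - q + \<alpha> *\<^sub>R ?v)"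
        using 3(4)[OF qd(2), of "?q' - q + \<alpha> *\<^sub>R ?v"] by linarith
      also have "\<dots> \<le> B * (C1 * (\<alpha> * n)\<^sup>2)" using T1 3(2) by (intro mult_left_mono) auto
      finally show ?thesis by simp
    qed
    finally have "f (step y \<alpha>) - f y \<le> B * (C1 * (\<alpha> * n)\<^sup>2) - \<alpha> * N + C2 * (\<alpha> * n * P)\<^sup>2"
      using U1 by linarith
    also have "\<dots> = Q * \<alpha> * \<alpha> * n\<^sup>2 - \<alpha> * N" by (simp add: Q_def power2_eq_square algebra_simps)
    also have "\<dots> \<le> (1 - r) * \<alpha> * N - \<alpha> * N"
    proof -
      have "Q * \<alpha> \<le> Q * ((1 - r) * m / Q)" using \<alpha> a0 Q by (intro mult_left_mono) auto
      also have "\<dots> = (1 - r) * m" using Q by simp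
      finally have "Q * \<alpha> * (\<alpha> * n\<^sup>2) \<le> (1 - r) * m * (\<alpha> * n\<^sup>2)" using \<alpha> by (intro mult_right_mono) auto
      also have "\<dots> = (1 - r) * \<alpha> * (m * n\<^sup>2)" by simp
      also have "\<dots> \<le> (1 - r) * \<alpha> * N" using mN r \<alpha> by (intro mult_left_mono) auto
      finally show ?thesis by (simp add: mult.assoc)
    qed
    finally have "r * \<alpha> * N \<le> f y - f (step y \<alpha>)" by (simp add: algebra_simps)
    then show "armijo r y \<alpha>"
      using grad_norm_square(2,3)[OF c(1) qi] by (simp add: N_def q(2))
  qed
qed

section \<open>The backtracking loop and converging runs\<close>

lemma backtrack_unfold:
  "backtrack A g R f \<tau> r x \<alpha> = (if armijo r x \<alpha> then \<alpha> else backtrack A g R f \<tau> r x (\<tau> * \<alpha>))"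
  unfolding backtrack_def
  by (subst while_unfold) (simp add: not_less)

text \<open>The value of \<open>while\<close> is meaningful only if the loop stops. An exponent
  satisfying the Armijo condition bounds the number of iterations, though the loop may stop earlier
  with a smaller \<open>k\<close>.\<close>

lemma backtrack_power:
  assumes "armijo r x (\<tau> ^ n * \<alpha>)"
  shows "\<exists>k. backtrack A g R f \<tau> r x \<alpha> = \<tau> ^ k * \<alpha>"
  using assms
proof (induction n arbitrary: \<alpha>)
  case 0
  then have "backtrack A g R f \<tau> r x \<alpha> = \<tau> ^ 0 * \<alpha>" by (subst backtrack_unfold) simp
  then show ?case by blast
next
  case (Suc n)
  show ?case
  proof (cases "armijo r x \<alpha>")
    case True
    then have "backtrack A g R f \<tau> r x \<alpha> = \<tau> ^ 0 * \<alpha>" by (subst backtrack_unfold) simp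
    then show ?thesis by blast
  next
    case False
    have "armijo r x (\<tau> ^ n * (\<tau> * \<alpha>))" using Suc.prems by (simp add: mult.assoc mult.left_commute)
    then obtain k where "backtrack A g R f \<tau> r x (\<tau> * \<alpha>) = \<tau> ^ k * (\<tau> * \<alpha>)" using Suc.IH by blast
    then have "backtrack A g R f \<tau> r x \<alpha> = \<tau> ^ Suc k * \<alpha>"
      using False by (subst backtrack_unfold) (simp add: mult.assoc mult.left_commute)
    then show ?thesis by blast
  qed
qed

lemma backtrack_is_power:
  assumes "0 < \<tau>" "\<tau> < 1" "r < 1" "0 < \<alpha>"
  shows "\<exists>k. backtrack A g R f \<tau> r x \<alpha> = \<tau> ^ k * \<alpha>"
proof -
  obtain U a0 where U: "x \<in> U" "a0 > 0" "\<And>y \<alpha>. y \<in> U \<Longrightarrow> 0 < \<alpha> \<Longrightarrow> \<alpha> < a0 \<Longrightarrow> armijo r y \<alpha>"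
    using armijo_locally_uniform[OF assms(3), of x] by metis
  obtain n where "\<tau> ^ n < a0 / \<alpha>" using real_arch_pow_inv[of "a0 / \<alpha>" \<tau>] U assms by auto
  then have "\<tau> ^ n * \<alpha> < a0" using assms by (simp add: pos_less_divide_eq)
  then show ?thesis using assms by (intro backtrack_power U(3)[OF U(1)]) auto
qed

text \<open>Near the limit, step sizes are no longer reset, and those below \<open>a0\<close> are
  accepted unchanged, so \<open>eventually_constant_geometric\<close> applies. The finitely many
  earlier steps are recorded by their exponents, which leaves countably many prefixes.\<close>

lemma converging_run_eventually_fixed_step:
  assumes \<tau>: "0 < \<tau>" "\<tau> < 1" and r: "r < 1" and \<epsilon>: "0 < \<epsilon>" and a: "0 < a"
    and crit: "grad A g f x = tv_zero" and conv: "stabilized_rgd A g R f \<tau> r \<epsilon> a x0 \<longlonglongrightarrow> x"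
  shows "\<exists>ks k. (\<lambda>n. ((\<lambda>y. step y (\<tau> ^ k * a)) ^^ n) (fold (\<lambda>k y. step y (\<tau> ^ k * a)) ks x0)) \<longlonglongrightarrow> x"
proof -
  define X where "X t = fst (stabilized_rgd_state A g R f \<tau> r \<epsilon> a x0 t)" for t
  define s where "s t = snd (stabilized_rgd_state A g R f \<tau> r \<epsilon> a x0 t)" for t
  define b where "b t = backtrack A g R f \<tau> r (X t) (s t)" for t
  have X0: "X 0 = x0" "s 0 = a" by (simp_all add: X_def s_def)
  have XS: "X (Suc t) = step (X t) (b t)" for t
    by (simp add: X_def s_def b_def split_beta Let_def)
  have sS: "s (Suc t) = (if tv_norm g (X (Suc t)) (grad A g f (X (Suc t))) \<ge> \<epsilon> then a else b t)" for t
    by (simp add: X_def s_def b_def split_beta Let_def)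
  have conv: "X \<longlonglongrightarrow> x"
  proof -
    have "stabilized_rgd A g R f \<tau> r \<epsilon> a x0 = X" by (simp add: fun_eq_iff stabilized_rgd_def X_def)
    then show ?thesis using conv by simp
  qed
  have spos: "0 < \<tau> ^ k * a" for k using \<tau> a by simp
  have pw: "\<exists>k. s t = \<tau> ^ k * a" for t
  proof (induction t)
    case 0
    show ?case by (rule exI[of _ 0]) (simp add: X0)
  next
    case (Suc t)
    then obtain k where k: "s t = \<tau> ^ k * a" by blast
    obtain l where "b t = \<tau> ^ l * s t"
      using backtrack_is_power[OF \<tau> r, of "s t" "X t"] spos k unfolding b_def by auto
    then have "b t = \<tau> ^ (l + k) * a" by (simp add: k power_add)
    moreover have "a = \<tau> ^ 0 * a" by simp
    ultimately show ?case unfolding sS by metis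
  qed
  have s0: "s t > 0" for t using pw[of t] spos by metis
  have bpow: "\<exists>l. b t = \<tau> ^ l * s t" for t
    unfolding b_def by (rule backtrack_is_power[OF \<tau> r s0])
  have bpw: "\<exists>k. b t = \<tau> ^ k * a" for t
  proof -
    obtain k l where "s t = \<tau> ^ k * a" "b t = \<tau> ^ l * s t" using pw bpow by metis
    then have "b t = \<tau> ^ (l + k) * a" by (simp add: power_add)
    then show ?thesis by blast
  qed
  have ble: "b t \<le> s t" for t
  proof -
    obtain l where "b t = \<tau> ^ l * s t" using bpow by blast
    moreover have "\<tau> ^ l \<le> 1" using \<tau> by (simp add: power_le_one)
    ultimately show ?thesis using s0[of t] mult_right_mono[of "\<tau> ^ l" 1 "s t"] by simp
  qed
  obtain U where U: "open U" "x \<in> U" "\<And>y. y \<in> U \<Longrightarrow> tv_norm g y (grad A g f y) < \<epsilon>"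
    using grad_norm_small_near_critical[OF crit \<epsilon>] by blast
  obtain U' a0 where U': "open U'" "x \<in> U'" "a0 > 0"
    "\<And>y \<alpha>. y \<in> U' \<Longrightarrow> 0 < \<alpha> \<Longrightarrow> \<alpha> < a0 \<Longrightarrow> armijo r y \<alpha>"
    using armijo_locally_uniform[OF r, of x] by metis
  have "\<forall>\<^sub>F t in sequentially. X t \<in> U \<inter> U'"
    using topological_tendstoD[OF conv, of "U \<inter> U'"] U U' by auto
  then obtain T where T: "\<And>t. t \<ge> T \<Longrightarrow> X t \<in> U" "\<And>t. t \<ge> T \<Longrightarrow> X t \<in> U'"
    unfolding eventually_sequentially by blast
  \<comment> \<open>The reset test looks at the new iterate \<open>X (Suc t)\<close>, which already
    lies where the gradient norm is below \<epsilon>; hence the accepted step size is carried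
    over.\<close>
  have sb: "s (Suc t) = b t" if "t \<ge> T" for t
    using U(3)[OF T(1), of "Suc t"] that by (simp add: sS)
  have bs: "b t = s t" if "t \<ge> T" "s t < a0" for t
    unfolding b_def using U'(4)[OF T(2)[OF that(1)] s0 that(2)] by (subst backtrack_unfold) simp
  have dec: "s (Suc t) \<le> s t" if "t \<ge> T" for t using sb[OF that] ble[of t] by simp
  have const: "s (Suc t) = s t" if "t \<ge> T" "s t < a0" for t using sb[OF that(1)] bs[OF that] by simp
  obtain T' where T': "T' \<ge> T" "\<And>t. t \<ge> T' \<Longrightarrow> s t = s T'"
    using eventually_constant_geometric[where s=s and T=T, OF \<tau> a U'(3) pw dec const] by blast
  obtain k where k: "s T' = \<tau> ^ k * a" using pw by blast
  have XT: "X (n + T') = ((\<lambda>y. step y (\<tau> ^ k * a)) ^^ n) (X T')" for n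
  proof (induction n)
    case (Suc n)
    have "b (n + T') = \<tau> ^ k * a"
      using sb[of "n + T'"] T'(1) T'(2)[of "Suc (n + T')"] k by simp
    then show ?case using XS[of "n + T'"] Suc by simp
  qed simp
  have "\<exists>ks. X t = fold (\<lambda>k y. step y (\<tau> ^ k * a)) ks x0" for t
  proof (induction t)
    case 0
    show ?case by (rule exI[of _ "[]"]) (simp add: X0)
  next
    case (Suc t)
    then obtain ks where "X t = fold (\<lambda>k y. step y (\<tau> ^ k * a)) ks x0" by blast
    moreover obtain l where "b t = \<tau> ^ l * a" using bpw by blast
    ultimately have "X (Suc t) = fold (\<lambda>k y. step y (\<tau> ^ k * a)) (ks @ [l]) x0" by (simp add: XS)
    then show ?case by blast
  qed
  then obtain ks where ks: "X T' = fold (\<lambda>k y. step y (\<tau> ^ k * a)) ks x0" by blast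
  have "(\<lambda>n. X (n + T')) \<longlonglongrightarrow> x" using conv by (rule LIMSEQ_ignore_initial_segment)
  then show ?thesis unfolding XT ks by blast
qed

text \<open>The null set belonging to the constant phase is pulled back through the prefix one
  regular step at a time, and the union runs over the countable set of prefixes and final
  exponents.\<close>

lemma saddle_avoidance_of_regular_steps:
  assumes \<tau>: "0 < \<tau>" "\<tau> < 1" and r: "r < 1" and \<epsilon>: "0 < \<epsilon>" and a: "0 < a"
    and reg: "\<And>k. regular_step (\<tau> ^ k * a)"
  shows "mnull {x0. \<exists>x. strict_saddle A g f x \<and> stabilized_rgd A g R f \<tau> r \<epsilon> a x0 \<longlonglongrightarrow> x}"
proof -
  define W where "W k = {y. \<exists>x. strict_saddle A g f x \<and> (\<lambda>n. ((\<lambda>y. step y (\<tau> ^ k * a)) ^^ n) y) \<longlonglongrightarrow> x}" for k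
  have W: "mnull (W k)" for k
    unfolding W_def by (rule mnull_converge_to_strict_saddle[OF reg]) (use \<tau> a in simp)
  have pre: "mnull {x0. fold (\<lambda>k y. step y (\<tau> ^ k * a)) ks x0 \<in> W k}" for ks k
  proof (induction ks)
    case Nil
    show ?case using W by simp
  next
    \<comment> \<open>\<open>fold\<close> performs the head of the list first, so the set for
      \<open>l # ks\<close> is the preimage of the set for \<open>ks\<close> under the step with
      exponent \<open>l\<close>.\<close>
    case (Cons l ks)
    from mnull_step_preimage[OF reg[of l] Cons] show ?case by simp
  qed
  have "mnull (\<Union>(ks, k)\<in>UNIV. {x0. fold (\<lambda>k y. step y (\<tau> ^ k * a)) ks x0 \<in> W k})"
    using pre by (intro mnull_UN) auto
  then show ?thesis
  proof (rule mnull_subset, clarify)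
    fix x0 x assume x: "strict_saddle A g f x" "stabilized_rgd A g R f \<tau> r \<epsilon> a x0 \<longlonglongrightarrow> x"
    have "grad A g f x = tv_zero" using x(1) by (simp add: strict_saddle_def)
    from converging_run_eventually_fixed_step[OF \<tau> r \<epsilon> a this x(2)] x(1)
    show "x0 \<in> (\<Union>(ks, k)\<in>UNIV. {x0. fold (\<lambda>k y. step y (\<tau> ^ k * a)) ks x0 \<in> W k})"
      unfolding W_def by blast
  qed
qed

end

theorem theorem1p4:
  fixes A :: "('m::{t2_space, second_countable_topology}, 'e::euclidean_space) chart set"
    and g :: "('m, 'e) metric"
    and R :: "'m \<Rightarrow> ('m, 'e) tangent_vector \<Rightarrow> 'm"
    and f :: "'m \<Rightarrow> real"
    and \<tau> r \<epsilon> :: real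
  assumes "real_analytic_atlas A"
    and "riemannian_metric A g"
    and "is_retraction A R"
    and "real_analytic_bundle_map A R"
    and "C2_function A f"
    and "0 < \<tau>" "\<tau> < 1"
    and "0 < r" "r < 1"
    and "0 < \<epsilon>"
  shows "AE \<alpha>bar in lebesgue. \<alpha>bar > 0 \<longrightarrow>
    manifold_measure_zero A
      {x0. \<exists>x. strict_saddle A g f x \<and> stabilized_rgd A g R f \<tau> r \<epsilon> \<alpha>bar x0 \<longlonglongrightarrow> x}"
proof -
  interpret riemannian_retraction A g R f by unfold_locales (fact assms)+
  have "AE a in lebesgue. \<forall>k. regular_step (\<tau> ^ k * a)"
    using AE_lebesgue_scaled_powers[OF AE_regular_step] assms by simp
  then show ?thesis
  proof (rule AE_mp, intro AE_I2 impI)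
    fix a assume "\<forall>k. regular_step (\<tau> ^ k * a)" "0 < a"
    then show "manifold_measure_zero A
        {x0. \<exists>x. strict_saddle A g f x \<and> stabilized_rgd A g R f \<tau> r \<epsilon> a x0 \<longlonglongrightarrow> x}"
      using assms by (intro mnull_imp_manifold_measure_zero saddle_avoidance_of_regular_steps) auto
  qed
qed

end
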